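(* Let $k$ be a field of characteristic $0$. If $\mathcal L$ and $\mathcal L'$ are fgc centreless Lie tori over $k$ that are isomorphic as $k$-algebras, then they have the same root-grading type, the same nullity, the same centroid rank ($\mathrm{crk}(\mathcal L)=\mathrm{crk}(\mathcal L')$) and the same root-space rank vector ($\mathrm{rkv}(\mathcal L)=\mathrm{rkv}(\mathcal L')$).
   Context: An irreducible finite root system is a finite subset $\Delta$ of a finite-dimensional vector space with $0\in\Delta$ and $\Delta^\times:=\Delta\setminus\{0\}$ an irreducible (possibly non-reduced) root system in the usual sense; $Q=\mathrm{span}_{\mathbb Z}\Delta$, $\alpha^\vee$ coroots, $\Delta^\times_{\mathrm{ind}}=\Delta^\times\setminus2\Delta^\times$. Let $\Lambda$ be a finitely generated free abelian group. A Lie torus of type $(\Delta,\Lambda)$ is a Lie algebra $\mathcal L$ over $k$ with a $Q\times\Lambda$-grading $\mathcal L=\bigoplus\mathcal L_\alpha^\lambda$ ($\mathcal L_\alpha:=\bigoplus_\lambda\mathcal L_\alpha^\lambda$, $\mathcal L^\lambda:=\bigoplus_\alpha\mathcal L_\alpha^\lambda$) such that: (LT1) $\{\alpha:\mathcal L_\alpha\neq0\}=\Delta$; (LT2)(i) $\mathcal L_\alpha^0\neq0$ for $\alpha\in\Delta^\times_{\mathrm{ind}}$; (ii) whenever $\alpha\in\Delta^\times$ and $\mathcal L_\alpha^\lambda\ne0$ there are $e\in\mathcal L_\alpha^\lambda$, $f\in\mathcal L_{-\alpha}^{-\lambda}$ with $\mathcal L_\alpha^\lambda=ke$, $\mathcal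 L_{-\alpha}^{-\lambda}=kf$, $[[e,f],x]=\langle\beta,\alpha^\vee\rangle x$ for $x\in\mathcal L_\beta$, $\beta\in Q$; (LT3) $\mathcal L$ is generated by the $\mathcal L_\alpha$, $\alpha\in\Delta^\times$; (LT4) $\Lambda$ is generated by $\{\lambda:\mathcal L^\lambda\ne0\}$. Root-grading type = type of $\Delta$; nullity = $\mathrm{rank}_{\mathbb Z}\Lambda$. Centroid $C=\{c\in\mathrm{End}_k\mathcal L:c[x,y]=[cx,y]=[x,cy]\}$; fgc = finitely generated over $C$; centreless = zero centre. For fgc centreless $\mathcal L$, $\mathcal L$ and each $\mathcal L_\alpha$ are free $C$-modules of finite rank; the centroid rank is $\mathrm{crk}(\mathcal L):=\mathrm{rank}_C(\mathcal L)$. $\mathrm{rank}_C(\mathcal L_\alpha)$ for $\alpha\in\Delta^\times$ depends only on the length of $\alpha$. Short roots: minimal length in $\Delta^\times$; extra-long: in $\Delta^\times\cap2\Delta^\times$; long: the others. Let $\mathrm{rk_{sh}},\mathrm{rk_{lg}},\mathrm{rk_{ex}}$ be $\mathrm{rank}_C(\mathcal L_\alpha)$ for $\alpha$ short, long, extra-long. The root-space rank vector $\mathrm{rkv}(\mathcal L)$ is $(\mathrm{rk_{sh}})$ if $\Delta$ is reduced and simply laced; $(\mathrm{rk_{sh}},\mathrm{rk_{lg}})$ if reduced and not simply laced; $(\mathrm{rk_{sh}},\mathrm{rk_{ex}})$ if of type $BC_1$; $(\mathrm{rk_{sh}},\mathrm{rk_{lg}},\mathrm{rk_{ex}})$ if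 of type $BC_\ell$, $\ell\ge2$. *)

theory Defs
  imports "HOL-Analysis.Analysis" "HOL-Library.Function_Algebras"
begin

text \<open>D is meant to be the set of nonzero roots.  A root system in the usual
(Bourbaki) sense, possibly non-reduced, in the real span of D.\<close>

definition root_system :: "'v::real_vector set \<Rightarrow> bool" where
  "root_system D \<longleftrightarrow> finite D \<and> 0 \<notin> D \<and>
     (\<forall>\<alpha>\<in>D. \<exists>f::'v \<Rightarrow> real. linear f \<and> f \<alpha> = 2 \<and>
        (\<forall>\<beta>\<in>D. \<beta> - f \<beta> *\<^sub>R \<alpha> \<in> D) \<and> (\<forall>\<beta>\<in>D. f \<beta> \<in> \<int>))"

text \<open>The coroot of alpha, as a linear functional (unique on the span of D).\<close>
definition coroot :: "'v::real_vector set \<Rightarrow> 'v \<Rightarrow> 'v \<Rightarrow> real" where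
  "coroot D \<alpha> = (SOME f. linear f \<and> f \<alpha> = 2 \<and> (\<forall>\<beta>\<in>D. \<beta> - f \<beta> *\<^sub>R \<alpha> \<in> D))"

definition irreducible_rs :: "'v::real_vector set \<Rightarrow> bool" where
  "irreducible_rs D \<longleftrightarrow> root_system D \<and> D \<noteq> {} \<and>
     \<not> (\<exists>A B. A \<noteq> {} \<and> B \<noteq> {} \<and> A \<union> B = D \<and> A \<inter> B = {} \<and>
              (\<forall>\<alpha>\<in>A. \<forall>\<beta>\<in>B. coroot D \<alpha> \<beta> = 0))"

definition irr_finite_rs :: "'v::real_vector set \<Rightarrow> bool" where
  "irr_finite_rs \<Delta> \<longleftrightarrow> finite \<Delta> \<and> 0 \<in> \<Delta> \<and> irreducible_rs (\<Delta> - {0})"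

definition root_lattice :: "'v::real_vector set \<Rightarrow> 'v set" where
  "root_lattice \<Delta> = {x. \<exists>F c. finite F \<and> F \<subseteq> \<Delta> \<and> x = (\<Sum>\<alpha>\<in>F. of_int (c \<alpha>) *\<^sub>R \<alpha>)}"

text \<open>Canonical Weyl-invariant form, used to measure root lengths.\<close>
definition rs_form :: "'v::real_vector set \<Rightarrow> 'v \<Rightarrow> 'v \<Rightarrow> real" where
  "rs_form D x y = (\<Sum>\<gamma>\<in>D. coroot D \<gamma> x * coroot D \<gamma> y)"

definition short_root :: "'v::real_vector set \<Rightarrow> 'v \<Rightarrow> bool" where
  "short_root D \<alpha> \<longleftrightarrow> \<alpha> \<in> D \<and> (\<forall>\<beta>\<in>D. rs_form D \<alpha> \<alpha> \<le> rs_form D \<beta> \<beta>)"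

definition extralong_root :: "'v::real_vector set \<Rightarrow> 'v \<Rightarrow> bool" where
  "extralong_root D \<alpha> \<longleftrightarrow> \<alpha> \<in> D \<and> \<alpha> \<in> (\<lambda>x. 2 *\<^sub>R x) ` D"

definition long_root :: "'v::real_vector set \<Rightarrow> 'v \<Rightarrow> bool" where
  "long_root D \<alpha> \<longleftrightarrow> \<alpha> \<in> D \<and> \<not> short_root D \<alpha> \<and> \<not> extralong_root D \<alpha>"

definition reduced_rs :: "'v::real_vector set \<Rightarrow> bool" where
  "reduced_rs D \<longleftrightarrow> (\<forall>\<alpha>\<in>D. 2 *\<^sub>R \<alpha> \<notin> D)"

definition simply_laced :: "'v::real_vector set \<Rightarrow> bool" where
  "simply_laced D \<longleftrightarrow> (\<forall>\<alpha>\<in>D. \<forall>\<beta>\<in>D. rs_form D \<alpha> \<alpha> = rs_form D \<beta> \<beta>)"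

text \<open>Same type = isomorphic root systems.\<close>
definition rs_iso :: "'v::real_vector set \<Rightarrow> 'w::real_vector set \<Rightarrow> bool" where
  "rs_iso \<Delta> \<Delta>' \<longleftrightarrow> (\<exists>\<phi>::'v \<Rightarrow> 'w. linear \<phi> \<and> inj_on \<phi> (span \<Delta>) \<and> \<phi> ` \<Delta> = \<Delta>')"

definition ksubspace :: "('k::field \<Rightarrow> 'a::ab_group_add \<Rightarrow> 'a) \<Rightarrow> 'a set \<Rightarrow> bool" where
  "ksubspace sc S \<longleftrightarrow> 0 \<in> S \<and> (\<forall>x\<in>S. \<forall>y\<in>S. x + y \<in> S) \<and> (\<forall>a. \<forall>x\<in>S. sc a x \<in> S)"

definition lie_algebra :: "('k::field \<Rightarrow> 'a::ab_group_add \<Rightarrow> 'a) \<Rightarrow> ('a \<Rightarrow> 'a \<Rightarrow> 'a) \<Rightarrow> bool" where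
  "lie_algebra sc br \<longleftrightarrow> vector_space sc \<and>
     (\<forall>x y z. br (x + y) z = br x z + br y z) \<and>
     (\<forall>x y z. br x (y + z) = br x y + br x z) \<and>
     (\<forall>a x y. br (sc a x) y = sc a (br x y)) \<and>
     (\<forall>a x y. br x (sc a y) = sc a (br x y)) \<and>
     (\<forall>x. br x x = 0) \<and>
     (\<forall>x y z. br x (br y z) + br y (br z x) + br z (br x y) = 0)"

definition lie_alg_iso ::
  "('k::field \<Rightarrow> 'a::ab_group_add \<Rightarrow> 'a) \<Rightarrow> ('a \<Rightarrow> 'a \<Rightarrow> 'a) \<Rightarrow>
   ('k \<Rightarrow> 'b::ab_group_add \<Rightarrow> 'b) \<Rightarrow> ('b \<Rightarrow> 'b \<Rightarrow> 'b) \<Rightarrow> ('a \<Rightarrow> 'b) \<Rightarrow> bool" where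
  "lie_alg_iso sc br sc' br' \<phi> \<longleftrightarrow> bij \<phi> \<and>
     (\<forall>x y. \<phi> (x + y) = \<phi> x + \<phi> y) \<and> (\<forall>a x. \<phi> (sc a x) = sc' a (\<phi> x)) \<and>
     (\<forall>x y. \<phi> (br x y) = br' (\<phi> x) (\<phi> y))"

definition lie_subalgebra :: "('k::field \<Rightarrow> 'a::ab_group_add \<Rightarrow> 'a) \<Rightarrow> ('a \<Rightarrow> 'a \<Rightarrow> 'a) \<Rightarrow> 'a set \<Rightarrow> bool" where
  "lie_subalgebra sc br S \<longleftrightarrow> ksubspace sc S \<and> (\<forall>x\<in>S. \<forall>y\<in>S. br x y \<in> S)"

definition centreless :: "('a::ab_group_add \<Rightarrow> 'a \<Rightarrow> 'a) \<Rightarrow> bool" where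
  "centreless br \<longleftrightarrow> {z. \<forall>x. br z x = 0} = {0}"

definition centroid :: "('k::field \<Rightarrow> 'a::ab_group_add \<Rightarrow> 'a) \<Rightarrow> ('a \<Rightarrow> 'a \<Rightarrow> 'a) \<Rightarrow> ('a \<Rightarrow> 'a) set" where
  "centroid sc br = {c. (\<forall>x y. c (x + y) = c x + c y) \<and> (\<forall>a x. c (sc a x) = sc a (c x)) \<and>
       (\<forall>x y. c (br x y) = br (c x) y \<and> c (br x y) = br x (c y))}"

definition fgc :: "('k::field \<Rightarrow> 'a::ab_group_add \<Rightarrow> 'a) \<Rightarrow> ('a \<Rightarrow> 'a \<Rightarrow> 'a) \<Rightarrow> bool" where
  "fgc sc br \<longleftrightarrow> (\<exists>F. finite F \<and> (\<forall>x. \<exists>c. (\<forall>f\<in>F. c f \<in> centroid sc br) \<and> x = (\<Sum>f\<in>F. c f f)))"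

definition cbasis :: "('a \<Rightarrow> 'a) set \<Rightarrow> 'a::ab_group_add set \<Rightarrow> 'a set \<Rightarrow> bool" where
  "cbasis C M B \<longleftrightarrow> finite B \<and>
     M = {x. \<exists>c. (\<forall>b\<in>B. c b \<in> C) \<and> x = (\<Sum>b\<in>B. c b b)} \<and>
     (\<forall>c. (\<forall>b\<in>B. c b \<in> C) \<and> (\<Sum>b\<in>B. c b b) = 0 \<longrightarrow> (\<forall>b\<in>B. c b = (\<lambda>_. 0)))"

definition crank :: "('a \<Rightarrow> 'a) set \<Rightarrow> 'a::ab_group_add set \<Rightarrow> nat" where
  "crank C M = card (SOME B. cbasis C M B)"

definition crk :: "('k::field \<Rightarrow> 'a::ab_group_add \<Rightarrow> 'a) \<Rightarrow> ('a \<Rightarrow> 'a \<Rightarrow> 'a) \<Rightarrow> nat" where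
  "crk sc br = crank (centroid sc br) UNIV"

definition fsums :: "('i \<Rightarrow> 'a::comm_monoid_add set) \<Rightarrow> 'a set" where
  "fsums A = {x. \<exists>I c. finite I \<and> (\<forall>i\<in>I. c i \<in> A i) \<and> x = sum c I}"

text \<open>Lambda is modelled as Z^n = functions nat => int vanishing from n on.\<close>
definition lat :: "nat \<Rightarrow> (nat \<Rightarrow> int) set" where
  "lat n = {l. \<forall>i\<ge>n. l i = 0}"

definition root_space :: "('v \<Rightarrow> (nat \<Rightarrow> int) \<Rightarrow> 'a::comm_monoid_add set) \<Rightarrow> 'v \<Rightarrow> 'a set" where
  "root_space gr \<alpha> = fsums (gr \<alpha>)"

definition lat_space :: "('v \<Rightarrow> (nat \<Rightarrow> int) \<Rightarrow> 'a::comm_monoid_add set) \<Rightarrow> (nat \<Rightarrow> int) \<Rightarrow> 'a set" where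
  "lat_space gr l = fsums (\<lambda>\<alpha>. gr \<alpha> l)"

definition lie_torus ::
  "('k::field_char_0 \<Rightarrow> 'a::ab_group_add \<Rightarrow> 'a) \<Rightarrow> ('a \<Rightarrow> 'a \<Rightarrow> 'a) \<Rightarrow>
   'v::real_vector set \<Rightarrow> nat \<Rightarrow> ('v \<Rightarrow> (nat \<Rightarrow> int) \<Rightarrow> 'a set) \<Rightarrow> bool" where
  "lie_torus sc br \<Delta> n gr \<longleftrightarrow>
     lie_algebra sc br \<and> irr_finite_rs \<Delta> \<and>
     \<comment> \<open>grading by Q x Lambda\<close>
     (\<forall>\<alpha> l. ksubspace sc (gr \<alpha> l)) \<and>
     (\<forall>\<alpha> l. (\<alpha> \<notin> root_lattice \<Delta> \<or> l \<notin> lat n) \<longrightarrow> gr \<alpha> l = {0}) \<and>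
     (\<forall>x. \<exists>!c::('v \<times> (nat \<Rightarrow> int)) \<Rightarrow> 'a. finite {p. c p \<noteq> 0} \<and>
            (\<forall>p. c p \<in> gr (fst p) (snd p)) \<and> x = sum c {p. c p \<noteq> 0}) \<and>
     (\<forall>\<alpha> l \<beta> \<mu>. \<forall>x\<in>gr \<alpha> l. \<forall>y\<in>gr \<beta> \<mu>. br x y \<in> gr (\<alpha> + \<beta>) (l + \<mu>)) \<and>
     \<comment> \<open>(LT1)\<close>
     {\<alpha>. root_space gr \<alpha> \<noteq> {0}} = \<Delta> \<and>
     \<comment> \<open>(LT2)(i)\<close>
     (\<forall>\<alpha>\<in>\<Delta> - {0}. \<alpha> \<notin> (\<lambda>x. 2 *\<^sub>R x) ` (\<Delta> - {0}) \<longrightarrow> gr \<alpha> 0 \<noteq> {0}) \<and>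
     \<comment> \<open>(LT2)(ii)\<close>
     (\<forall>\<alpha>\<in>\<Delta> - {0}. \<forall>l. gr \<alpha> l \<noteq> {0} \<longrightarrow>
        (\<exists>e f. gr \<alpha> l = range (\<lambda>a. sc a e) \<and> gr (- \<alpha>) (- l) = range (\<lambda>a. sc a f) \<and>
           (\<forall>\<beta>\<in>root_lattice \<Delta>. \<forall>m::int. coroot (\<Delta> - {0}) \<alpha> \<beta> = of_int m \<longrightarrow>
              (\<forall>x\<in>root_space gr \<beta>. br (br e f) x = sc (of_int m) x)))) \<and>
     \<comment> \<open>(LT3)\<close>
     (\<forall>S. lie_subalgebra sc br S \<and> (\<Union>\<alpha>\<in>\<Delta> - {0}. root_space gr \<alpha>) \<subseteq> S \<longrightarrow> S = UNIV) \<and>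
     \<comment> \<open>(LT4)\<close>
     lat n = {\<mu>. \<exists>F m. finite F \<and> F \<subseteq> {l\<in>lat n. lat_space gr l \<noteq> {0}} \<and>
                      \<mu> = (\<lambda>i. \<Sum>l\<in>F. m l * l i)}"

definition rkv ::
  "('k::field \<Rightarrow> 'a::ab_group_add \<Rightarrow> 'a) \<Rightarrow> ('a \<Rightarrow> 'a \<Rightarrow> 'a) \<Rightarrow>
   'v::real_vector set \<Rightarrow> ('v \<Rightarrow> (nat \<Rightarrow> int) \<Rightarrow> 'a set) \<Rightarrow> nat list" where
  "rkv sc br \<Delta> gr =
    (let D = \<Delta> - {0};
         rk = (\<lambda>\<alpha>. crank (centroid sc br) (root_space gr \<alpha>));
         sh = rk (SOME \<alpha>. short_root D \<alpha>);
         lg = rk (SOME \<alpha>. long_root D \<alpha>);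
         ex = rk (SOME \<alpha>. extralong_root D \<alpha>)
     in if reduced_rs D then (if simply_laced D then [sh] else [sh, lg])
        else if dim (span D) = 1 then [sh, ex] else [sh, lg, ex])"

end

(*
Two gradings of one algebra are compared through leading terms.  Order the grading group of the
first Lie torus generically by reals, let h be a generic linear functional on the roots of the
second torus, and filter the algebra by F_q, the sum of the second root spaces of roots b with
h b >= q.  The leading terms of the elements of F_q form a graded module N_q over the centroid
whose rank is at least that of F_q.  Elements of N_q with q > 0 are ad-nilpotent, whereas a nonzero
homogeneous element of root degree 0 never is.  So the homogeneous spaces of
degrees p and -p, of nonzero root degree, cannot lie in N_q and N_(-q) respectively for generic q,
and counting ranks shows that exactly one of these inclusions holds and that rank N_q = rank F_q.
Hence the jumps w(a) of N on the root spaces form an odd function that is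
additive along root strings, that is, a linear one.  This gives a linear map from the first root
system onto the second which adds up ranks; by symmetry it is an isomorphism preserving ranks.
The nullity is the rank of the group of units of the centroid modulo scalars.
*)

theory Submission
  imports Defs
begin

section \<open>Root systems\<close>

text \<open>The second root spaces need not be homogeneous for the first grading, so the two
  gradings cannot simply be intersected, and no conjugacy of split toral subalgebras is invoked.
  Passing to leading terms restores homogeneity and keeps the bracket of levels q and r inside level
  q + r, but it bounds ranks from one side only. The missing bound comes from replacing each basis
  element of level q by an element of opposite degree. Genericity enters three times. Real values
  injective on the degrees give each nonzero element a single leading degree. A level that is not a
  value of h can be raised slightly without changing the filtration, which turns a bracket of level
  0 into one of positive level. And h is injective on the root lattice, so a jump, which is a real
  number, names a root. Ranks are counted over a ring that is only a commutative domain. Equal ranks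
  yield equal modules because the modules are graded and nonzero homogeneous elements of the
  centroid are invertible. Linearity is proved without a base of simple roots: additivity is known
  only for pairs of roots at an obtuse angle.\<close>

lemma finite_shift_zero:
  fixes x v :: "'v::real_vector"
  assumes "finite D" and "\<And>m::nat. x + of_nat m *\<^sub>R v \<in> D"
  shows "v = 0"
proof (rule ccontr)
  assume v: "v \<noteq> 0"
  have "inj (\<lambda>m::nat. x + of_nat m *\<^sub>R v)" using v by (auto intro!: injI)
  moreover have "range (\<lambda>m::nat. x + of_nat m *\<^sub>R v) \<subseteq> D" using assms(2) by auto
  ultimately show False using assms(1) by (meson finite_subset infinite_UNIV_nat range_inj_infinite)
qed

lemma reflection_functional_unique:
  fixes f g :: "'v::real_vector \<Rightarrow> real"
  assumes D: "finite D" "\<alpha> \<noteq> 0" and f: "linear f" "f \<alpha> = 2" "\<And>\<beta>. \<beta> \<in> D \<Longrightarrow> \<beta> - f \<beta> *\<^sub>R \<alpha> \<in> D"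
    and g: "linear g" "g \<alpha> = 2" "\<And>\<beta>. \<beta> \<in> D \<Longrightarrow> \<beta> - g \<beta> *\<^sub>R \<alpha> \<in> D" and \<beta>: "\<beta> \<in> D"
  shows "f \<beta> = g \<beta>"
proof -
  \<comment> \<open>The product of the two reflections is a transvection permuting the finite set D.\<close>
  define d where "d x = g x - f x" for x
  have step: "x + d x *\<^sub>R \<alpha> \<in> D" if "x \<in> D" for x
  proof -
    have "(x - g x *\<^sub>R \<alpha>) - f (x - g x *\<^sub>R \<alpha>) *\<^sub>R \<alpha> \<in> D" using f(3) g(3) that by blast
    moreover have "f (x - g x *\<^sub>R \<alpha>) = f x - 2 * g x"
      using f by (simp add: linear_diff linear_cmul)
    moreover have "(x - g x *\<^sub>R \<alpha>) - (f x - 2 * g x) *\<^sub>R \<alpha> = x + d x *\<^sub>R \<alpha>"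
      unfolding d_def scaleR_left_diff_distrib mult_2 scaleR_left_distrib by simp
    ultimately show ?thesis by metis
  qed
  have dinv: "d (x + c *\<^sub>R \<alpha>) = d x" for x c
    using f g by (simp add: d_def linear_add linear_cmul)
  have "\<beta> + of_nat m *\<^sub>R (d \<beta> *\<^sub>R \<alpha>) \<in> D" for m
  proof (induction m)
    case (Suc m)
    from step[OF this] show ?case using dinv[of \<beta> "of_nat m * d \<beta>"] by (simp add: algebra_simps)
  qed (use \<beta> in simp)
  from finite_shift_zero[OF D(1) this] show ?thesis using D(2) by (simp add: d_def)
qed

section \<open>Coroots and reflections\<close>

locale rsys =
  fixes D :: "'v::real_vector set"
  assumes rs: "root_system D"
begin

lemma fin: "finite D" and nz: "\<alpha> \<in> D \<Longrightarrow> \<alpha> \<noteq> 0"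
  using rs by (auto simp: root_system_def)

abbreviation cr where "cr \<equiv> coroot D"

lemma coroot_props:
  assumes "\<alpha> \<in> D"
  shows "linear (cr \<alpha>) \<and> cr \<alpha> \<alpha> = 2 \<and> (\<forall>\<beta>\<in>D. \<beta> - cr \<alpha> \<beta> *\<^sub>R \<alpha> \<in> D)"
proof -
  have "\<exists>f. linear f \<and> f \<alpha> = 2 \<and> (\<forall>\<beta>\<in>D. \<beta> - f \<beta> *\<^sub>R \<alpha> \<in> D)"
    using rs assms unfolding root_system_def by blast
  from someI_ex[OF this] show ?thesis unfolding coroot_def .
qed

lemma coroot_linear: "\<alpha> \<in> D \<Longrightarrow> linear (cr \<alpha>)"
  and coroot_self: "\<alpha> \<in> D \<Longrightarrow> cr \<alpha> \<alpha> = 2"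
  and refl_in: "\<alpha> \<in> D \<Longrightarrow> \<beta> \<in> D \<Longrightarrow> \<beta> - cr \<alpha> \<beta> *\<^sub>R \<alpha> \<in> D"
  using coroot_props by auto

lemma coroot_unique:
  assumes "\<alpha> \<in> D" "linear f" "f \<alpha> = 2" "\<And>\<beta>. \<beta> \<in> D \<Longrightarrow> \<beta> - f \<beta> *\<^sub>R \<alpha> \<in> D" "\<beta> \<in> D"
  shows "cr \<alpha> \<beta> = f \<beta>"
  by (rule reflection_functional_unique[OF fin nz, of \<alpha>]) (use assms coroot_props in auto)

lemma linear_eq_on_span:
  fixes f g :: "'v \<Rightarrow> 'c::real_vector"
  assumes "linear f" "linear g" "\<And>\<beta>. \<beta> \<in> D \<Longrightarrow> f \<beta> = g \<beta>" "x \<in> span D"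
  shows "f x = g x"
  using linear_eq_on[of f g x D] assms by blast

text \<open>The permutation argument pins a coroot down on the roots, hence on their span. Off the
  span the value of \<open>coroot\<close> is an arbitrary choice, which is why later identities
  carry a hypothesis of membership in \<open>span D\<close>.\<close>

lemma coroot_unique_span:
  assumes "\<alpha> \<in> D" "linear f" "f \<alpha> = 2" "\<And>\<beta>. \<beta> \<in> D \<Longrightarrow> \<beta> - f \<beta> *\<^sub>R \<alpha> \<in> D" "x \<in> span D"
  shows "cr \<alpha> x = f x"
  by (rule linear_eq_on_span) (use assms coroot_unique coroot_linear in auto)

text \<open>\<open>coroot\<close> is chosen without demanding integrality; uniqueness identifies it
  on roots with the integral functional supplied by \<open>root_system\<close>.\<close>

lemma coroot_int: "\<alpha> \<in> D \<Longrightarrow> \<beta> \<in> D \<Longrightarrow> cr \<alpha> \<beta> \<in> \<int>"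
proof -
  assume a: "\<alpha> \<in> D" "\<beta> \<in> D"
  obtain f where f: "linear f" "f \<alpha> = 2" "\<forall>\<beta>\<in>D. \<beta> - f \<beta> *\<^sub>R \<alpha> \<in> D" "\<forall>\<beta>\<in>D. f \<beta> \<in> \<int>"
    using rs a by (auto simp: root_system_def)
  then show ?thesis using coroot_unique[of \<alpha> f \<beta>] a by simp
qed

lemma neg_in: "\<alpha> \<in> D \<Longrightarrow> - \<alpha> \<in> D"
  using refl_in[of \<alpha> \<alpha>] coroot_self[of \<alpha>] by (simp add: scaleR_2)

lemma coroot_scale:
  assumes "\<alpha> \<in> D" "c *\<^sub>R \<alpha> \<in> D" "x \<in> span D"
  shows "cr (c *\<^sub>R \<alpha>) x = cr \<alpha> x / c"
proof -
  have c: "c \<noteq> 0" using nz[OF assms(2)] by auto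
  show ?thesis
    by (rule coroot_unique_span)
      (use assms c coroot_props[OF assms(1)] in \<open>auto simp: linear_cmul linear_iff add_divide_distrib\<close>)
qed

lemma coroot_neg: "\<alpha> \<in> D \<Longrightarrow> x \<in> span D \<Longrightarrow> cr (- \<alpha>) x = - cr \<alpha> x"
  using coroot_scale[of \<alpha> "-1" x] neg_in[of \<alpha>] by simp

definition s :: "'v \<Rightarrow> 'v \<Rightarrow> 'v" where "s \<alpha> x = x - cr \<alpha> x *\<^sub>R \<alpha>"

lemma s_in: "\<alpha> \<in> D \<Longrightarrow> \<beta> \<in> D \<Longrightarrow> s \<alpha> \<beta> \<in> D" using refl_in by (simp add: s_def)

lemma s_linear: "\<alpha> \<in> D \<Longrightarrow> linear (s \<alpha>)"
  using coroot_linear[of \<alpha>] by (simp add: s_def[abs_def] linear_iff algebra_simps)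

lemma coroot_s_self: "\<alpha> \<in> D \<Longrightarrow> cr \<alpha> (s \<alpha> x) = - cr \<alpha> x"
  using coroot_linear[of \<alpha>] coroot_self[of \<alpha>] by (simp add: s_def linear_diff linear_cmul)

lemma s_invol: "\<alpha> \<in> D \<Longrightarrow> s \<alpha> (s \<alpha> x) = x"
  using coroot_s_self[of \<alpha> x] by (simp add: s_def)

lemma s_self: "\<alpha> \<in> D \<Longrightarrow> s \<alpha> \<alpha> = - \<alpha>" by (simp add: s_def coroot_self scaleR_2)

lemma s_image: "\<alpha> \<in> D \<Longrightarrow> s \<alpha> ` D = D"
  using s_in s_invol by (metis (no_types, lifting) image_eqI image_subsetI subset_antisym subsetI)

lemma s_inj: "\<alpha> \<in> D \<Longrightarrow> inj_on (s \<alpha>) A" using s_invol by (metis inj_on_def)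

lemma sum_s: "\<alpha> \<in> D \<Longrightarrow> sum f D = (\<Sum>\<beta>\<in>D. f (s \<alpha> \<beta>))"
  using sum.reindex[OF s_inj[of \<alpha> D], of f] s_image[of \<alpha>] by simp

text \<open>Conjugating the reflection in \<gamma> by \<open>s \<alpha>\<close> gives the reflection
  in \<open>s \<alpha> \<gamma>\<close>; uniqueness of coroots does the rest.\<close>

lemma coroot_s:
  assumes "\<alpha> \<in> D" "\<gamma> \<in> D" "x \<in> span D"
  shows "cr (s \<alpha> \<gamma>) x = cr \<gamma> (s \<alpha> x)"
proof (rule coroot_unique_span)
  show "linear (\<lambda>x. cr \<gamma> (s \<alpha> x))"
    using linear_compose[OF s_linear coroot_linear, of \<alpha> \<gamma>] assms by (simp add: o_def)
  show "cr \<gamma> (s \<alpha> (s \<alpha> \<gamma>)) = 2" using assms by (simp add: s_invol coroot_self)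
  fix \<beta> assume b: "\<beta> \<in> D"
  have "s \<alpha> (s \<gamma> (s \<alpha> \<beta>)) = \<beta> - cr \<gamma> (s \<alpha> \<beta>) *\<^sub>R s \<alpha> \<gamma>"
    unfolding s_def[of \<gamma>] using assms s_linear[of \<alpha>] by (simp add: linear_diff linear_cmul s_invol)
  then show "\<beta> - cr \<gamma> (s \<alpha> \<beta>) *\<^sub>R s \<alpha> \<gamma> \<in> D" using s_in assms b by metis
qed (use assms s_in in auto)

text \<open>Reindexing the sum by \<open>s \<gamma>\<close> negates each coefficient and changes
  each root by a multiple of \<gamma>, so the sum and its reflected copy add up to a multiple of
  \<gamma>.\<close>

lemma coroot_moment:
  assumes "\<gamma> \<in> D"
  shows "2 *\<^sub>R (\<Sum>\<beta>\<in>D. cr \<gamma> \<beta> *\<^sub>R \<beta>) = (\<Sum>\<beta>\<in>D. (cr \<gamma> \<beta>)\<^sup>2) *\<^sub>R \<gamma>"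
proof -
  have "(\<Sum>\<beta>\<in>D. cr \<gamma> \<beta> *\<^sub>R \<beta>) = (\<Sum>\<beta>\<in>D. cr \<gamma> (s \<gamma> \<beta>) *\<^sub>R s \<gamma> \<beta>)"
    by (rule sum_s[OF assms, of "\<lambda>\<beta>. cr \<gamma> \<beta> *\<^sub>R \<beta>"])
  also have "\<dots> = (\<Sum>\<beta>\<in>D. (cr \<gamma> \<beta>)\<^sup>2 *\<^sub>R \<gamma> - cr \<gamma> \<beta> *\<^sub>R \<beta>)"
    by (rule sum.cong) (use coroot_s_self[OF assms] in \<open>auto simp: s_def[of \<gamma>] scaleR_right_diff_distrib power2_eq_square\<close>)
  finally show ?thesis by (simp add: sum_subtractf scaleR_2 scaleR_sum_left algebra_simps)
qed

text \<open>By the previous lemma the coroots span the dual space, since every root is the image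
  of its coroot under the map of the dual given by the form summing f b g b over the roots b.\<close>
lemma coroots_separate:
  assumes "v \<in> span D" "\<And>\<gamma>. \<gamma> \<in> D \<Longrightarrow> cr \<gamma> v = 0"
  shows "v = 0"
proof -
  from assms(1) obtain a where v: "v = (\<Sum>\<gamma>\<in>D. a \<gamma> *\<^sub>R \<gamma>)"
    using span_finite[OF fin] by auto
  define N where "N \<gamma> = (\<Sum>\<beta>\<in>D. (cr \<gamma> \<beta>)\<^sup>2)" for \<gamma>
  have N: "N \<gamma> > 0" if "\<gamma> \<in> D" for \<gamma>
    unfolding N_def by (rule sum_pos2[OF fin that]) (use that coroot_self in auto)
  define f where "f x = (\<Sum>\<gamma>\<in>D. (2 * a \<gamma> / N \<gamma>) * cr \<gamma> x)" for x
  have fl: "linear f"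
    unfolding f_def using coroot_linear
    by (intro linear_compose_sum ballI) (auto simp: linear_iff algebra_simps add_divide_distrib)
  have "v = (\<Sum>\<gamma>\<in>D. (2 * a \<gamma> / N \<gamma>) *\<^sub>R (\<Sum>\<beta>\<in>D. cr \<gamma> \<beta> *\<^sub>R \<beta>))"
    unfolding v
  proof (rule sum.cong[OF refl])
    fix \<gamma> assume g: "\<gamma> \<in> D"
    have "(2 * a \<gamma> / N \<gamma>) *\<^sub>R (\<Sum>\<beta>\<in>D. cr \<gamma> \<beta> *\<^sub>R \<beta>) = (a \<gamma> / N \<gamma>) *\<^sub>R (2 *\<^sub>R (\<Sum>\<beta>\<in>D. cr \<gamma> \<beta> *\<^sub>R \<beta>))"
      by simp
    also have "\<dots> = (a \<gamma> / N \<gamma>) *\<^sub>R (N \<gamma> *\<^sub>R \<gamma>)" unfolding coroot_moment[OF g] N_def by simp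
    also have "\<dots> = a \<gamma> *\<^sub>R \<gamma>" using N[OF g] by simp
    finally show "a \<gamma> *\<^sub>R \<gamma> = (2 * a \<gamma> / N \<gamma>) *\<^sub>R (\<Sum>\<beta>\<in>D. cr \<gamma> \<beta> *\<^sub>R \<beta>)" by simp
  qed
  also have "\<dots> = (\<Sum>\<beta>\<in>D. f \<beta> *\<^sub>R \<beta>)"
    unfolding f_def scaleR_sum_right scaleR_sum_left by (subst sum.swap) simp
  finally have v2: "v = (\<Sum>\<beta>\<in>D. f \<beta> *\<^sub>R \<beta>)" .
  \<comment> \<open>\<open>f\<close> is a combination of coroots and so kills \<open>v\<close>,
    while evaluating it on \<open>v\<close> written with its own values as coefficients gives a sum
    of squares.\<close>
  have "f v = 0" unfolding f_def using assms by simp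
  moreover have "f v = (\<Sum>\<beta>\<in>D. f \<beta> * f \<beta>)"
    by (subst v2) (simp add: linear_sum[OF fl] linear_cmul[OF fl])
  ultimately have "\<forall>\<beta>\<in>D. f \<beta> * f \<beta> = 0"
    using sum_nonneg_eq_0_iff[OF fin, of "\<lambda>\<beta>. f \<beta> * f \<beta>"] by simp
  then show ?thesis using v2 by simp
qed

section \<open>The Weyl-invariant form\<close>

abbreviation fm where "fm \<equiv> rs_form D"

lemma fm_sym: "fm x y = fm y x" by (simp add: rs_form_def mult.commute)

lemma fm_lin: "linear (fm x)"
  unfolding rs_form_def[abs_def] using coroot_linear
  by (intro linear_compose_sum ballI) (auto simp: linear_iff algebra_simps)

lemma fm_lin2: "linear (\<lambda>x. fm x y)"
proof -
  have "(\<lambda>x. fm x y) = fm y" by (rule ext) (rule fm_sym)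
  then show ?thesis using fm_lin[of y] by simp
qed

lemma fm_nonneg: "fm x x \<ge> 0" unfolding rs_form_def by (intro sum_nonneg) simp

lemma fm_eq_0: "x \<in> span D \<Longrightarrow> fm x x = 0 \<Longrightarrow> x = 0"
proof -
  assume a: "x \<in> span D" "fm x x = 0"
  then have "\<forall>\<gamma>\<in>D. cr \<gamma> x * cr \<gamma> x = 0"
    using sum_nonneg_eq_0_iff[OF fin, of "\<lambda>\<gamma>. cr \<gamma> x * cr \<gamma> x"] by (simp add: rs_form_def)
  then show "x = 0" using coroots_separate a(1) by auto
qed

lemma fm_pos: "\<alpha> \<in> D \<Longrightarrow> fm \<alpha> \<alpha> > 0"
proof -
  assume a: "\<alpha> \<in> D"
  then have "fm \<alpha> \<alpha> \<noteq> 0" using fm_eq_0[of \<alpha>] nz span_base by blast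
  then show ?thesis using fm_nonneg[of \<alpha>] by simp
qed

lemma fm_s:
  assumes "\<alpha> \<in> D" "x \<in> span D" "y \<in> span D"
  shows "fm (s \<alpha> x) (s \<alpha> y) = fm x y"
proof -
  have "fm x y = (\<Sum>\<gamma>\<in>D. cr (s \<alpha> \<gamma>) x * cr (s \<alpha> \<gamma>) y)"
    unfolding rs_form_def by (rule sum_s[OF assms(1)])
  also have "\<dots> = fm (s \<alpha> x) (s \<alpha> y)"
    unfolding rs_form_def by (rule sum.cong) (use assms coroot_s in auto)
  finally show ?thesis by simp
qed

text \<open>Invariance under \<open>s \<alpha>\<close>, which negates \<alpha>, turns
  \<open>fm x \<alpha>\<close> into an equation for itself.\<close>

lemma fm_coroot:
  assumes "\<alpha> \<in> D" "x \<in> span D"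
  shows "2 * fm x \<alpha> = cr \<alpha> x * fm \<alpha> \<alpha>"
proof -
  have "fm x \<alpha> = fm (s \<alpha> x) (s \<alpha> \<alpha>)" using fm_s assms span_base by metis
  also have "\<dots> = - fm (s \<alpha> x) \<alpha>" using linear_neg[OF fm_lin] s_self assms by simp
  also have "\<dots> = - fm x \<alpha> + cr \<alpha> x * fm \<alpha> \<alpha>"
    unfolding s_def using linear_diff[OF fm_lin2, of x _ \<alpha>] linear_cmul[OF fm_lin2] by simp
  finally show ?thesis by simp
qed

lemma coroot_eq: "\<alpha> \<in> D \<Longrightarrow> x \<in> span D \<Longrightarrow> cr \<alpha> x = 2 * fm x \<alpha> / fm \<alpha> \<alpha>"
  using fm_coroot fm_pos[of \<alpha>] by (simp add: field_simps)

lemma coroot_zero_sym: "\<alpha> \<in> D \<Longrightarrow> \<beta> \<in> D \<Longrightarrow> cr \<alpha> \<beta> = 0 \<longleftrightarrow> cr \<beta> \<alpha> = 0"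
  using coroot_eq[of \<alpha> \<beta>] coroot_eq[of \<beta> \<alpha>] fm_sym[of \<alpha> \<beta>] fm_pos[of \<alpha>] fm_pos[of \<beta>]
  by (simp add: span_base)

section \<open>Functions additive on obtuse pairs of roots\<close>

text \<open>The hypothesis covers only negative pairings, since those are the ones for which a
  bracket of root vectors is known to be nonzero. The root string from \<beta> to its reflection is
  shortened at both ends at once, so that every step used is an obtuse one.\<close>

lemma root_string_additive:
  fixes u :: "'v \<Rightarrow> 'c::real_vector"
  assumes u0: "u 0 = 0" and un: "\<And>\<alpha>. \<alpha> \<in> D \<Longrightarrow> u (- \<alpha>) = - u \<alpha>"
    and us: "\<And>\<alpha> \<beta>. \<alpha> \<in> D \<Longrightarrow> \<beta> \<in> D \<Longrightarrow> cr \<alpha> \<beta> < 0 \<Longrightarrow> \<beta> + \<alpha> \<in> insert 0 D \<and> u (\<beta> + \<alpha>) = u \<beta> + u \<alpha>"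
    and \<alpha>: "\<alpha> \<in> D"
  shows "\<beta> \<in> D \<Longrightarrow> u (s \<alpha> \<beta>) = u \<beta> - cr \<alpha> \<beta> *\<^sub>R u \<alpha>"
proof -
  \<comment> \<open>Moving \<beta> to \<beta> + \<alpha> raises the pairing by 2, so
    \<open>m\<close> drops by 2 in the recursion; \<open>m\<close> equal to 0 or 1, and a string
    passing through 0, are settled directly.\<close>
  have neg: "u (s \<alpha> \<beta>) = u \<beta> + of_nat m *\<^sub>R u \<alpha>" if "\<beta> \<in> D" "cr \<alpha> \<beta> = - of_nat m" for m \<beta>
    using that
  proof (induction m arbitrary: \<beta> rule: less_induct)
    case (less m)
    show ?case
    proof (cases "m = 0")
      case True then show ?thesis using less.prems by (simp add: s_def)
    next
      case False
      then have lt: "cr \<alpha> \<beta> < 0" using less.prems by simp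
      note st = us[OF \<alpha> less.prems(1) lt]
      show ?thesis
      proof (cases "m = 1")
        case True then show ?thesis using st less.prems by (simp add: s_def)
      next
        case F: False
        then have m2: "m \<ge> 2" using False by simp
        show ?thesis
        proof (cases "\<beta> + \<alpha> = 0")
          case True
          then have b: "\<beta> = - \<alpha>" by (simp add: eq_neg_iff_add_eq_0)
          then have "m = 2" using less.prems \<alpha> coroot_self linear_neg[OF coroot_linear] by fastforce
          then show ?thesis using b \<alpha> less.prems un by (simp add: s_def scaleR_2)
        next
          case nz: False
          then have b1: "\<beta> + \<alpha> \<in> D" using st by simp
          have c1: "cr \<alpha> (\<beta> + \<alpha>) = - of_nat (m - 2)"
            using \<alpha> less.prems m2 by (simp add: linear_add[OF coroot_linear] coroot_self of_nat_diff)
          have IH: "u (s \<alpha> (\<beta> + \<alpha>)) = u (\<beta> + \<alpha>) + of_nat (m - 2) *\<^sub>R u \<alpha>"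
            by (rule less.IH[OF _ b1 c1]) (use m2 in simp)
          \<comment> \<open>The far end of the string is obtuse to - \<alpha>, and one step inwards
            from it is the reflection of \<beta> + \<alpha>.\<close>
          have g: "s \<alpha> \<beta> \<in> D" "cr (- \<alpha>) (s \<alpha> \<beta>) < 0"
            using \<alpha> less.prems lt by (auto simp: s_in coroot_neg span_base coroot_s_self)
          have "u (s \<alpha> \<beta> + - \<alpha>) = u (s \<alpha> \<beta>) - u \<alpha>"
            using us[OF neg_in[OF \<alpha>] g] un[OF \<alpha>] by simp
          moreover have "s \<alpha> \<beta> + - \<alpha> = s \<alpha> (\<beta> + \<alpha>)"
            using linear_add[OF s_linear[OF \<alpha>]] s_self[OF \<alpha>] by simp
          ultimately have "u (s \<alpha> \<beta>) = u \<beta> + u \<alpha> + of_nat (m - 2) *\<^sub>R u \<alpha> + u \<alpha>"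
            using IH st by (simp add: algebra_simps)
          also have "\<dots> = u \<beta> + of_nat m *\<^sub>R u \<alpha>"
            using m2 by (simp add: of_nat_diff algebra_simps scaleR_2)
          finally show ?thesis .
        qed
      qed
    qed
  qed
  assume \<beta>: "\<beta> \<in> D"
  then obtain z where z: "cr \<alpha> \<beta> = of_int z" using coroot_int[OF \<alpha>] Ints_cases by metis
  show ?thesis
  proof (cases "z \<le> 0")
    case True
    then have "cr \<alpha> \<beta> = - of_nat (nat (-z))" using z by simp
    from neg[OF \<beta> this] show ?thesis using z True by simp
  next
    case False
    have "cr \<alpha> (s \<alpha> \<beta>) = - of_nat (nat z)" using z False coroot_s_self[OF \<alpha>] by simp
    from neg[OF s_in[OF \<alpha> \<beta>] this] show ?thesis using z False s_invol[OF \<alpha>] by simp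
  qed
qed

lemma reflection_additive_imp_zero:
  fixes u :: "'v \<Rightarrow> real"
  assumes refl: "\<And>\<alpha> \<beta>. \<alpha> \<in> D \<Longrightarrow> \<beta> \<in> D \<Longrightarrow> u (s \<alpha> \<beta>) = u \<beta> - cr \<alpha> \<beta> * u \<alpha>"
    and B: "B \<subseteq> D" "D \<subseteq> span B" "\<And>\<beta>. \<beta> \<in> B \<Longrightarrow> u \<beta> = 0" and g: "\<gamma> \<in> D"
  shows "u \<gamma> = 0"
proof (rule ccontr)
  assume nz0: "u \<gamma> \<noteq> 0"
  \<comment> \<open>The sum of the roots at which u is maximal is fixed by all reflections in B, hence zero.\<close>
  define M where "M = Max (u ` D)"
  have le: "u \<beta> \<le> M" if "\<beta> \<in> D" for \<beta> unfolding M_def using that fin by simp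
  have un: "u (- \<beta>) = - u \<beta>" if "\<beta> \<in> D" for \<beta>
    using refl[OF that that] that by (simp add: s_self coroot_self)
  have M0: "M > 0" using le[OF g] le[OF neg_in[OF g]] un[OF g] nz0 by linarith
  define T where "T = {\<delta>\<in>D. u \<delta> = M}"
  have finT: "finite T" using fin by (simp add: T_def)
  obtain \<delta>0 where d0: "\<delta>0 \<in> T"
    using Max_in[of "u ` D"] fin g unfolding T_def M_def by fastforce
  have sT: "s \<beta> ` T = T" if "\<beta> \<in> B" for \<beta>
  proof -
    have bD: "\<beta> \<in> D" using B that by auto
    have "s \<beta> \<delta> \<in> T" if "\<delta> \<in> T" for \<delta>
      using that refl[OF bD, of \<delta>] B(3)[OF \<open>\<beta> \<in> B\<close>] s_in[OF bD] by (auto simp: T_def)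
    then show ?thesis using s_invol[OF bD] by (metis (no_types, lifting) image_eqI image_subsetI subset_antisym subsetI)
  qed
  define \<sigma> where "\<sigma> = \<Sum>T"
  have \<sigma>: "\<sigma> \<in> span D" unfolding \<sigma>_def by (rule span_sum) (auto simp: T_def span_base)
  have orth: "cr \<beta> \<sigma> = 0" if "\<beta> \<in> B" for \<beta>
  proof -
    have bD: "\<beta> \<in> D" using B that by auto
    have "s \<beta> \<sigma> = (\<Sum>\<delta>\<in>T. s \<beta> \<delta>)" unfolding \<sigma>_def using linear_sum[OF s_linear[OF bD]] by simp
    also have "\<dots> = \<sigma>" unfolding \<sigma>_def using sum.reindex[OF s_inj[OF bD, of T], of "\<lambda>x. x"] sT[OF that] by simp
    finally have "s \<beta> \<sigma> = \<sigma>" .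
    then show ?thesis using nz[OF bD] by (simp add: s_def)
  qed
  have "fm \<sigma> x = 0" if "x \<in> span B" for x
  proof (rule linear_eq_on[OF fm_lin[of \<sigma>] linear_zero that])
    fix \<beta> assume "\<beta> \<in> B"
    then show "fm \<sigma> \<beta> = 0" using fm_coroot[OF _ \<sigma>, of \<beta>] orth B(1) by auto
  qed
  moreover have "\<sigma> \<in> span B" using \<sigma> B(2) span_mono[of D "span B"] by (auto simp: span_span)
  ultimately have "\<sigma> = 0" using fm_eq_0 \<sigma> by blast
  moreover have d0D: "\<delta>0 \<in> D" "u \<delta>0 = M" using d0 by (auto simp: T_def)
  ultimately have "(\<Sum>\<delta>\<in>T. cr \<delta>0 \<delta>) = 0"
    using linear_sum[OF coroot_linear[OF d0D(1)], of "\<lambda>x. x" T] linear_0[OF coroot_linear[OF d0D(1)]]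
    by (simp add: \<sigma>_def)
  \<comment> \<open>Reflecting a maximizer in another one cannot exceed the maximum
    \<open>M\<close>, which is positive; this makes every pairing inside \<open>T\<close>
    nonnegative, and \<delta>0 pairs with itself to 2.\<close>
  moreover have "(\<Sum>\<delta>\<in>T. cr \<delta>0 \<delta>) > 0"
  proof (rule sum_pos2[OF finT d0])
    show "0 < cr \<delta>0 \<delta>0" using coroot_self[OF d0D(1)] by simp
    fix \<delta> assume d: "\<delta> \<in> T"
    then have "M - cr \<delta>0 \<delta> * M \<le> M"
      using refl[OF d0D(1), of \<delta>] le[OF s_in[OF d0D(1)], of \<delta>] d0D by (simp add: T_def)
    then show "0 \<le> cr \<delta>0 \<delta>" using M0 by (simp add: zero_le_mult_iff)
  qed
  ultimately show False by simp
qed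

text \<open>The substitute for extending from a base of simple roots.\<close>
lemma string_additive_extends:
  fixes u :: "'v \<Rightarrow> 'c::real_vector"
  assumes "u 0 = 0" and "\<And>\<alpha>. \<alpha> \<in> D \<Longrightarrow> u (- \<alpha>) = - u \<alpha>"
    and "\<And>\<alpha> \<beta>. \<alpha> \<in> D \<Longrightarrow> \<beta> \<in> D \<Longrightarrow> cr \<alpha> \<beta> < 0 \<Longrightarrow> \<beta> + \<alpha> \<in> insert 0 D \<and> u (\<beta> + \<alpha>) = u \<beta> + u \<alpha>"
  shows "\<exists>W. linear W \<and> (\<forall>\<alpha>\<in>D. W \<alpha> = u \<alpha>)"
proof -
  obtain B where B: "B \<subseteq> D" "independent B" "D \<subseteq> span B"
    using maximal_independent_subset by metis
  obtain W where W: "linear W" "\<forall>x\<in>B. W x = u x" using linear_independent_extend[OF B(2)] by blast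
  have "W \<gamma> = u \<gamma>" if g: "\<gamma> \<in> D" for \<gamma>
  proof (rule ccontr)
    assume ne: "W \<gamma> \<noteq> u \<gamma>"
    define y where "y = W \<gamma> - u \<gamma>"
    have "independent {y}" using ne by (simp add: y_def)
    \<comment> \<open>A functional not vanishing on the discrepancy reduces the vector-valued case
      to real values, where the argument by maximizers applies.\<close>
    then obtain \<psi> :: "'c \<Rightarrow> real" where p: "linear \<psi>" "\<psi> y = 1"
      using linear_independent_extend[of "{y}" "\<lambda>_. 1"] by auto
    have "\<psi> (W \<gamma> - u \<gamma>) = 0"
    proof (rule reflection_additive_imp_zero[OF _ B(1) B(3) _ g, where u = "\<lambda>x. \<psi> (W x - u x)"])
      fix \<alpha> \<beta> assume ab: "\<alpha> \<in> D" "\<beta> \<in> D"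
      have "u (s \<alpha> \<beta>) = u \<beta> - cr \<alpha> \<beta> *\<^sub>R u \<alpha>"
        by (rule root_string_additive[OF assms]) (use ab in auto)
      moreover have "W (s \<alpha> \<beta>) = W \<beta> - cr \<alpha> \<beta> *\<^sub>R W \<alpha>"
        using W(1) by (simp add: s_def linear_diff linear_cmul)
      ultimately show "\<psi> (W (s \<alpha> \<beta>) - u (s \<alpha> \<beta>)) = \<psi> (W \<beta> - u \<beta>) - cr \<alpha> \<beta> * \<psi> (W \<alpha> - u \<alpha>)"
        using p(1) by (simp only: linear_diff linear_cmul) (simp add: algebra_simps)
    qed (use W(2) linear_0[OF p(1)] in auto)
    then show False using p(2) by (simp add: y_def)
  qed
  then show ?thesis using W(1) by blast
qed


section \<open>Weyl group orbits and pairs of roots\<close>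

inductive_set orb :: "'v \<Rightarrow> 'v set" for \<beta> where
  orb_base: "\<beta> \<in> orb \<beta>"
| orb_step: "\<gamma> \<in> D \<Longrightarrow> \<delta> \<in> orb \<beta> \<Longrightarrow> s \<gamma> \<delta> \<in> orb \<beta>"

lemma orb_in: "\<delta> \<in> orb \<beta> \<Longrightarrow> \<beta> \<in> D \<Longrightarrow> \<delta> \<in> D"
  by (induction rule: orb.induct) (auto simp: s_in)

lemma orb_fm: "\<delta> \<in> orb \<beta> \<Longrightarrow> \<beta> \<in> D \<Longrightarrow> fm \<delta> \<delta> = fm \<beta> \<beta>"
  by (induction rule: orb.induct) (auto simp: fm_s orb_in span_base)

lemma orb_double: "\<delta> \<in> orb \<beta> \<Longrightarrow> \<beta> \<in> D \<Longrightarrow> c *\<^sub>R \<beta> \<in> D \<Longrightarrow> c *\<^sub>R \<delta> \<in> D"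
proof (induction rule: orb.induct)
  case (orb_step \<gamma> \<delta>)
  then show ?case using s_in[of \<gamma> "c *\<^sub>R \<delta>"] linear_cmul[OF s_linear, of \<gamma> c \<delta>] by simp
qed

lemma extralong_s: "\<gamma> \<in> D \<Longrightarrow> extralong_root D \<delta> \<Longrightarrow> extralong_root D (s \<gamma> \<delta>)"
  unfolding extralong_root_def using s_in linear_cmul[OF s_linear] by (auto simp: image_iff)

lemma extralong_orb: "\<delta> \<in> orb \<beta> \<Longrightarrow> extralong_root D \<delta> \<Longrightarrow> extralong_root D \<beta>"
proof (induction rule: orb.induct)
  case (orb_step \<gamma> \<delta>)
  then show ?case using extralong_s[of \<gamma> "s \<gamma> \<delta>"] s_invol by simp
qed

text \<open>\<open>x\<close> is the component of \<beta> orthogonal to \<alpha>. Its squared length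
  is a nonnegative multiple of 1 - p q / 4, which bounds p q by 4 and forces proportionality when
  the bound is attained.\<close>

lemma coroot_pair:
  assumes "\<alpha> \<in> D" "\<beta> \<in> D" "cr \<alpha> \<beta> > 0"
  obtains p q :: int where "p > 0" "q > 0" "cr \<alpha> \<beta> = of_int p" "cr \<beta> \<alpha> = of_int q"
    "p * q \<le> 4" "of_int p * fm \<alpha> \<alpha> = of_int q * fm \<beta> \<beta>"
    "p * q = 4 \<Longrightarrow> \<beta> = (of_int p / 2) *\<^sub>R \<alpha>"
proof -
  obtain p where p: "cr \<alpha> \<beta> = of_int p" using coroot_int[OF assms(1,2)] Ints_cases by metis
  obtain q where q: "cr \<beta> \<alpha> = of_int q" using coroot_int[OF assms(2,1)] Ints_cases by metis
  have sp: "\<alpha> \<in> span D" "\<beta> \<in> span D" using assms span_base by auto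
  note pos = fm_pos[OF assms(1)] fm_pos[OF assms(2)]
  have e1: "2 * fm \<beta> \<alpha> = of_int p * fm \<alpha> \<alpha>" using fm_coroot[OF assms(1) sp(2)] p by simp
  have e2: "2 * fm \<beta> \<alpha> = of_int q * fm \<beta> \<beta>" using fm_coroot[OF assms(2) sp(1)] q fm_sym[of \<alpha> \<beta>] by simp
  have p0: "p > 0" using assms(3) p by simp
  then have "of_int q * fm \<beta> \<beta> > 0" using e1 e2 pos by simp
  then have q0: "q > 0" using pos by (simp add: zero_less_mult_iff)
  define c where "c = (of_int p :: real) / 2"
  define x where "x = \<beta> - c *\<^sub>R \<alpha>"
  have "fm x x = fm \<beta> \<beta> - 2 * c * fm \<beta> \<alpha> + c * c * fm \<alpha> \<alpha>"
    unfolding x_def linear_diff[OF fm_lin2] linear_diff[OF fm_lin] linear_cmul[OF fm_lin2] linear_cmul[OF fm_lin]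
    by (simp add: fm_sym[of \<alpha> \<beta>] algebra_simps)
  also have "\<dots> = fm \<beta> \<beta> - (of_int p * fm \<alpha> \<alpha>) * of_int p / 4"
    using e1 by (simp add: c_def field_simps)
  also have "\<dots> = (1 - of_int (p * q) / 4) * fm \<beta> \<beta>" using e1 e2 by (simp add: field_simps)
  finally have xx: "fm x x = (1 - of_int (p * q) / 4) * fm \<beta> \<beta>" .
  then have "(1 - of_int (p * q) / 4) * fm \<beta> \<beta> \<ge> 0" using fm_nonneg[of x] by simp
  then have "1 - of_int (p * q) / 4 \<ge> (0::real)" using pos by (simp add: zero_le_mult_iff)
  then have le: "p * q \<le> 4" by linarith
  have "x \<in> span D" unfolding x_def using sp by (simp add: span_diff span_mul)
  then have "x = 0" if "p * q = 4" using fm_eq_0 xx that by simp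
  then have "p * q = 4 \<Longrightarrow> \<beta> = (of_int p / 2) *\<^sub>R \<alpha>" by (simp add: x_def c_def)
  then show thesis using that p q p0 q0 le e1 e2 by simp
qed

end

section \<open>Root lengths in irreducible systems\<close>

locale irr_rsys = rsys +
  assumes irr: "irreducible_rs D"
begin

lemma nonempty: "D \<noteq> {}" using irr by (simp add: irreducible_rs_def)

text \<open>Otherwise the roots with and without the property would split \<open>D\<close> into two
  orthogonal parts. The rule propagates a property along chains of nonorthogonal roots.\<close>

lemma irreducible_induct:
  assumes "\<alpha> \<in> D" "P \<alpha>" "\<And>\<alpha> \<beta>. \<alpha> \<in> D \<Longrightarrow> P \<alpha> \<Longrightarrow> \<beta> \<in> D \<Longrightarrow> cr \<alpha> \<beta> \<noteq> 0 \<Longrightarrow> P \<beta>" "\<beta> \<in> D"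
  shows "P \<beta>"
proof (rule ccontr)
  assume "\<not> P \<beta>"
  then have "{x\<in>D. P x} \<noteq> {}" "{x\<in>D. \<not> P x} \<noteq> {}" using assms(1,2,4) by auto
  moreover have "{x\<in>D. P x} \<union> {x\<in>D. \<not> P x} = D" "{x\<in>D. P x} \<inter> {x\<in>D. \<not> P x} = {}" by auto
  moreover have "\<forall>\<alpha>\<in>{x\<in>D. P x}. \<forall>\<beta>\<in>{x\<in>D. \<not> P x}. cr \<alpha> \<beta> = 0" using assms(3) by auto
  ultimately have "\<exists>A B. A \<noteq> {} \<and> B \<noteq> {} \<and> A \<union> B = D \<and> A \<inter> B = {} \<and> (\<forall>\<alpha>\<in>A. \<forall>\<beta>\<in>B. cr \<alpha> \<beta> = 0)"
    by (intro exI[of _ "{x\<in>D. P x}"] exI[of _ "{x\<in>D. \<not> P x}"] conjI)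
  then show False using irr unfolding irreducible_rs_def by simp
qed

text \<open>If an orbit element is nonorthogonal to \<gamma>, and \<gamma> to \<delta>, then that
  element or its reflection in \<gamma> is nonorthogonal to \<delta>. Irreducibility spreads this to
  all roots, and \<open>s \<alpha>\<close> corrects the sign at the end.\<close>

lemma orbit_meets:
  assumes "\<alpha> \<in> D" "\<beta> \<in> D"
  obtains \<beta>' where "\<beta>' \<in> orb \<beta>" "\<beta>' \<in> D" "cr \<alpha> \<beta>' > 0"
proof -
  have "\<exists>\<beta>'\<in>orb \<beta>. cr \<alpha> \<beta>' \<noteq> 0"
  proof (rule irreducible_induct[OF assms(2), where P = "\<lambda>\<gamma>. \<exists>\<beta>'\<in>orb \<beta>. cr \<gamma> \<beta>' \<noteq> 0"])
    show "\<exists>\<beta>'\<in>orb \<beta>. cr \<beta> \<beta>' \<noteq> 0" using orb_base coroot_self[OF assms(2)] by (metis zero_neq_numeral)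
    fix \<gamma> \<delta> assume g: "\<gamma> \<in> D" "\<exists>\<beta>'\<in>orb \<beta>. cr \<gamma> \<beta>' \<noteq> 0" "\<delta> \<in> D" "cr \<gamma> \<delta> \<noteq> 0"
    then obtain \<beta>' where b: "\<beta>' \<in> orb \<beta>" "cr \<gamma> \<beta>' \<noteq> 0" by auto
    have "cr \<delta> (s \<gamma> \<beta>') = cr \<delta> \<beta>' - cr \<gamma> \<beta>' * cr \<delta> \<gamma>"
      using coroot_linear[OF g(3)] by (simp add: s_def linear_diff linear_cmul)
    moreover have "cr \<gamma> \<beta>' * cr \<delta> \<gamma> \<noteq> 0" using b g coroot_zero_sym by auto
    ultimately have "cr \<delta> \<beta>' \<noteq> 0 \<or> cr \<delta> (s \<gamma> \<beta>') \<noteq> 0" by linarith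
    then show "\<exists>\<beta>'\<in>orb \<beta>. cr \<delta> \<beta>' \<noteq> 0" using orb_step[OF g(1) b(1)] b(1) by blast
  qed (use assms in auto)
  then obtain \<beta>' where b: "\<beta>' \<in> orb \<beta>" "cr \<alpha> \<beta>' \<noteq> 0" by auto
  show thesis
  proof (cases "cr \<alpha> \<beta>' > 0")
    case True then show thesis using that b orb_in assms by blast
  next
    case False
    then have "cr \<alpha> (s \<alpha> \<beta>') > 0" using b coroot_s_self[OF assms(1)] by simp
    then show thesis using that[OF orb_step[OF assms(1) b(1)]] orb_in[OF orb_step[OF assms(1) b(1)]] assms by blast
  qed
qed

text \<open>This is conjugacy of roots of equal length, phrased for invariants of reflections. After
  \<beta> is moved within its orbit to an acute angle with \<alpha>, equal lengths make the two
  pairings agree, so both are 1 or both are 2.\<close>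

lemma equal_length_invariant:
  assumes inv: "\<And>\<gamma> \<delta>. \<gamma> \<in> D \<Longrightarrow> \<delta> \<in> D \<Longrightarrow> r (s \<gamma> \<delta>) = r \<delta>"
    and "\<alpha> \<in> D" "\<beta> \<in> D" "fm \<alpha> \<alpha> = fm \<beta> \<beta>"
  shows "r \<alpha> = r \<beta>"
proof -
  obtain \<beta>' where b: "\<beta>' \<in> orb \<beta>" "\<beta>' \<in> D" "cr \<alpha> \<beta>' > 0" using orbit_meets assms by blast
  have "r \<delta> = r \<beta>" if "\<delta> \<in> orb \<beta>" for \<delta>
    using that by (induction rule: orb.induct) (use inv orb_in assms(3) in auto)
  then have rb: "r \<beta>' = r \<beta>" using b by simp
  obtain p q :: int where pq: "p > 0" "q > 0" "cr \<alpha> \<beta>' = of_int p" "cr \<beta>' \<alpha> = of_int q"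
    "p * q \<le> 4" "of_int p * fm \<alpha> \<alpha> = of_int q * fm \<beta>' \<beta>'" "p * q = 4 \<Longrightarrow> \<beta>' = (of_int p / 2) *\<^sub>R \<alpha>"
    using coroot_pair[OF assms(2) b(2,3)] by metis
  have eq: "p = q" using pq(6) orb_fm[OF b(1) assms(3)] assms(4) fm_pos[OF assms(3)] by simp
  have "p < 3"
  proof (rule ccontr)
    assume "\<not> p < 3"
    then have "3 * 3 \<le> p * p" by (intro mult_mono) auto
    then show False using pq(5) eq by simp
  qed
  then consider "p = 1" | "p = 2" using pq(1) by linarith
  then have "r \<beta>' = r \<alpha>"
  proof cases
    case 1
    \<comment> \<open>With both pairings equal to 1 the roots span a system of type A_2, where three
      reflections carry one to the other.\<close>
    have e: "s \<alpha> (s \<beta>' (s \<alpha> \<beta>')) = \<alpha>"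
    proof -
      have "s \<alpha> \<beta>' = \<beta>' - \<alpha>" using pq(3) 1 by (simp add: s_def)
      moreover have "s \<beta>' (\<beta>' - \<alpha>) = - \<alpha>"
        using pq(4) 1 eq linear_diff[OF coroot_linear[OF b(2)]] coroot_self[OF b(2)] by (simp add: s_def)
      ultimately show ?thesis using linear_neg[OF s_linear[OF assms(2)]] s_self[OF assms(2)] by simp
    qed
    have "r (s \<alpha> (s \<beta>' (s \<alpha> \<beta>'))) = r \<beta>'" using inv s_in assms(2) b(2) by metis
    then show ?thesis using e by simp
  next
    case 2 then show ?thesis using pq(7) eq by simp
  qed
  then show ?thesis using rb by simp
qed

text \<open>Moving \<alpha> to an acute angle with \<gamma> gives pairings with q = 1 and p one of
  2, 3, 4. The value 4 would make a conjugate of \<alpha> twice \<gamma>, hence \<alpha>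
  extra-long.\<close>

lemma length_ratio:
  assumes "\<gamma> \<in> D" "\<alpha> \<in> D" "\<not> extralong_root D \<alpha>" "fm \<gamma> \<gamma> < fm \<alpha> \<alpha>"
  shows "fm \<alpha> \<alpha> = 2 * fm \<gamma> \<gamma> \<or> fm \<alpha> \<alpha> = 3 * fm \<gamma> \<gamma>"
proof -
  obtain \<beta> where b: "\<beta> \<in> orb \<alpha>" "\<beta> \<in> D" "cr \<gamma> \<beta> > 0" using orbit_meets assms by blast
  obtain p q :: int where pq: "p > 0" "q > 0" "p * q \<le> 4"
    "of_int p * fm \<gamma> \<gamma> = of_int q * fm \<beta> \<beta>" "p * q = 4 \<Longrightarrow> \<beta> = (of_int p / 2) *\<^sub>R \<gamma>"
    using coroot_pair[OF assms(1) b(2,3)] by metis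
  note eq = orb_fm[OF b(1) assms(2)]
  have "of_int q * fm \<gamma> \<gamma> < of_int q * fm \<beta> \<beta>" using assms(4) eq pq by simp
  then have "of_int q * fm \<gamma> \<gamma> < of_int p * fm \<gamma> \<gamma>" using pq by simp
  then have "q < p" using fm_pos[OF assms(1)] by simp
  have q1: "q = 1"
  proof (rule ccontr)
    assume "q \<noteq> 1"
    then have "3 * 2 \<le> p * q" using pq \<open>q < p\<close> by (intro mult_mono) auto
    then show False using pq by simp
  qed
  have "p \<noteq> 4"
  proof
    assume "p = 4"
    then have "\<beta> = 2 *\<^sub>R \<gamma>" using pq(5) q1 by simp
    then have "extralong_root D \<beta>" using b assms by (auto simp: extralong_root_def)
    then show False using extralong_orb b assms by blast
  qed
  then have "p = 2 \<or> p = 3" using pq q1 \<open>q < p\<close> by auto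
  then show ?thesis using pq(4) q1 eq by auto
qed

lemma ex_short: "\<exists>\<alpha>. short_root D \<alpha>"
proof -
  obtain \<alpha> where "\<alpha> \<in> D" "fm \<alpha> \<alpha> = Min ((\<lambda>\<alpha>. fm \<alpha> \<alpha>) ` D)"
    using Min_in[of "(\<lambda>\<alpha>. fm \<alpha> \<alpha>) ` D"] fin nonempty by fastforce
  then show ?thesis using fin by (auto simp: short_root_def)
qed

lemma short_length: "short_root D \<alpha> \<Longrightarrow> short_root D \<beta> \<Longrightarrow> fm \<alpha> \<alpha> = fm \<beta> \<beta>"
  by (auto simp: short_root_def intro: antisym)

text \<open>Two different long lengths would be 2 and 3 times the short squared length, and their
  ratio 3/2 is itself excluded by \<open>length_ratio\<close>. Together with
  \<open>equal_length_invariant\<close> this makes the choice of a long root in \<open>rkv\<close>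
  immaterial.\<close>

lemma long_length:
  assumes "long_root D \<alpha>" "long_root D \<beta>"
  shows "fm \<alpha> \<alpha> = fm \<beta> \<beta>"
proof -
  obtain \<gamma> where g: "short_root D \<gamma>" using ex_short by blast
  have gD: "\<gamma> \<in> D" using g by (simp add: short_root_def)
  have l: "\<delta> \<in> D \<and> \<not> extralong_root D \<delta> \<and> fm \<gamma> \<gamma> < fm \<delta> \<delta>" if "long_root D \<delta>" for \<delta>
    using that g unfolding long_root_def short_root_def by (metis leI order_trans)
  note a = length_ratio[OF gD] fm_pos[OF gD]
  have "\<not> fm \<delta> \<delta> < fm \<epsilon> \<epsilon>" if "long_root D \<delta>" "long_root D \<epsilon>" for \<delta> \<epsilon>
    using a l[OF that(1)] l[OF that(2)] length_ratio[of \<delta> \<epsilon>] by smt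
  then show ?thesis using assms by (meson linorder_cases)
qed

text \<open>The coroot of \<open>2 *\<^sub>R \<alpha>\<close> is half that of \<alpha> and must
  still be integral on \<beta>.\<close>

lemma double_even:
  assumes "\<alpha> \<in> D" "2 *\<^sub>R \<alpha> \<in> D" "\<beta> \<in> D" "cr \<alpha> \<beta> = of_int p"
  shows "even p"
proof -
  have "of_int p / (2::real) \<in> \<int>"
    using coroot_int[OF assms(2,3)] coroot_scale[OF assms(1,2), of \<beta>] assms(3,4) span_base by metis
  then obtain r where "of_int p / (2::real) = of_int r" using Ints_cases by metis
  then have "(of_int p :: real) = of_int (2 * r)" by simp
  then have "p = 2 * r" using of_int_eq_iff by blast
  then show ?thesis by simp
qed

text \<open>For the halves of two extra-long roots, placed at an acute angle, both pairings are even
  and have product at most 4. Hence they are equal, and so are the lengths.\<close>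

lemma extralong_length:
  assumes "extralong_root D \<alpha>" "extralong_root D \<beta>"
  shows "fm \<alpha> \<alpha> = fm \<beta> \<beta>"
proof -
  obtain a b where a: "a \<in> D" "\<alpha> = 2 *\<^sub>R a" "2 *\<^sub>R a \<in> D" and b: "b \<in> D" "\<beta> = 2 *\<^sub>R b" "2 *\<^sub>R b \<in> D"
    using assms by (auto simp: extralong_root_def)
  obtain b' where b': "b' \<in> orb b" "b' \<in> D" "cr a b' > 0" using orbit_meets a b by blast
  obtain p q :: int where pq: "p > 0" "q > 0" "cr a b' = of_int p" "cr b' a = of_int q" "p * q \<le> 4"
    "of_int p * fm a a = of_int q * fm b' b'"
    using coroot_pair[OF a(1) b'(2,3)] by metis
  have ev: "even p" "even q"
    using double_even[OF a(1,3) b'(2) pq(3)] double_even[OF b'(2) orb_double[OF b'(1) b(1,3)] a(1) pq(4)] by auto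
  then have "p \<ge> 2" "q \<ge> 2" using pq by presburger+
  then have "2 * q \<le> p * q" "p * 2 \<le> p * q" using pq by (auto intro: mult_mono)
  then have "p = q" using pq \<open>p \<ge> 2\<close> \<open>q \<ge> 2\<close> by linarith
  then have "fm a a = fm b b" using pq orb_fm[OF b'(1) b(1)] by simp
  then show ?thesis using a b by (simp add: linear_cmul[OF fm_lin] linear_cmul[OF fm_lin2])
qed

lemma ex_extralong: "\<not> reduced_rs D \<Longrightarrow> \<exists>\<alpha>. extralong_root D \<alpha>"
  by (auto simp: reduced_rs_def extralong_root_def)

lemma ex_long_reduced:
  assumes "reduced_rs D" "\<not> simply_laced D"
  shows "\<exists>\<alpha>. long_root D \<alpha>"
proof -
  have ne: "\<not> extralong_root D \<alpha>" for \<alpha> using assms(1) by (auto simp: reduced_rs_def extralong_root_def)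
  obtain \<alpha> \<beta> where ab: "\<alpha> \<in> D" "\<beta> \<in> D" "fm \<alpha> \<alpha> \<noteq> fm \<beta> \<beta>" using assms(2) by (auto simp: simply_laced_def)
  then have "\<not> short_root D \<alpha> \<or> \<not> short_root D \<beta>" using short_length by blast
  then show ?thesis using ab ne by (auto simp: long_root_def)
qed

text \<open>Rank above 1 provides a root \<beta> off the line of a doubled root \<alpha> and acute
  to it. Evenness and p q < 4 leave only p = 2 and q = 1: \<beta> is longer than \<alpha>, yet it
  cannot be a double, because its half would pair with \<alpha> to the odd number 1.\<close>

lemma ex_long_nonreduced:
  assumes "\<not> reduced_rs D" "dim (span D) \<noteq> 1"
  shows "\<exists>\<alpha>. long_root D \<alpha>"
proof -
  obtain \<alpha> where a: "\<alpha> \<in> D" "2 *\<^sub>R \<alpha> \<in> D" using assms(1) by (auto simp: reduced_rs_def)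
  have "\<not> D \<subseteq> span {\<alpha>}"
  proof
    assume "D \<subseteq> span {\<alpha>}"
    then have "span D = span {\<alpha>}"
      using a by (metis empty_subsetI insert_subset span_eq span_superset subset_trans)
    moreover have "dim {\<alpha>} = card {\<alpha>}" using nz[OF a(1)] by (intro dim_eq_card_independent) simp
    ultimately show False using assms(2) by (simp add: dim_span)
  qed
  then obtain \<beta>0 where b0: "\<beta>0 \<in> D" "\<beta>0 \<notin> span {\<alpha>}" by auto
  have "\<exists>\<beta>\<in>D. \<beta> \<notin> span {\<alpha>} \<and> cr \<alpha> \<beta> \<noteq> 0"
  proof (rule ccontr)
    assume c: "\<not> ?thesis"
    have "\<beta>0 \<in> span {\<alpha>}"
    proof (rule irreducible_induct[OF a(1), where P = "\<lambda>x. x \<in> span {\<alpha>}"])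
      fix \<gamma> \<delta> assume g: "\<gamma> \<in> D" "\<gamma> \<in> span {\<alpha>}" "\<delta> \<in> D" "cr \<gamma> \<delta> \<noteq> 0"
      then obtain t where "\<gamma> = t *\<^sub>R \<alpha>" by (auto simp: span_singleton)
      then have "cr \<alpha> \<delta> \<noteq> 0" using coroot_scale[OF a(1), of t \<delta>] g span_base[OF g(3)] by auto
      then show "\<delta> \<in> span {\<alpha>}" using c g(3) by blast
    qed (use b0 in \<open>auto simp: span_base\<close>)
    then show False using b0 by simp
  qed
  then obtain \<beta>1 where b1: "\<beta>1 \<in> D" "\<beta>1 \<notin> span {\<alpha>}" "cr \<alpha> \<beta>1 \<noteq> 0" by auto
  obtain \<beta> where b: "\<beta> \<in> D" "\<beta> \<notin> span {\<alpha>}" "cr \<alpha> \<beta> > 0"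
  proof (cases "cr \<alpha> \<beta>1 > 0")
    case True then show thesis using that b1 by blast
  next
    case False
    have "s \<alpha> \<beta>1 \<notin> span {\<alpha>}"
    proof
      assume "s \<alpha> \<beta>1 \<in> span {\<alpha>}"
      then have "s \<alpha> \<beta>1 + cr \<alpha> \<beta>1 *\<^sub>R \<alpha> \<in> span {\<alpha>}" using span_add[OF _ span_mul[OF span_base], of "s \<alpha> \<beta>1" "{\<alpha>}" \<alpha>] by simp
      then show False using b1 by (simp add: s_def)
    qed
    then show thesis using that[of "s \<alpha> \<beta>1"] s_in[OF a(1) b1(1)] coroot_s_self[OF a(1), of \<beta>1] False b1 by simp
  qed
  obtain p q :: int where pq: "p > 0" "q > 0" "cr \<alpha> \<beta> = of_int p" "p * q \<le> 4"
    "of_int p * fm \<alpha> \<alpha> = of_int q * fm \<beta> \<beta>" "p * q = 4 \<Longrightarrow> \<beta> = (of_int p / 2) *\<^sub>R \<alpha>"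
    using coroot_pair[OF a(1) b(1,3)] by metis
  have "p * q \<noteq> 4" using pq(6) b(2) by (auto simp: span_singleton)
  have "even p" using double_even[OF a b(1) pq(3)] .
  then have "p \<ge> 2" using pq by presburger
  have q1: "q = 1"
  proof (rule ccontr)
    assume "q \<noteq> 1"
    then have "2 * 2 \<le> p * q" using pq \<open>p \<ge> 2\<close> by (intro mult_mono) auto
    then show False using pq \<open>p * q \<noteq> 4\<close> by simp
  qed
  then have p2: "p = 2" using pq \<open>p * q \<noteq> 4\<close> \<open>p \<ge> 2\<close> \<open>even p\<close> by presburger
  have "fm \<alpha> \<alpha> < fm \<beta> \<beta>" using pq(5) p2 q1 fm_pos[OF a(1)] by simp
  then have "\<not> short_root D \<beta>" using a(1) by (auto simp: short_root_def not_le intro!: bexI[of _ \<alpha>])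
  moreover have "\<not> extralong_root D \<beta>"
  proof
    assume "extralong_root D \<beta>"
    then obtain \<delta> where d: "\<delta> \<in> D" "\<beta> = 2 *\<^sub>R \<delta>" by (auto simp: extralong_root_def)
    then have "cr \<alpha> \<delta> = of_int 1" using pq(3) p2 linear_cmul[OF coroot_linear[OF a(1)]] by simp
    then show False using double_even[OF a d(1)] by fastforce
  qed
  ultimately show ?thesis using b(1) by (auto simp: long_root_def)
qed

end

section \<open>Isomorphic root systems\<close>

locale rsys_iso = rsys D + E: rsys E for D :: "'v::real_vector set" and E :: "'w::real_vector set" +
  fixes \<phi> :: "'v \<Rightarrow> 'w"
  assumes lin: "linear \<phi>" and inj: "inj_on \<phi> (span D)" and img: "\<phi> ` D = E"
begin

text \<open>Composing the coroot of \<alpha> with a left inverse of \<phi> yields a functional with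
  the defining properties of the coroot of \<open>\<phi> \<alpha>\<close>, so uniqueness applies.
  The form and all notions of length follow along.\<close>

lemma coroot_iso: "\<alpha> \<in> D \<Longrightarrow> \<beta> \<in> D \<Longrightarrow> E.cr (\<phi> \<alpha>) (\<phi> \<beta>) = cr \<alpha> \<beta>"
proof -
  assume a: "\<alpha> \<in> D" "\<beta> \<in> D"
  obtain g where g: "linear g" "\<And>x. x \<in> span D \<Longrightarrow> g (\<phi> x) = x"
    using linear_inj_on_left_inverse[OF lin inj] by blast
  have "E.cr (\<phi> \<alpha>) (\<phi> \<beta>) = (cr \<alpha> \<circ> g) (\<phi> \<beta>)"
  proof (rule E.coroot_unique)
    show "linear (cr \<alpha> \<circ> g)" using linear_compose[OF g(1) coroot_linear[OF a(1)]] .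
    fix \<delta> assume "\<delta> \<in> E"
    then obtain d where d: "d \<in> D" "\<delta> = \<phi> d" using img by auto
    then have "\<delta> - (cr \<alpha> \<circ> g) \<delta> *\<^sub>R \<phi> \<alpha> = \<phi> (s \<alpha> d)"
      using g(2) lin by (simp add: s_def linear_diff linear_cmul span_base)
    then show "\<delta> - (cr \<alpha> \<circ> g) \<delta> *\<^sub>R \<phi> \<alpha> \<in> E" using s_in[OF a(1) d(1)] img by auto
  qed (use a g(2) img in \<open>auto simp: span_base coroot_self\<close>)
  then show ?thesis using g(2)[OF span_base[OF a(2)]] by simp
qed

lemma fm_iso: "\<alpha> \<in> D \<Longrightarrow> \<beta> \<in> D \<Longrightarrow> E.fm (\<phi> \<alpha>) (\<phi> \<beta>) = fm \<alpha> \<beta>"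
proof -
  assume a: "\<alpha> \<in> D" "\<beta> \<in> D"
  have "inj_on \<phi> D" by (rule inj_on_subset[OF inj span_superset])
  then have "E.fm (\<phi> \<alpha>) (\<phi> \<beta>) = (\<Sum>\<gamma>\<in>D. E.cr (\<phi> \<gamma>) (\<phi> \<alpha>) * E.cr (\<phi> \<gamma>) (\<phi> \<beta>))"
    unfolding rs_form_def using sum.reindex[of \<phi> D] img by simp
  also have "\<dots> = fm \<alpha> \<beta>" unfolding rs_form_def by (rule sum.cong) (use a coroot_iso in auto)
  finally show ?thesis .
qed

lemma double_iso: "\<alpha> \<in> D \<Longrightarrow> 2 *\<^sub>R \<phi> \<alpha> \<in> E \<longleftrightarrow> 2 *\<^sub>R \<alpha> \<in> D"
proof -
  assume a: "\<alpha> \<in> D"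
  have "2 *\<^sub>R \<alpha> = d" if "d \<in> D" "2 *\<^sub>R \<phi> \<alpha> = \<phi> d" for d
    using inj_onD[OF inj, of "2 *\<^sub>R \<alpha>" d] that a lin by (simp add: linear_cmul span_base span_mul)
  moreover have "2 *\<^sub>R \<phi> \<alpha> = \<phi> (2 *\<^sub>R \<alpha>)" using linear_cmul[OF lin] by simp
  ultimately show ?thesis using img by (metis image_iff)
qed

lemma reduced_iso: "reduced_rs E \<longleftrightarrow> reduced_rs D"
  using double_iso img by (auto simp: reduced_rs_def)

lemma simply_laced_iso: "simply_laced E \<longleftrightarrow> simply_laced D"
  unfolding simply_laced_def img[symmetric] ball_simps by (simp add: fm_iso img cong: ball_cong)

lemma short_iso: "\<alpha> \<in> D \<Longrightarrow> short_root E (\<phi> \<alpha>) \<longleftrightarrow> short_root D \<alpha>"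
  using fm_iso img by (auto simp: short_root_def)

lemma extralong_iso: "\<alpha> \<in> D \<Longrightarrow> extralong_root E (\<phi> \<alpha>) \<longleftrightarrow> extralong_root D \<alpha>"
proof -
  assume a: "\<alpha> \<in> D"
  have "\<alpha> = 2 *\<^sub>R d" if "d \<in> D" "\<phi> \<alpha> = 2 *\<^sub>R \<phi> d" for d
    using inj_onD[OF inj, of \<alpha> "2 *\<^sub>R d"] that a lin by (simp add: linear_cmul span_base span_mul)
  then show ?thesis using a img linear_cmul[OF lin, of 2] by (force simp: extralong_root_def image_iff)
qed

lemma long_iso: "\<alpha> \<in> D \<Longrightarrow> long_root E (\<phi> \<alpha>) \<longleftrightarrow> long_root D \<alpha>"
  using short_iso extralong_iso img by (auto simp: long_root_def)

lemma dim_iso: "dim (span E) = dim (span D)"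
proof -
  obtain B where B: "B \<subseteq> D" "independent B" "D \<subseteq> span B"
    using maximal_independent_subset by metis
  have sB: "span B = span D" using B by (metis span_mono span_span subset_antisym)
  have "independent (\<phi> ` B)" using linear_dependent_inj_imageD[OF lin, of B] B(2) inj sB by auto
  moreover have "span E = span (\<phi> ` B)" using linear_span_image[OF lin] img sB by metis
  moreover have "card (\<phi> ` B) = card B" using inj_on_subset[OF inj, of B] B(1) sB span_superset
    by (metis card_image)
  ultimately have "dim (span E) = card B" by (metis dim_span dim_eq_card_independent)
  also have "\<dots> = dim (span D)" using sB B(2) by (metis dim_span dim_eq_card_independent)
  finally show ?thesis .
qed

end

section \<open>Generic real functionals on the grading group\<close>

lemma countable_int_combinations:
  fixes A :: "'v::real_vector set"
  assumes "finite A"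
  shows "countable {x. \<exists>c::'v \<Rightarrow> int. x = (\<Sum>\<alpha>\<in>A. of_int (c \<alpha>) *\<^sub>R \<alpha>)}"
  using assms
proof (induction A)
  case (insert a A)
  have "{x. \<exists>c::'v \<Rightarrow> int. x = (\<Sum>\<alpha>\<in>insert a A. of_int (c \<alpha>) *\<^sub>R \<alpha>)}
    \<subseteq> (\<lambda>(k::int, x). of_int k *\<^sub>R a + x) ` (UNIV \<times> {x. \<exists>c::'v \<Rightarrow> int. x = (\<Sum>\<alpha>\<in>A. of_int (c \<alpha>) *\<^sub>R \<alpha>)})"
    using insert.hyps by (auto simp: image_iff)
  then show ?case using insert.IH by (meson countable_SIGMA countable_image countable_subset countableI_type)
qed simp

lemma root_lattice_subset:
  assumes "finite \<Delta>"
  shows "root_lattice \<Delta> = {x. \<exists>c::'v::real_vector \<Rightarrow> int. x = (\<Sum>\<alpha>\<in>\<Delta>. of_int (c \<alpha>) *\<^sub>R \<alpha>)}"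
proof -
  have "(\<Sum>\<alpha>\<in>F. of_int (c \<alpha>) *\<^sub>R \<alpha>) = (\<Sum>\<alpha>\<in>\<Delta>. of_int (if \<alpha> \<in> F then c \<alpha> else 0) *\<^sub>R \<alpha>)"
    if "F \<subseteq> \<Delta>" for F and c :: "'v \<Rightarrow> int"
    by (rule sum.mono_neutral_cong_left[OF assms that]) auto
  note e = this
  show "root_lattice \<Delta> = {x. \<exists>c::'v \<Rightarrow> int. x = (\<Sum>\<alpha>\<in>\<Delta>. of_int (c \<alpha>) *\<^sub>R \<alpha>)}"
  proof (intro set_eqI iffI)
    fix x assume "x \<in> root_lattice \<Delta>"
    then obtain F and c :: "'v \<Rightarrow> int" where F: "F \<subseteq> \<Delta>" and x: "x = (\<Sum>\<alpha>\<in>F. of_int (c \<alpha>) *\<^sub>R \<alpha>)"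
      by (auto simp: root_lattice_def)
    define c' where "c' = (\<lambda>\<alpha>. if \<alpha> \<in> F then c \<alpha> else 0)"
    have "x = (\<Sum>\<alpha>\<in>\<Delta>. of_int (c' \<alpha>) *\<^sub>R \<alpha>)" unfolding x c'_def by (rule e[OF F])
    then show "x \<in> {x. \<exists>c::'v \<Rightarrow> int. x = (\<Sum>\<alpha>\<in>\<Delta>. of_int (c \<alpha>) *\<^sub>R \<alpha>)}" by blast
  next
    fix x assume "x \<in> {x. \<exists>c::'v \<Rightarrow> int. x = (\<Sum>\<alpha>\<in>\<Delta>. of_int (c \<alpha>) *\<^sub>R \<alpha>)}"
    then show "x \<in> root_lattice \<Delta>" unfolding root_lattice_def using assms by blast
  qed
qed

lemma countable_root_lattice: "finite \<Delta> \<Longrightarrow> countable (root_lattice \<Delta>)"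
  by (simp add: countable_int_combinations root_lattice_subset)

lemma countable_lat: "countable (lat n)"
proof -
  have "lat n \<subseteq> (\<lambda>xs i. if i < length xs then xs ! i else 0) ` (UNIV :: int list set)"
  proof
    fix l assume "l \<in> lat n"
    then have "l = (\<lambda>i. if i < length (map l [0..<n]) then map l [0..<n] ! i else 0)"
      by (auto simp: lat_def)
    then show "l \<in> (\<lambda>xs i. if i < length xs then xs ! i else 0) ` UNIV" by blast
  qed
  then show ?thesis by (meson countable_image countable_subset countableI_type)
qed

lemma root_lattice_diff: "finite \<Delta> \<Longrightarrow> x \<in> root_lattice \<Delta> \<Longrightarrow> y \<in> root_lattice \<Delta> \<Longrightarrow> x - y \<in> root_lattice \<Delta>"
proof -
  assume a: "finite \<Delta>" "x \<in> root_lattice \<Delta>" "y \<in> root_lattice \<Delta>"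
  then obtain c d :: "_ \<Rightarrow> int" where "x = (\<Sum>\<alpha>\<in>\<Delta>. of_int (c \<alpha>) *\<^sub>R \<alpha>)" "y = (\<Sum>\<alpha>\<in>\<Delta>. of_int (d \<alpha>) *\<^sub>R \<alpha>)"
    by (auto simp: root_lattice_subset)
  moreover define c' where "c' = (\<lambda>\<alpha>. c \<alpha> - d \<alpha>)"
  ultimately have "x - y = (\<Sum>\<alpha>\<in>\<Delta>. of_int (c' \<alpha>) *\<^sub>R \<alpha>)"
    by (simp add: sum_subtractf algebra_simps)
  then show ?thesis unfolding root_lattice_subset[OF a(1)] by blast
qed

lemma root_lattice_base: "\<alpha> \<in> \<Delta> \<Longrightarrow> \<alpha> \<in> root_lattice \<Delta>"
  unfolding root_lattice_def by (intro CollectI exI[of _ "{\<alpha>}"] exI[of _ "\<lambda>_. 1"]) auto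

lemma root_lattice_span: "root_lattice \<Delta> \<subseteq> span \<Delta>"
proof
  fix x assume "x \<in> root_lattice \<Delta>"
  then obtain F and c :: "_ \<Rightarrow> int" where "F \<subseteq> \<Delta>" "x = (\<Sum>\<alpha>\<in>F. of_int (c \<alpha>) *\<^sub>R \<alpha>)"
    by (auto simp: root_lattice_def)
  then show "x \<in> span \<Delta>" by (auto intro!: span_sum span_mul intro: span_base)
qed

text \<open>A functional with coefficients 1, t, t^2, ... in a basis is injective on the
  countable group for all but countably many t.\<close>
lemma generic_functional:
  fixes \<Delta> :: "'v::real_vector set"
  assumes fin: "finite \<Delta>"
  obtains h :: "'v \<Rightarrow> real" and k :: "(nat \<Rightarrow> int) \<Rightarrow> real"
  where "linear h" "\<And>x y. k (x + y) = k x + k y"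
    "inj_on (\<lambda>p. h (fst p) + k (snd p)) (root_lattice \<Delta> \<times> lat n)"
proof -
  obtain B where B: "B \<subseteq> \<Delta>" "independent B" "\<Delta> \<subseteq> span B"
    using maximal_independent_subset by metis
  have finB: "finite B" using B(1) fin finite_subset by blast
  define d where "d = card B"
  obtain b where b: "bij_betw b {..<d} B" using ex_bij_betw_nat_finite[OF finB] by (auto simp: d_def atLeast0LessThan)
  have "\<exists>f::'v \<Rightarrow> real. linear f \<and> (\<forall>j<d. f (b j) = (if j = i then 1 else 0))" if "i < d" for i
  proof -
    obtain f :: "'v \<Rightarrow> real" where "linear f" "\<forall>x\<in>B. f x = (if x = b i then 1 else 0)"
      using linear_independent_extend[OF B(2), of "\<lambda>x. if x = b i then 1 else 0"] by blast
    moreover have "b j = b i \<longleftrightarrow> j = i" if "j < d" for j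
      using b \<open>i < d\<close> that by (auto simp: bij_betw_def inj_on_def)
    moreover have "b j \<in> B" if "j < d" for j using b that by (auto simp: bij_betw_def)
    ultimately show ?thesis by auto
  qed
  then obtain f :: "nat \<Rightarrow> 'v \<Rightarrow> real" where f: "\<And>i. i < d \<Longrightarrow> linear (f i)"
      "\<And>i j. i < d \<Longrightarrow> j < d \<Longrightarrow> f i (b j) = (if j = i then 1 else 0)" by metis
  have sep: "x = 0" if xB: "x \<in> span B" and f0: "\<And>i. i < d \<Longrightarrow> f i x = 0" for x
  proof -
    have imB: "B = b ` {..<d}" using b by (simp add: bij_betw_def)
    obtain a where "x = (\<Sum>v\<in>B. a v *\<^sub>R v)" using xB unfolding span_finite[OF finB] by blast
    then have x: "x = (\<Sum>j<d. a (b j) *\<^sub>R b j)" using sum.reindex_bij_betw[OF b, of "\<lambda>v. a v *\<^sub>R v"] by simp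
    have "a (b i) = 0" if "i < d" for i
    proof -
      have "f i x = (\<Sum>j<d. a (b j) * (if j = i then 1 else 0))"
        unfolding x linear_sum[OF f(1)[OF that]] using f that by (intro sum.cong) (auto simp: linear_cmul)
      then show ?thesis using f0[OF that] that by (simp add: if_distrib cong: if_cong)
    qed
    then show ?thesis using x by simp
  qed
  \<comment> \<open>One list of coordinates for both factors: the first \<open>d\<close> belong to
    the root part in the basis \<open>B\<close>, the other \<open>n\<close> to the lattice
    part.\<close>
  define co where "co p i = (if i < d then f i (fst p) else of_int (snd p (i - d)))" for p :: "'v \<times> (nat \<Rightarrow> int)" and i
  define S where "S = root_lattice \<Delta> \<times> lat n"
  have S0: "p = 0" if "p \<in> S" "\<And>i. i < d + n \<Longrightarrow> co p i = 0" for p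
  proof -
    have "fst p \<in> span B"
      using that(1) root_lattice_span[of \<Delta>] span_mono[OF B(3)] by (auto simp: S_def span_span)
    then have "fst p = 0"
    proof (rule sep)
      fix i assume "i < d"
      then show "f i (fst p) = 0" using that(2)[of i] by (simp add: co_def)
    qed
    moreover have "snd p i = 0" for i
    proof (cases "i < n")
      case True then show ?thesis using that(2)[of "d + i"] by (simp add: co_def)
    next
      case False then show ?thesis using that(1) by (auto simp: S_def lat_def)
    qed
    ultimately show ?thesis by (simp add: prod_eq_iff fun_eq_iff)
  qed
  have Sd: "p - q \<in> S" if "p \<in> S" "q \<in> S" for p q
    using that root_lattice_diff[OF fin] by (auto simp: S_def lat_def)
  \<comment> \<open>Each nonzero group element excludes the finitely many zeros of its coordinate
    polynomial. The sum runs up to exponent \<open>d + n\<close> inclusive, so the guard pads the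
    last coefficient with 0.\<close>
  have "countable (\<Union>p\<in>S - {0}. {t::real. (\<Sum>i\<le>d+n. (if i < d + n then co p i else 0) * t ^ i) = 0})"
  proof (rule countable_UN)
    show "countable (S - {0})" unfolding S_def
      using countable_root_lattice[OF fin] countable_lat by (intro countable_Diff countable_SIGMA)
    fix p assume p: "p \<in> S - {0}"
    then obtain i where "i < d + n" "co p i \<noteq> 0" using S0 by blast
    then show "countable {t::real. (\<Sum>i\<le>d+n. (if i < d + n then co p i else 0) * t ^ i) = 0}"
      using polyfun_roots_finite[of "\<lambda>i. if i < d + n then co p i else 0" i "d + n"] countable_finite by simp
  qed
  then have "(\<Union>p\<in>S - {0}. {t::real. (\<Sum>i\<le>d+n. (if i < d + n then co p i else 0) * t ^ i) = 0}) \<noteq> UNIV"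
    using uncountable_UNIV_real by metis
  then obtain t :: real where t: "\<And>p. p \<in> S - {0} \<Longrightarrow> (\<Sum>i\<le>d+n. (if i < d + n then co p i else 0) * t ^ i) \<noteq> 0"
    by blast
  define h where "h v = (\<Sum>i<d. t ^ i * f i v)" for v
  define k where "k l = (\<Sum>j<n. t ^ (d + j) * of_int (l j))" for l :: "nat \<Rightarrow> int"
  have hl: "linear h" unfolding h_def using f(1)
    by (intro linear_compose_sum ballI) (auto simp: linear_iff algebra_simps)
  have ka: "k (x + y) = k x + k y" for x y by (simp add: k_def sum.distrib algebra_simps)
  then have kd: "k (x - y) = k x - k y" for x y by (metis add_diff_cancel_right' diff_add_cancel)
  have hk: "h (fst p) + k (snd p) = (\<Sum>i\<le>d+n. (if i < d + n then co p i else 0) * t ^ i)" for p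
  proof -
    have "(\<Sum>i\<le>d+n. (if i < d + n then co p i else 0) * t ^ i) = (\<Sum>i<d+n. co p i * t ^ i)"
      by (rule sum.mono_neutral_cong_right) auto
    also have "\<dots> = (\<Sum>i<d. co p i * t ^ i) + (\<Sum>j<n. co p (d + j) * t ^ (d + j))"
      by (induction n) (simp_all add: add.assoc)
    finally show ?thesis by (simp add: h_def k_def co_def mult.commute)
  qed
  have "inj_on (\<lambda>p. h (fst p) + k (snd p)) S"
  proof (rule inj_onI)
    fix p q assume pq: "p \<in> S" "q \<in> S" "h (fst p) + k (snd p) = h (fst q) + k (snd q)"
    then have "h (fst (p - q)) + k (snd (p - q)) = 0"
      using kd linear_diff[OF hl] by simp
    then have "p - q = 0" using t[of "p - q"] Sd[OF pq(1,2)] hk[of "p - q"] by (metis Diff_iff singletonD)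
    then show "p = q" by simp
  qed
  then show thesis using that hl ka unfolding S_def by blast
qed

section \<open>Ranks over a commutative torsion-free ring of endomorphisms\<close>

text \<open>A commutative domain presented as a set of additive maps acting without torsion. The
  centroid is one instance; the integers acting on integer-valued functions are the other. Rank is
  developed by elimination inside the ring, with no field of fractions.\<close>

locale endo_ring =
  fixes C :: "('a::ab_group_add \<Rightarrow> 'a) set"
  assumes C_add: "c \<in> C \<Longrightarrow> c (x + y) = c x + c y"
    and C_plus: "c \<in> C \<Longrightarrow> d \<in> C \<Longrightarrow> (\<lambda>x. c x + d x) \<in> C"
    and C_neg: "c \<in> C \<Longrightarrow> (\<lambda>x. - c x) \<in> C"
    and C_comp: "c \<in> C \<Longrightarrow> d \<in> C \<Longrightarrow> (\<lambda>x. c (d x)) \<in> C"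
    and C_one: "(\<lambda>x. x) \<in> C"
    and C_comm: "c \<in> C \<Longrightarrow> d \<in> C \<Longrightarrow> c (d x) = d (c x)"
    and C_torsion_free: "c \<in> C \<Longrightarrow> c x = 0 \<Longrightarrow> x \<noteq> 0 \<Longrightarrow> c = (\<lambda>_. 0)"
    and nontriv: "\<exists>x::'a. x \<noteq> 0"
begin

lemma C_0: "c \<in> C \<Longrightarrow> c 0 = 0" using C_add[of c 0 0] by simp
lemma C_minus: "c \<in> C \<Longrightarrow> c (- x) = - c x"
  using C_add[of c x "- x"] C_0[of c] by (simp add: eq_neg_iff_add_eq_0 add.commute)
lemma C_diff: "c \<in> C \<Longrightarrow> c (x - y) = c x - c y"
  using C_add[of c x "- y"] C_minus[of c y] by simp
lemma C_sum: "c \<in> C \<Longrightarrow> c (sum f A) = (\<Sum>i\<in>A. c (f i))"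
  by (induction A rule: infinite_finite_induct) (auto simp: C_0 C_add)
lemma C_zero: "(\<lambda>_. 0) \<in> C" using C_plus[OF C_one C_neg[OF C_one]] by simp
lemma C_sum_mem: "(\<And>i. i \<in> A \<Longrightarrow> f i \<in> C) \<Longrightarrow> (\<lambda>x. \<Sum>i\<in>A. f i x) \<in> C"
  by (induction A rule: infinite_finite_induct) (auto simp: C_zero intro: C_plus)
lemma C_domain: "c \<in> C \<Longrightarrow> d \<in> C \<Longrightarrow> (\<lambda>x. c (d x)) = (\<lambda>_. 0) \<Longrightarrow> d \<noteq> (\<lambda>_. 0) \<Longrightarrow> c = (\<lambda>_. 0)"
proof -
  assume a: "c \<in> C" "d \<in> C" "(\<lambda>x. c (d x)) = (\<lambda>_. 0)" "d \<noteq> (\<lambda>_. 0)"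
  then obtain x where "d x \<noteq> 0" by auto
  moreover have "c (d x) = 0" using a(3) by (rule fun_cong)
  ultimately show ?thesis using C_torsion_free[OF a(1)] by blast
qed
lemma one_nonzero: "(\<lambda>x. x) \<noteq> (\<lambda>_::'a. 0)" using nontriv by (metis)

text \<open>Independence is stated for indexed families so that images under a map or a choice
  function can be treated before their injectivity is known; \<open>cfree_imp_cind\<close> then
  supplies it.\<close>

definition cfree :: "'i set \<Rightarrow> ('i \<Rightarrow> 'a) \<Rightarrow> bool" where
  "cfree I v \<longleftrightarrow> finite I \<and>
    (\<forall>c. (\<forall>i\<in>I. c i \<in> C) \<and> (\<Sum>i\<in>I. c i (v i)) = 0 \<longrightarrow> (\<forall>i\<in>I. c i = (\<lambda>_. 0)))"

lemma cfreeD: "cfree I v \<Longrightarrow> (\<And>i. i \<in> I \<Longrightarrow> c i \<in> C) \<Longrightarrow> (\<Sum>i\<in>I. c i (v i)) = 0 \<Longrightarrow> i \<in> I \<Longrightarrow> c i = (\<lambda>_. 0)"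
  unfolding cfree_def by blast

lemma cfree_finite: "cfree I v \<Longrightarrow> finite I" by (simp add: cfree_def)

definition cspan :: "'a set \<Rightarrow> 'a set" where
  "cspan T = {x. \<exists>c. (\<forall>t\<in>T. c t \<in> C) \<and> x = (\<Sum>t\<in>T. c t t)}"

definition cmod :: "'a set \<Rightarrow> bool" where
  "cmod N \<longleftrightarrow> 0 \<in> N \<and> (\<forall>x\<in>N. \<forall>y\<in>N. x + y \<in> N) \<and> (\<forall>c\<in>C. \<forall>x\<in>N. c x \<in> N)"

lemma cmod_0: "cmod N \<Longrightarrow> 0 \<in> N" and cmod_add: "cmod N \<Longrightarrow> x \<in> N \<Longrightarrow> y \<in> N \<Longrightarrow> x + y \<in> N"
  and cmod_C: "cmod N \<Longrightarrow> c \<in> C \<Longrightarrow> x \<in> N \<Longrightarrow> c x \<in> N"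
  by (auto simp: cmod_def)
lemma cmod_neg: "cmod N \<Longrightarrow> x \<in> N \<Longrightarrow> - x \<in> N" using cmod_C[OF _ C_neg[OF C_one]] by simp
lemma cmod_diff: "cmod N \<Longrightarrow> x \<in> N \<Longrightarrow> y \<in> N \<Longrightarrow> x - y \<in> N"
  using cmod_add[of N x "- y"] cmod_neg[of N y] by simp
lemma cmod_sum: "cmod N \<Longrightarrow> (\<And>i. i \<in> A \<Longrightarrow> f i \<in> N) \<Longrightarrow> sum f A \<in> N"
  by (induction A rule: infinite_finite_induct) (auto intro: cmod_0 cmod_add)

lemma cmod_csum:
  assumes "cmod N" "\<And>i. i \<in> A \<Longrightarrow> c i \<in> C" "\<And>i. i \<in> A \<Longrightarrow> v i \<in> N"
  shows "(\<Sum>i\<in>A. c i (v i)) \<in> N"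
  by (rule cmod_sum[OF assms(1)]) (rule cmod_C[OF assms(1)], simp_all add: assms)

lemma cmod_cspan: "cmod (cspan T)"
  unfolding cmod_def
proof (intro conjI ballI)
  show "0 \<in> cspan T" unfolding cspan_def by (intro CollectI exI[of _ "\<lambda>_ _. 0"]) (simp add: C_zero)
  fix x y assume "x \<in> cspan T" "y \<in> cspan T"
  then obtain c d where "\<forall>t\<in>T. c t \<in> C" "x = (\<Sum>t\<in>T. c t t)" "\<forall>t\<in>T. d t \<in> C" "y = (\<Sum>t\<in>T. d t t)"
    by (auto simp: cspan_def)
  then show "x + y \<in> cspan T" unfolding cspan_def
    by (intro CollectI exI[of _ "\<lambda>t x. c t x + d t x"]) (auto simp: sum.distrib C_plus)
next
  fix c x assume c: "c \<in> C" and "x \<in> cspan T"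
  then obtain d where "\<forall>t\<in>T. d t \<in> C" "x = (\<Sum>t\<in>T. d t t)" by (auto simp: cspan_def)
  then show "c x \<in> cspan T" unfolding cspan_def using c
    by (intro CollectI exI[of _ "\<lambda>t x. c (d t x)"]) (auto simp: C_sum C_comp)
qed

lemma cspan_base: "finite T \<Longrightarrow> t \<in> T \<Longrightarrow> t \<in> cspan T"
  unfolding cspan_def
  by (intro CollectI exI[of _ "\<lambda>s. if s = t then (\<lambda>x. x) else (\<lambda>_. 0)"])
    (auto simp: C_one C_zero if_distrib[of "\<lambda>f. f _"] sum.delta cong: if_cong)

lemma cspan_least: "cmod N \<Longrightarrow> T \<subseteq> N \<Longrightarrow> cspan T \<subseteq> N"
  unfolding cspan_def using cmod_csum[of N T _ "\<lambda>x. x"] by auto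

text \<open>Fraction-free elimination: if some \<open>v p\<close> has a nonzero coefficient at the
  generator \<open>t\<close>, cross-multiplying with it removes \<open>t\<close> from all other
  vectors, and commutativity makes the two contributions of \<open>t\<close> cancel. The new family
  stays independent because the ring is a domain.\<close>

lemma steinitz:
  fixes v :: "'i \<Rightarrow> 'a"
  assumes "finite T" "cfree I v" "\<And>i. i \<in> I \<Longrightarrow> v i \<in> cspan T"
  shows "card I \<le> card T"
  using assms
proof (induction T arbitrary: I v rule: finite_induct)
  case empty
  have v0: "v i = 0" if "i \<in> I" for i using empty(2)[OF that] by (simp add: cspan_def)
  have "I = {}"
  proof (rule equals0I)
    fix i assume "i \<in> I"
    then have "(\<lambda>x::'a. x) = (\<lambda>_. 0)"
      using cfreeD[OF empty(1), of "\<lambda>_ x. x" i] v0 C_one by simp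
    then show False using one_nonzero by simp
  qed
  then show ?case by simp
next
  case (insert t T)
  have "\<exists>a w. a \<in> C \<and> w \<in> cspan T \<and> v i = a t + w" if i: "i \<in> I" for i
  proof -
    obtain c where c: "\<forall>t\<in>insert t T. c t \<in> C" "v i = (\<Sum>t\<in>insert t T. c t t)"
      using insert.prems(2)[OF i] by (auto simp: cspan_def)
    then show ?thesis using insert.hyps
      by (intro exI[of _ "c t"] exI[of _ "\<Sum>t\<in>T. c t t"]) (auto simp: cspan_def)
  qed
  then obtain a w where aw: "\<And>i. i \<in> I \<Longrightarrow> a i \<in> C \<and> w i \<in> cspan T \<and> v i = a i t + w i" by metis
  have finI: "finite I" using insert.prems by (simp add: cfree_def)
  show ?case
  proof (cases "\<exists>p\<in>I. a p \<noteq> (\<lambda>_. 0)")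
    case False
    then have "v i \<in> cspan T" if "i \<in> I" for i using aw[OF that] that by simp
    then have "card I \<le> card T" using insert.IH[OF insert.prems(1)] by simp
    then show ?thesis using insert.hyps by simp
  next
    case True
    then obtain p where p: "p \<in> I" "a p \<noteq> (\<lambda>_. 0)" by auto
    define v' where "v' i = a p (v i) - a i (v p)" for i
    have "cfree (I - {p}) v'"
      unfolding cfree_def
    proof (intro conjI allI impI)
      show "finite (I - {p})" using finI by simp
      fix c assume c: "(\<forall>i\<in>I - {p}. c i \<in> C) \<and> (\<Sum>i\<in>I - {p}. c i (v' i)) = 0"
      \<comment> \<open>A relation among the eliminated vectors, expanded in the original ones;
        everything subtracted along \<open>v p\<close> is gathered in the coefficient at
        \<open>p\<close>.\<close>
      define d where "d i = (if i = p then (\<lambda>x. - (\<Sum>j\<in>I - {p}. c j (a j x))) else (\<lambda>x. c i (a p x)))" for i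
      have dC: "\<forall>i\<in>I. d i \<in> C"
      proof
        fix i assume i: "i \<in> I"
        show "d i \<in> C"
        proof (cases "i = p")
          case True
          have "(\<lambda>x. \<Sum>j\<in>I - {p}. c j (a j x)) \<in> C" by (rule C_sum_mem) (use C_comp c aw in simp)
          then show ?thesis using True C_neg by (simp add: d_def)
        next
          case False then show ?thesis using C_comp[of "c i" "a p"] c aw p i by (simp add: d_def)
        qed
      qed
      have "(\<Sum>i\<in>I. d i (v i)) = d p (v p) + (\<Sum>i\<in>I - {p}. d i (v i))" using finI p by (simp add: sum.remove)
      also have "\<dots> = (\<Sum>i\<in>I - {p}. c i (a p (v i)) - c i (a i (v p)))"
        by (simp add: d_def sum_subtractf)
      also have "\<dots> = (\<Sum>i\<in>I - {p}. c i (v' i))"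
        by (rule sum.cong) (use c in \<open>auto simp: v'_def C_diff\<close>)
      finally have "(\<Sum>i\<in>I. d i (v i)) = 0" using c by simp
      then have "\<forall>i\<in>I. d i = (\<lambda>_. 0)" using cfreeD[OF insert.prems(1), of d] dC by blast
      note d0 = this
      show "\<forall>i\<in>I - {p}. c i = (\<lambda>_. 0)"
      proof
        fix i assume i: "i \<in> I - {p}"
        then have "(\<lambda>x. c i (a p x)) = (\<lambda>_. 0)" using bspec[OF d0, of i] by (simp add: d_def)
        then show "c i = (\<lambda>_. 0)" using C_domain[of "c i" "a p"] c i aw[OF p(1)] p(2) by blast
      qed
    qed
    moreover have "v' i \<in> cspan T" if "i \<in> I - {p}" for i
    proof -
      have i: "i \<in> I" using that by simp
      have "v' i = a p (w i) - a i (w p)"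
        using aw[OF i] aw[OF p(1)] C_comm[of "a p" "a i" t] by (simp add: v'_def C_add)
      then show ?thesis using aw[OF i] aw[OF p(1)] cmod_cspan by (simp add: cmod_diff cmod_C)
    qed
    ultimately have "card (I - {p}) \<le> card T" by (rule insert.IH)
    then show ?thesis using insert.hyps finI p by simp
  qed
qed

abbreviation cind :: "'a set \<Rightarrow> bool" where "cind B \<equiv> cfree B (\<lambda>x. x)"

lemma cbasis_iff: "cbasis C M B \<longleftrightarrow> cind B \<and> M = cspan B"
  by (auto simp: cbasis_def cfree_def cspan_def)

text \<open>Any two bases have the same cardinality by exchange in both directions, so the choice
  inside \<open>crank\<close> is harmless.\<close>

lemma crank_eq:
  assumes "cbasis C M B"
  shows "crank C M = card B"
proof -
  have "cbasis C M (SOME B. cbasis C M B)" using assms by (rule someI)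
  moreover have "card A \<le> card A'" if "cbasis C M A" "cbasis C M A'" for A A'
    using that steinitz[of A' A "\<lambda>x. x"] cspan_base cfree_finite unfolding cbasis_iff by metis
  ultimately have "card (SOME B. cbasis C M B) = card B" using assms by (meson antisym)
  then show ?thesis by (simp add: crank_def)
qed

lemma cind_card_le_crank:
  assumes "cbasis C M B" "cind A" "A \<subseteq> M"
  shows "card A \<le> crank C M"
proof -
  have "finite B" "M = cspan B" using assms(1) by (auto simp: cbasis_iff cfree_def)
  then show ?thesis using steinitz[of B A "\<lambda>x. x"] assms crank_eq[OF assms(1)] by auto
qed

lemma cfree_imp_cind:
  assumes "cfree I v"
  shows "inj_on v I" "cind (v ` I)"
proof -
  have fin: "finite I" using assms by (simp add: cfree_def)
  show inj: "inj_on v I"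
  proof (rule inj_onI, rule ccontr)
    fix i j assume ij: "i \<in> I" "j \<in> I" "v i = v j" "i \<noteq> j"
    define c :: "_ \<Rightarrow> 'a \<Rightarrow> 'a" where
      "c k = (if k = i then (\<lambda>x. x) else if k = j then (\<lambda>x. - x) else (\<lambda>_. 0))" for k
    have "(\<Sum>k\<in>I. c k (v k)) = (\<Sum>k\<in>{i, j}. c k (v k))"
      by (rule sum.mono_neutral_right) (use fin ij in \<open>auto simp: c_def\<close>)
    then have "(\<Sum>k\<in>I. c k (v k)) = 0" using ij by (simp add: c_def)
    moreover have "\<forall>k\<in>I. c k \<in> C" using C_one C_neg[OF C_one] C_zero by (auto simp: c_def)
    ultimately have "c i = (\<lambda>_. 0)" using assms ij(1) unfolding cfree_def by blast
    then show False using one_nonzero by (simp add: c_def)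
  qed
  show "cind (v ` I)"
    unfolding cfree_def
  proof (intro conjI allI impI)
    fix c assume c: "(\<forall>i\<in>v ` I. c i \<in> C) \<and> (\<Sum>i\<in>v ` I. c i i) = 0"
    then have "(\<Sum>i\<in>I. (c (v i)) (v i)) = 0" by (simp add: sum.reindex[OF inj])
    then have "c (v i) = (\<lambda>_. 0)" if "i \<in> I" for i
      using cfreeD[OF assms, of "\<lambda>i. c (v i)"] c that by blast
    then show "\<forall>i\<in>v ` I. c i = (\<lambda>_. 0)" by auto
  qed (use fin in simp)
qed

lemma cind_subset:
  assumes B: "cind B" and A: "A \<subseteq> B"
  shows "cind A"
  unfolding cfree_def
proof (intro conjI allI impI)
  fix c assume c: "(\<forall>i\<in>A. c i \<in> C) \<and> (\<Sum>i\<in>A. c i i) = 0"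
  define d where "d i = (if i \<in> A then c i else (\<lambda>_. 0))" for i
  have "(\<Sum>i\<in>B. d i i) = (\<Sum>i\<in>A. c i i)"
    by (rule sum.mono_neutral_cong_right[OF cfree_finite[OF B] A]) (simp_all add: d_def)
  moreover have "\<forall>i\<in>B. d i \<in> C" using c C_zero by (auto simp: d_def)
  ultimately have "d i = (\<lambda>_. 0)" if "i \<in> B" for i using cfreeD[OF B, of d i] c that by simp
  then show "\<forall>i\<in>A. c i = (\<lambda>_. 0)" using A unfolding d_def by (metis subsetD)
qed (use finite_subset[OF A cfree_finite[OF B]] in simp)

lemma cind_union:
  assumes A: "cind A" "A \<subseteq> M" "cmod M" and B: "cind B" "B \<subseteq> N" "cmod N" and MN: "M \<inter> N \<subseteq> {0}"
  shows "cind (A \<union> B) \<and> A \<inter> B = {}"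
proof -
  have fin: "finite A" "finite B" using A(1) B(1) by (simp_all add: cfree_finite)
  have n0: "0 \<notin> A"
  proof
    assume "0 \<in> A"
    then have "cind {0}" using cind_subset[OF A(1)] by simp
    then have "(\<lambda>x::'a. x) = (\<lambda>_. 0)" using cfreeD[of "{0}" "\<lambda>x. x" "\<lambda>_ x. x" 0] C_one by simp
    then show False using one_nonzero by simp
  qed
  then have disj: "A \<inter> B = {}" using A(2) B(2) MN by blast
  have "cind (A \<union> B)"
    unfolding cfree_def
  proof (intro conjI allI impI)
    fix c assume c: "(\<forall>i\<in>A \<union> B. c i \<in> C) \<and> (\<Sum>i\<in>A \<union> B. c i i) = 0"
    then have s: "(\<Sum>i\<in>A. c i i) + (\<Sum>i\<in>B. c i i) = 0" using sum.union_disjoint[OF fin disj, of "\<lambda>i. c i i"] by simp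
    have m: "(\<Sum>i\<in>A. c i i) \<in> M" "(\<Sum>i\<in>B. c i i) \<in> N"
      using c A(2) B(2) cmod_csum[OF A(3), of A c "\<lambda>x. x"] cmod_csum[OF B(3), of B c "\<lambda>x. x"] by auto
    have "(\<Sum>i\<in>A. c i i) = - (\<Sum>i\<in>B. c i i)" using s by (simp add: eq_neg_iff_add_eq_0)
    then have a0: "(\<Sum>i\<in>A. c i i) = 0" using m cmod_neg[OF B(3) m(2)] MN by auto
    have b0: "(\<Sum>i\<in>B. c i i) = 0" using s unfolding a0 by simp
    have "c i = (\<lambda>_. 0)" if "i \<in> A" for i using cfreeD[OF A(1), of c i] a0 c that by blast
    moreover have "c i = (\<lambda>_. 0)" if "i \<in> B" for i using cfreeD[OF B(1), of c i] b0 c that by blast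
    ultimately show "\<forall>i\<in>A \<union> B. c i = (\<lambda>_. 0)" by blast
  qed (use fin in simp)
  then show ?thesis using disj by simp
qed

lemma cfree_map:
  assumes B: "cind B" "B \<subseteq> M" "cmod M"
    and T: "\<And>x y. x \<in> M \<Longrightarrow> y \<in> M \<Longrightarrow> T (x + y) = T x + T y" "\<And>c x. c \<in> C \<Longrightarrow> x \<in> M \<Longrightarrow> T (c x) = c (T x)"
      "\<And>x. x \<in> M \<Longrightarrow> T x = 0 \<Longrightarrow> x = 0"
  shows "cfree B T"
  unfolding cfree_def
proof (intro conjI allI impI)
  show fin: "finite B" using B by (simp add: cfree_def)
  fix c assume c: "(\<forall>i\<in>B. c i \<in> C) \<and> (\<Sum>i\<in>B. c i (T i)) = 0"
  have T0: "T 0 = 0" using T(1)[of 0 0] B(3) by (simp add: cmod_0)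
  have "T (\<Sum>i\<in>B'. c i i) = (\<Sum>i\<in>B'. T (c i i))" if "B' \<subseteq> B" for B'
    using finite_subset[OF that fin] that
  proof (induction B' rule: finite_induct)
    case (insert b B')
    have "(\<Sum>i\<in>B'. c i i) \<in> M" using insert.prems B(2) c cmod_csum[OF B(3), of B' c "\<lambda>x. x"] by auto
    moreover have "c b b \<in> M" using insert.prems B(2) c cmod_C[OF B(3), of "c b" b] by auto
    ultimately show ?case using insert.hyps insert.IH insert.prems T(1) by simp
  qed (simp add: T0)
  then have "T (\<Sum>i\<in>B. c i i) = (\<Sum>i\<in>B. c i (T i))" using T(2) c B(2) by (simp add: subset_iff)
  moreover have "(\<Sum>i\<in>B. c i i) \<in> M" using B(2) c cmod_csum[OF B(3), of B c "\<lambda>x. x"] by auto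
  ultimately have "(\<Sum>i\<in>B. c i i) = 0" using T(3) c by simp
  then show "\<forall>i\<in>B. c i = (\<lambda>_. 0)" using cfreeD[OF B(1), of c] c by blast
qed

lemma direct_sum_basis:
  assumes "finite I" "\<And>i. i \<in> I \<Longrightarrow> cbasis C (P i) (b i)"
    and "\<And>m. (\<And>i. i \<in> I \<Longrightarrow> m i \<in> P i) \<Longrightarrow> sum m I = 0 \<Longrightarrow> (\<And>i. i \<in> I \<Longrightarrow> m i = 0)"
  shows "cbasis C {x. \<exists>m. (\<forall>i\<in>I. m i \<in> P i) \<and> x = sum m I} (\<Union>i\<in>I. b i) \<and>
    card (\<Union>i\<in>I. b i) = (\<Sum>i\<in>I. card (b i))"
  using assms
proof (induction I rule: finite_induct)
  case empty
  have "cspan {} = {0}" by (auto simp: cspan_def)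
  then show ?case by (auto simp: cbasis_iff cfree_def)
next
  case (insert j I)
  have cm: "cmod (P i)" if "i \<in> insert j I" for i using insert.prems(1)[OF that] cmod_cspan by (simp add: cbasis_iff)
  have dirI: "m i = 0" if "\<And>i. i \<in> I \<Longrightarrow> m i \<in> P i" "sum m I = 0" "i \<in> I" for m i
  proof -
    define m' where "m' i = (if i = j then 0 else m i)" for i
    have "m' k \<in> P k" if "k \<in> insert j I" for k
      using that \<open>\<And>i. i \<in> I \<Longrightarrow> m i \<in> P i\<close> cm cmod_0 by (auto simp: m'_def)
    moreover have "sum m' I = sum m I" by (rule sum.cong) (use insert.hyps in \<open>auto simp: m'_def\<close>)
    then have "sum m' (insert j I) = 0" using insert.hyps that(2) by (simp add: m'_def)
    ultimately have "m' i = 0" using insert.prems(2)[of m' i] that(3) by blast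
    then show ?thesis using that(3) insert.hyps by (auto simp: m'_def split: if_splits)
  qed
  define M where "M = {x. \<exists>m. (\<forall>i\<in>I. m i \<in> P i) \<and> x = sum m I}"
  have "cbasis C M (\<Union>i\<in>I. b i) \<and> card (\<Union>i\<in>I. b i) = (\<Sum>i\<in>I. card (b i))"
    unfolding M_def
  proof (rule insert.IH)
    fix m i assume "\<And>i. i \<in> I \<Longrightarrow> m i \<in> P i" "sum m I = 0" "i \<in> I"
    then show "m i = 0" by (rule dirI)
  qed (use insert.prems(1) in blast)
  then have IH: "cbasis C M (\<Union>i\<in>I. b i)" "card (\<Union>i\<in>I. b i) = (\<Sum>i\<in>I. card (b i))" by auto
  have mM: "cmod M" using IH(1) cmod_cspan by (simp add: cbasis_iff)
  have bj: "cbasis C (P j) (b j)" using insert.prems(1) by simp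
  have fin: "finite (b j)" "finite (\<Union>i\<in>I. b i)" using bj IH(1) cfree_finite by (auto simp: cbasis_iff)
  have sub: "b j \<subseteq> P j" "(\<Union>i\<in>I. b i) \<subseteq> M"
    using bj IH(1) cspan_base[OF fin(1)] cspan_base[OF fin(2)] by (auto simp: cbasis_iff)
  have int: "P j \<inter> M \<subseteq> {0}"
  proof
    fix x assume x: "x \<in> P j \<inter> M"
    then obtain m where m: "\<forall>i\<in>I. m i \<in> P i" "x = sum m I" by (auto simp: M_def)
    define m' where "m' i = (if i = j then - x else m i)" for i
    have "m' k \<in> P k" if "k \<in> insert j I" for k
      using that m x cmod_neg[OF cm, of j x] by (auto simp: m'_def)
    moreover have "sum m' I = sum m I" by (rule sum.cong) (use insert.hyps in \<open>auto simp: m'_def\<close>)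
    then have "sum m' (insert j I) = 0" using insert.hyps m(2) by (simp add: m'_def)
    ultimately have "m' j = 0" using insert.prems(2)[of m' j] by blast
    then show "x \<in> {0}" by (simp add: m'_def)
  qed
  have u: "cind (b j \<union> (\<Union>i\<in>I. b i)) \<and> b j \<inter> (\<Union>i\<in>I. b i) = {}"
    by (rule cind_union[OF _ sub(1) cm _ sub(2) mM int]) (use bj IH(1) in \<open>auto simp: cbasis_iff\<close>)
  have "{x. \<exists>m. (\<forall>i\<in>insert j I. m i \<in> P i) \<and> x = sum m (insert j I)} = cspan (b j \<union> (\<Union>i\<in>I. b i))"
    (is "?L = ?R")
  proof
    have finu: "finite (b j \<union> (\<Union>i\<in>I. b i))" using fin by simp
    have "b j \<union> (\<Union>i\<in>I. b i) \<subseteq> ?R" using cspan_base[OF finu] by blast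
    then have "cspan (b j) \<subseteq> ?R" "cspan (\<Union>i\<in>I. b i) \<subseteq> ?R" by (intro cspan_least[OF cmod_cspan]; blast)+
    then have "P j \<subseteq> ?R" "M \<subseteq> ?R" using bj IH(1) by (auto simp: cbasis_iff)
    note PM = this
    show "?L \<subseteq> ?R"
    proof
      fix x assume "x \<in> ?L"
      then obtain m where m: "\<forall>i\<in>insert j I. m i \<in> P i" "x = sum m (insert j I)" by blast
      have "sum m I \<in> M" unfolding M_def using m(1) by blast
      then show "x \<in> ?R" using m insert.hyps PM cmod_add[OF cmod_cspan, of "m j" _ "sum m I"] by auto
    qed
  next
    show "?R \<subseteq> ?L"
    proof
      fix x assume "x \<in> ?R"
      then obtain c where c: "\<forall>i\<in>b j \<union> (\<Union>i\<in>I. b i). c i \<in> C" "x = (\<Sum>i\<in>b j \<union> (\<Union>i\<in>I. b i). c i i)"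
        by (auto simp: cspan_def)
      have "x = (\<Sum>i\<in>b j. c i i) + (\<Sum>i\<in>(\<Union>i\<in>I. b i). c i i)"
        unfolding c(2) using fin u by (intro sum.union_disjoint) auto
      moreover have "(\<Sum>i\<in>b j. c i i) \<in> P j" using c(1) sub(1) cmod_csum[OF cm, of j "b j" c "\<lambda>x. x"] by auto
      moreover have "(\<Sum>i\<in>(\<Union>i\<in>I. b i). c i i) \<in> M" using c(1) sub(2) cmod_csum[OF mM, of "\<Union>i\<in>I. b i" c "\<lambda>x. x"] by auto
      ultimately obtain a m where am: "x = a + sum m I" "a \<in> P j" "\<forall>i\<in>I. m i \<in> P i" by (auto simp: M_def)
      have "sum m I = (\<Sum>i\<in>I. if i = j then a else m i)" by (rule sum.cong) (use insert.hyps in auto)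
      then show "x \<in> ?L" using am insert.hyps by (intro CollectI exI[of _ "\<lambda>i. if i = j then a else m i"]) auto
    qed
  qed
  moreover have "card (b j \<union> (\<Union>i\<in>I. b i)) = card (b j) + (\<Sum>i\<in>I. card (b i))"
    using card_Un_disjoint[OF fin] u IH(2) by simp
  ultimately show ?case using u insert.hyps by (simp add: cbasis_iff)
qed

end

section \<open>Graded Lie algebras\<close>

lemma exists_arg_max:
  fixes \<sigma> :: "'c \<Rightarrow> real"
  assumes "finite A" "A \<noteq> {}" "inj_on \<sigma> A"
  obtains p where "p \<in> A" "\<And>q. q \<in> A \<Longrightarrow> q \<noteq> p \<Longrightarrow> \<sigma> q < \<sigma> p"
proof -
  obtain p where p: "p \<in> A" "\<sigma> p = Max (\<sigma> ` A)" using Max_in[of "\<sigma> ` A"] assms by fastforce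
  have "\<sigma> q < \<sigma> p" if "q \<in> A" "q \<noteq> p" for q
    using Max_ge[of "\<sigma> ` A" "\<sigma> q"] p assms that inj_onD[OF assms(3), of q p] by (force simp: less_le)
  then show thesis using that p by blast
qed

text \<open>The degree type may be larger than the grading group, hence the carrier
  \<open>S\<close>. The additive real function \<rho>, injective on \<open>S\<close>, orders the
  degrees compatibly with addition; leading terms refer to this order.\<close>

locale graded_lie = vector_space sc
  for sc :: "'k::field \<Rightarrow> 'a::ab_group_add \<Rightarrow> 'a" +
  fixes br :: "'a \<Rightarrow> 'a \<Rightarrow> 'a" and g :: "'p::ab_group_add \<Rightarrow> 'a set"
    and S :: "'p set" and \<rho> :: "'p \<Rightarrow> real"
  assumes lie: "lie_algebra sc br"
    and g_sub: "ksubspace sc (g p)"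
    and g_out: "p \<notin> S \<Longrightarrow> g p = {0}"
    and S_diff: "p \<in> S \<Longrightarrow> q \<in> S \<Longrightarrow> p - q \<in> S"
    and \<rho>_add: "\<rho> (p + q) = \<rho> p + \<rho> q" and \<rho>_inj: "inj_on \<rho> S"
    and dec: "\<exists>!c. finite {p. c p \<noteq> 0} \<and> (\<forall>p. c p \<in> g p) \<and> x = sum c {p. c p \<noteq> 0}"
    and g_br: "x \<in> g p \<Longrightarrow> y \<in> g q \<Longrightarrow> br x y \<in> g (p + q)"
    and cless: "centreless br"
begin

lemma br_addl: "br (x + y) z = br x z + br y z" and br_addr: "br x (y + z) = br x y + br x z"
  and br_scl: "br (sc a x) y = sc a (br x y)" and br_scr: "br x (sc a y) = sc a (br x y)"
  and br_self: "br x x = 0" and jacobi: "br x (br y z) + br y (br z x) + br z (br x y) = 0"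
  using lie by (auto simp: lie_algebra_def)

lemma br_0l [simp]: "br 0 y = 0" using br_addl[of 0 0 y] by simp
lemma br_0r [simp]: "br y 0 = 0" using br_addr[of y 0 0] by simp
lemma br_anti: "br y x = - br x y"
proof -
  have "br x y + br y x = br (x + y) (x + y)" unfolding br_addl br_addr by (simp add: br_self)
  then have "br x y + br y x = 0" by (simp only: br_self)
  then show ?thesis by (simp add: eq_neg_iff_add_eq_0 add.commute)
qed
lemma br_negr: "br x (- y) = - br x y"
  using br_addr[of x y "- y"] by (simp add: eq_neg_iff_add_eq_0 add.commute)
lemma br_negl: "br (- x) y = - br x y"
  using br_addl[of x "- x" y] by (simp add: eq_neg_iff_add_eq_0 add.commute)
lemma br_diffr: "br x (y - z) = br x y - br x z" using br_addr[of x y "- z"] by (simp add: br_negr)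
lemma br_diffl: "br (x - y) z = br x z - br y z" using br_addl[of x "- y" z] by (simp add: br_negl)
lemma br_suml: "br (sum f A) y = (\<Sum>i\<in>A. br (f i) y)"
  by (induction A rule: infinite_finite_induct) (auto simp: br_addl)
lemma br_sumr: "br y (sum f A) = (\<Sum>i\<in>A. br y (f i))"
  by (induction A rule: infinite_finite_induct) (auto simp: br_addr)
lemma br_br: "br (br x y) z = br x (br y z) - br y (br x z)"
proof -
  have "br x (br y z) - br y (br x z) - br (br x y) z = 0"
    using jacobi[of x y z] unfolding br_anti[of z "br x y"] br_anti[of z x] br_negr by simp
  then show ?thesis by simp
qed

lemma g_0: "0 \<in> g p" and g_add: "x \<in> g p \<Longrightarrow> y \<in> g p \<Longrightarrow> x + y \<in> g p" and g_sc: "x \<in> g p \<Longrightarrow> sc a x \<in> g p"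
  using g_sub[of p] by (auto simp: ksubspace_def)
lemma g_neg: "x \<in> g p \<Longrightarrow> - x \<in> g p" using g_sc[of x p "-1"] by simp
lemma g_S: "x \<in> g p \<Longrightarrow> x \<noteq> 0 \<Longrightarrow> p \<in> S" using g_out by blast
lemma \<rho>_0: "\<rho> 0 = 0" using \<rho>_add[of 0 0] by simp
lemma \<rho>_diff: "\<rho> (p - q) = \<rho> p - \<rho> q" using \<rho>_add[of "p - q" q] by simp

definition co :: "'a \<Rightarrow> 'p \<Rightarrow> 'a" where
  "co x = (THE c. finite {p. c p \<noteq> 0} \<and> (\<forall>p. c p \<in> g p) \<and> x = sum c {p. c p \<noteq> 0})"

lemma co_props: "finite {p. co x p \<noteq> 0} \<and> (\<forall>p. co x p \<in> g p) \<and> x = sum (co x) {p. co x p \<noteq> 0}"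
  unfolding co_def by (rule theI'[OF dec])

lemma co_fin: "finite {p. co x p \<noteq> 0}" and co_in: "co x p \<in> g p" and co_total: "x = sum (co x) {p. co x p \<noteq> 0}"
  using co_props by auto

lemma co_total_super: "finite P \<Longrightarrow> {p. co x p \<noteq> 0} \<subseteq> P \<Longrightarrow> x = (\<Sum>p\<in>P. co x p)"
  by (subst co_total[of x], rule sum.mono_neutral_left) auto

lemma co_unique:
  assumes "finite P" "\<And>p. c p \<in> g p" "\<And>p. p \<notin> P \<Longrightarrow> c p = 0" "x = sum c P"
  shows "co x = c"
proof -
  have s: "{p. c p \<noteq> 0} \<subseteq> P" using assms(3) by auto
  then have "sum c P = sum c {p. c p \<noteq> 0}" by (intro sum.mono_neutral_right) (use assms in auto)
  then have "finite {p. c p \<noteq> 0} \<and> (\<forall>p. c p \<in> g p) \<and> x = sum c {p. c p \<noteq> 0}"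
    using assms s finite_subset by auto
  then show ?thesis unfolding co_def by (rule the1_equality[OF dec])
qed

lemma co_add: "co (x + y) p = co x p + co y p"
proof -
  let ?P = "{p. co x p \<noteq> 0} \<union> {p. co y p \<noteq> 0}"
  have "co (x + y) = (\<lambda>p. co x p + co y p)"
  proof (rule co_unique[of ?P])
    have "x = (\<Sum>p\<in>?P. co x p)" by (rule co_total_super) (use co_fin in auto)
    moreover have "y = (\<Sum>p\<in>?P. co y p)" by (rule co_total_super) (use co_fin in auto)
    ultimately
    show "x + y = (\<Sum>p\<in>?P. co x p + co y p)" unfolding sum.distrib by (rule arg_cong2)
  next
    show "finite ?P" using co_fin by simp
    show "co x p + co y p \<in> g p" for p by (rule g_add[OF co_in co_in])
  qed auto
  then show ?thesis by simp
qed

lemma co_hom: "x \<in> g p \<Longrightarrow> co x q = (if q = p then x else 0)"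
proof -
  assume "x \<in> g p"
  then have "co x = (\<lambda>q. if q = p then x else 0)" by (intro co_unique[of "{p}"]) (auto intro: g_0)
  then show ?thesis by simp
qed

lemma co_0 [simp]: "co 0 p = 0" using co_add[of 0 0 p] by simp
lemma co_setsum: "co (sum f A) p = (\<Sum>i\<in>A. co (f i) p)"
  by (induction A rule: infinite_finite_induct) (auto simp: co_add)
lemma co_ext: "(\<And>p. co x p = co y p) \<Longrightarrow> x = y"
  using co_total[of x] co_total[of y] by (metis ext)
lemma co_nonzero: "x \<noteq> 0 \<Longrightarrow> \<exists>p. co x p \<noteq> 0" using co_ext[of x 0] by auto
lemma co_only: "(\<And>q. q \<noteq> p \<Longrightarrow> co x q = 0) \<Longrightarrow> x \<in> g p"
proof -
  assume a: "\<And>q. q \<noteq> p \<Longrightarrow> co x q = 0"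
  have "x = (\<Sum>q\<in>{p}. co x q)" by (rule co_total_super) (use a in auto)
  then show ?thesis using co_in[of x p] by simp
qed

lemma hom_induct:
  assumes "\<And>p x. x \<in> g p \<Longrightarrow> P x" "\<And>x y. P x \<Longrightarrow> P y \<Longrightarrow> P (x + y)"
  shows "P x"
proof -
  have "P (sum (co x) A)" for A
    by (induction A rule: infinite_finite_induct) (simp_all add: assms(1)[OF g_0] assms(2) assms(1)[OF co_in])
  then show ?thesis using co_total[of x] by metis
qed

lemma co_shift:
  assumes T: "\<And>x y. T (x + y) = T x + T y" "\<And>q y. y \<in> g q \<Longrightarrow> T y \<in> g (q + p)"
  shows "co (T y) r = T (co y (r - p))"
proof (induction y rule: hom_induct)
  case (1 q x)
  have T0: "T 0 = 0" using T(1)[of 0 0] by simp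
  show ?case using co_hom[OF T(2)[OF 1], of r] co_hom[OF 1, of "r - p"] T0 by auto
qed (simp add: T co_add)

lemma co_sc: "co (sc a x) p = sc a (co x p)"
  using co_shift[of "sc a" 0 x p] by (simp add: scale_right_distrib g_sc)

lemma co_br_homl: "x \<in> g p \<Longrightarrow> co (br x y) r = br x (co y (r - p))"
  by (rule co_shift) (auto simp: br_addr add.commute[of _ p] intro: g_br)

lemma co_br_homr: "x \<in> g p \<Longrightarrow> co (br y x) r = br (co y (r - p)) x"
  by (rule co_shift[where T = "\<lambda>y. br y x"]) (auto simp: br_addl intro: g_br)

lemma co_br: "co (br x y) r = (\<Sum>p | co x p \<noteq> 0. br (co x p) (co y (r - p)))"
proof -
  have "co (br x y) r = co (\<Sum>p | co x p \<noteq> 0. br (co x p) y) r"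
    by (subst co_total[of x]) (simp add: br_suml)
  then show ?thesis by (simp add: co_setsum co_br_homl[OF co_in])
qed

section \<open>The centroid and its homogeneous parts\<close>

abbreviation Cc where "Cc \<equiv> centroid sc br"

text \<open>Linearity over one argument of the bracket suffices, by antisymmetry.\<close>

lemma CcI: "(\<And>x y. c (x + y) = c x + c y) \<Longrightarrow> (\<And>a x. c (sc a x) = sc a (c x)) \<Longrightarrow>
  (\<And>x y. c (br x y) = br (c x) y) \<Longrightarrow> c \<in> Cc"
proof -
  assume a: "\<And>x y. c (x + y) = c x + c y" "\<And>a x. c (sc a x) = sc a (c x)" "\<And>x y. c (br x y) = br (c x) y"
  have "c (br x y) = br x (c y)" for x y
  proof -
    have "c (sc (-1) (br y x)) = sc (-1) (br (c y) x)" by (simp only: a)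
    then show ?thesis using br_anti[of x y] br_anti[of x "c y"] by simp
  qed
  then show ?thesis using a by (simp add: centroid_def)
qed

lemma Cc_add: "c \<in> Cc \<Longrightarrow> c (x + y) = c x + c y" and Cc_sc: "c \<in> Cc \<Longrightarrow> c (sc a x) = sc a (c x)"
  and Cc_brl: "c \<in> Cc \<Longrightarrow> c (br x y) = br (c x) y" and Cc_brr: "c \<in> Cc \<Longrightarrow> c (br x y) = br x (c y)"
  unfolding centroid_def by blast+
lemma Cc_0: "c \<in> Cc \<Longrightarrow> c 0 = 0" using Cc_add[of c 0 0] by simp

lemma central_zero: "(\<And>y. br z y = 0) \<Longrightarrow> z = 0"
  using cless unfolding centreless_def by blast

lemma Cc_scale: "sc a \<in> Cc" by (rule CcI) (auto simp: scale_right_distrib br_scl scale_left_commute)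
lemma Cc_plus: "c \<in> Cc \<Longrightarrow> d \<in> Cc \<Longrightarrow> (\<lambda>x. c x + d x) \<in> Cc"
  by (rule CcI) (auto simp: Cc_add Cc_sc Cc_brl br_addl scale_right_distrib algebra_simps)
lemma Cc_comp: "c \<in> Cc \<Longrightarrow> d \<in> Cc \<Longrightarrow> (\<lambda>x. c (d x)) \<in> Cc"
  by (rule CcI) (auto simp: Cc_add Cc_sc Cc_brl)
lemma Cc_neg: "c \<in> Cc \<Longrightarrow> (\<lambda>x. - c x) \<in> Cc"
  using Cc_comp[OF Cc_scale[of "-1"], of c] by simp
lemma Cc_one: "(\<lambda>x. x) \<in> Cc" using Cc_scale[of 1] by (simp add: scale_one[abs_def])
text \<open>Moving \<open>c\<close> and \<open>d\<close> onto different arguments of the bracket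
  shows that \<open>c (d x) - d (c x)\<close> brackets to 0 with everything, and the centre is
  zero.\<close>

lemma Cc_comm: "c \<in> Cc \<Longrightarrow> d \<in> Cc \<Longrightarrow> c (d x) = d (c x)"
proof -
  assume c: "c \<in> Cc" "d \<in> Cc"
  have "br (c (d x) - d (c x)) y = 0" for y
    using Cc_brl[OF c(1), of "d x" y] Cc_brr[OF c(2), of x y] Cc_brl[OF c(1), of x "d y"]
      Cc_brl[OF c(2), of "c x" y] Cc_brr[OF c(2), of "c x" y] Cc_brl[OF c(2), of x y]
    by (simp add: br_diffl)
  then show ?thesis using central_zero[of "c (d x) - d (c x)"] by simp
qed

text \<open>The homogeneous part of \<open>c\<close> of degree \<gamma>: from each component of
  \<open>x\<close>, only the output shifted by exactly \<gamma> is kept. It lies in the centroid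
  again (\<open>hc_Ch\<close>).\<close>

definition hc :: "('a \<Rightarrow> 'a) \<Rightarrow> 'p \<Rightarrow> 'a \<Rightarrow> 'a" where
  "hc c \<gamma> x = (\<Sum>p | co x p \<noteq> 0. co (c (co x p)) (p + \<gamma>))"

definition Ch :: "'p \<Rightarrow> ('a \<Rightarrow> 'a) set" where
  "Ch \<gamma> = {c\<in>Cc. \<forall>p. \<forall>x\<in>g p. c x \<in> g (p + \<gamma>)}"

lemma Ch_Cc: "c \<in> Ch \<gamma> \<Longrightarrow> c \<in> Cc" and Ch_g: "c \<in> Ch \<gamma> \<Longrightarrow> x \<in> g p \<Longrightarrow> c x \<in> g (p + \<gamma>)"
  by (auto simp: Ch_def)

lemma Ch_co: "c \<in> Ch \<gamma> \<Longrightarrow> co (c x) r = c (co x (r - \<gamma>))"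
  by (rule co_shift) (auto simp: Cc_add[OF Ch_Cc] intro: Ch_g)

lemma Ch_comp: "c \<in> Ch \<gamma> \<Longrightarrow> d \<in> Ch \<delta> \<Longrightarrow> (\<lambda>x. c (d x)) \<in> Ch (\<gamma> + \<delta>)"
  unfolding Ch_def by (auto simp: Cc_comp) (metis add.assoc add.commute)

lemma Ch_scale: "sc a \<in> Ch 0" unfolding Ch_def by (auto simp: Cc_scale intro: g_sc)
context
  fixes c assumes c: "c \<in> Cc"
begin

lemma hc_super: "finite P \<Longrightarrow> {p. co x p \<noteq> 0} \<subseteq> P \<Longrightarrow> hc c \<gamma> x = (\<Sum>p\<in>P. co (c (co x p)) (p + \<gamma>))"
  unfolding hc_def by (rule sum.mono_neutral_left) (auto simp: Cc_0[OF c])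

lemma hc_hom: "x \<in> g p \<Longrightarrow> hc c \<gamma> x = co (c x) (p + \<gamma>)"
proof -
  assume x: "x \<in> g p"
  have "{q. co x q \<noteq> 0} \<subseteq> {p}" using co_hom[OF x] by (auto split: if_splits)
  then show ?thesis using hc_super[of "{p}" x \<gamma>] co_hom[OF x, of p] by simp
qed

lemma hc_add: "hc c \<gamma> (x + y) = hc c \<gamma> x + hc c \<gamma> y"
proof -
  let ?P = "{p. co x p \<noteq> 0} \<union> {p. co y p \<noteq> 0}"
  have "hc c \<gamma> z = (\<Sum>p\<in>?P. co (c (co z p)) (p + \<gamma>))" if "z = x \<or> z = y \<or> z = x + y" for z
    by (rule hc_super) (use co_fin that in \<open>auto simp: co_add\<close>)
  then show ?thesis by (simp add: co_add Cc_add[OF c] sum.distrib)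
qed

lemma hc_sc: "hc c \<gamma> (sc a x) = sc a (hc c \<gamma> x)"
proof (induction x rule: hom_induct)
  case (1 p x) then show ?case using hc_hom[OF g_sc[OF 1]] hc_hom[OF 1] by (simp add: Cc_sc[OF c] co_sc)
qed (simp add: hc_add scale_right_distrib)

lemma hc_br: "hc c \<gamma> (br x y) = br (hc c \<gamma> x) y"
proof (induction x rule: hom_induct)
  case (1 p x)
  show ?case
  proof (induction y rule: hom_induct)
    case (1 q y)
    have "hc c \<gamma> (br x y) = co (br (c x) y) (p + q + \<gamma>)"
      using hc_hom[OF g_br[OF \<open>x \<in> g p\<close> 1]] Cc_brl[OF c] by simp
    also have "\<dots> = br (co (c x) (p + q + \<gamma> - q)) y" by (rule co_br_homr[OF 1])
    also have "\<dots> = br (hc c \<gamma> x) y" using hc_hom[OF \<open>x \<in> g p\<close>] by (simp add: algebra_simps)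
    finally show ?case .
  qed (simp add: br_addr hc_add)
qed (simp add: br_addl hc_add)

lemma hc_Ch: "hc c \<gamma> \<in> Ch \<gamma>"
  unfolding Ch_def using hc_hom co_in by (auto intro!: CcI simp: hc_add hc_sc hc_br)

end

end

section \<open>Graded simple algebras: Schur's lemma and torsion\<close>

locale graded_simple_lie = graded_lie sc br g S \<rho>
  for sc :: "'k::field \<Rightarrow> 'a::ab_group_add \<Rightarrow> 'a" and br
    and g :: "'p::ab_group_add \<Rightarrow> 'a set" and S \<rho> +
  assumes simple: "\<lbrakk>0 \<in> I; \<And>x y. x \<in> I \<Longrightarrow> y \<in> I \<Longrightarrow> x + y \<in> I; \<And>a x. x \<in> I \<Longrightarrow> sc a x \<in> I;
      \<And>x y. x \<in> I \<Longrightarrow> br y x \<in> I; \<And>x p. x \<in> I \<Longrightarrow> co x p \<in> I\<rbrakk> \<Longrightarrow> I = {0} \<or> I = UNIV"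
    and one_dim: "\<exists>p e. e \<noteq> 0 \<and> g p = range (\<lambda>a. sc a e)"
    and fgc: "fgc sc br"
begin

text \<open>Graded Schur lemma: the kernel of a homogeneous centroid element is a graded
  ideal.\<close>

lemma Ch_ker:
  assumes "c \<in> Ch \<gamma>" "c \<noteq> (\<lambda>_. 0)" "c x = 0"
  shows "x = 0"
proof -
  note C = Ch_Cc[OF assms(1)]
  have "{x. c x = 0} = {0} \<or> {x. c x = 0} = UNIV"
  proof (rule simple)
    fix x p assume "x \<in> {x. c x = 0}"
    then have "c (co x p) = 0" using Ch_co[OF assms(1), of x "p + \<gamma>"] by simp
    then show "co x p \<in> {x. c x = 0}" by simp
  qed (auto simp: Cc_add[OF C] Cc_0[OF C] Cc_sc[OF C] Cc_brr[OF C])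
  then show ?thesis using assms by blast
qed

text \<open>The range is a graded ideal too, so a nonzero homogeneous element is bijective;
  comparing components shows that its inverse has the opposite degree. These units replace division
  in the centroid.\<close>

lemma Ch_inverse:
  assumes "c \<in> Ch \<gamma>" "c \<noteq> (\<lambda>_. 0)"
  obtains d where "d \<in> Ch (- \<gamma>)" "\<And>x. c (d x) = x" "\<And>x. d (c x) = x"
proof -
  note C = Ch_Cc[OF assms(1)]
  have "range c = {0} \<or> range c = UNIV"
  proof (rule simple)
    show "0 \<in> range c" using Cc_0[OF C] by (metis rangeI)
    fix x assume "x \<in> range c"
    then obtain z where z: "x = c z" by auto
    show "x + y \<in> range c" if yc: "y \<in> range c" for y
    proof -
      obtain w where "y = c w" using yc by auto
      then have "x + y = c (z + w)" using z Cc_add[OF C] by simp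
      then show ?thesis by simp
    qed
    show "sc a x \<in> range c" for a unfolding z Cc_sc[OF C, symmetric] by (rule rangeI)
    show "br y x \<in> range c" for y unfolding z Cc_brr[OF C, symmetric] by (rule rangeI)
    show "co x p \<in> range c" for p unfolding z Ch_co[OF assms(1)] by (rule rangeI)
  qed
  moreover obtain x1 where "c x1 \<noteq> 0" using assms(2) by auto
  ultimately have surj: "surj c" by (metis rangeI singletonD)
  have inj: "inj c"
  proof (rule injI)
    fix x y assume "c x = c y"
    then have "c (x + - y) = 0" unfolding Cc_add[OF C] using Cc_sc[OF C, of "-1" y] by simp
    then have "x + - y = 0" by (rule Ch_ker[OF assms])
    then show "x = y" by simp
  qed
  define d where "d = inv c"
  have cd: "c (d x) = x" for x using surj by (simp add: d_def surj_f_inv_f)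
  have dc: "d (c x) = x" for x using inj by (simp add: d_def)
  have "d \<in> Ch (- \<gamma>)"
    unfolding Ch_def
  proof (intro CollectI conjI allI ballI)
    show "d \<in> Cc"
    proof (rule CcI)
      show "d (x + y) = d x + d y" for x y by (metis Cc_add[OF C] cd dc)
      show "d (sc a x) = sc a (d x)" for a x by (metis Cc_sc[OF C] cd dc)
      show "d (br x y) = br (d x) y" for x y by (metis Cc_brl[OF C] cd dc)
    qed
    fix p x assume x: "x \<in> g p"
    show "d x \<in> g (p + - \<gamma>)"
    proof (rule co_only)
      fix q assume "q \<noteq> p + - \<gamma>"
      then have "co x (q + \<gamma>) = 0" using co_hom[OF x, of "q + \<gamma>"] by (auto simp: algebra_simps)
      then have "c (co (d x) q) = 0" using Ch_co[OF assms(1), of "d x" "q + \<gamma>"] cd by simp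
      then show "co (d x) q = 0" using Ch_ker[OF assms] by blast
    qed
  qed
  then show thesis using that cd dc by blast
qed

definition p0 where "p0 = (SOME p. \<exists>e. e \<noteq> 0 \<and> g p = range (\<lambda>a. sc a e))"
definition e0 where "e0 = (SOME e. e \<noteq> 0 \<and> g p0 = range (\<lambda>a. sc a e))"

lemma e0: "e0 \<noteq> 0" "g p0 = range (\<lambda>a. sc a e0)" "e0 \<in> g p0"
proof -
  have "\<exists>e. e \<noteq> 0 \<and> g p0 = range (\<lambda>a. sc a e)" unfolding p0_def by (rule someI_ex[OF one_dim])
  then have "e0 \<noteq> 0 \<and> g p0 = range (\<lambda>a. sc a e0)" unfolding e0_def by (rule someI_ex)
  then show "e0 \<noteq> 0" and r: "g p0 = range (\<lambda>a. sc a e0)" by auto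
  show "e0 \<in> g p0" unfolding r by (rule image_eqI[of _ _ 1]) simp_all
qed

text \<open>Such an element acts on the line spanned by \<open>e0\<close> by a scalar. Subtracting
  the scalar leaves a homogeneous element with nonzero kernel, which vanishes by Schur.\<close>

lemma Ch_0_scalar: "c \<in> Ch 0 \<Longrightarrow> \<exists>a. c = sc a"
proof -
  assume c: "c \<in> Ch 0"
  then obtain a where a: "c e0 = sc a e0" using Ch_g[OF c e0(3)] e0(2) by auto
  define d where "d x = c x + - sc a x" for x
  have "d x \<in> g p" if "x \<in> g p" for x p
    unfolding d_def by (rule g_add) (use Ch_g[OF c that] that in \<open>auto intro: g_neg g_sc\<close>)
  moreover have "d \<in> Cc" using Cc_plus[OF Ch_Cc[OF c] Cc_neg[OF Cc_scale]] by (simp add: d_def[abs_def])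
  ultimately have "d \<in> Ch 0" by (simp add: Ch_def)
  then have "d = (\<lambda>_. 0)" using Ch_ker[of d 0 e0] a e0(1) by (auto simp: d_def)
  then have "c x = sc a x" for x unfolding d_def by (metis add_eq_0_iff2 minus_minus)
  then show ?thesis by blast
qed

definition G where "G c = {\<gamma>. hc c \<gamma> \<noteq> (\<lambda>_. 0)}"

text \<open>The single vector \<open>e0\<close> sees every degree occurring in \<open>c\<close>,
  because each nonzero homogeneous part is injective. This is what makes \<open>G c\<close>
  finite.\<close>

lemma G_e0: "c \<in> Cc \<Longrightarrow> \<gamma> \<in> G c \<Longrightarrow> co (c e0) (p0 + \<gamma>) \<noteq> 0"
  using Ch_ker[OF hc_Ch, of c \<gamma> e0] e0 hc_hom[of c e0 p0 \<gamma>] by (auto simp: G_def)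

lemma G_fin: "c \<in> Cc \<Longrightarrow> finite (G c)"
proof -
  assume "c \<in> Cc"
  then have "(+) p0 ` G c \<subseteq> {p. co (c e0) p \<noteq> 0}" using G_e0 by auto
  then have "finite ((+) p0 ` G c)" using co_fin finite_subset by blast
  then show ?thesis by (rule finite_imageD) simp
qed

lemma Ch_S: "c \<in> Ch \<gamma> \<Longrightarrow> c \<noteq> (\<lambda>_. 0) \<Longrightarrow> \<gamma> \<in> S"
proof -
  assume c: "c \<in> Ch \<gamma>" "c \<noteq> (\<lambda>_. 0)"
  then have "c e0 \<noteq> 0" using Ch_ker e0(1) by blast
  then have "p0 + \<gamma> \<in> S" using Ch_g[OF c(1) e0(3)] g_S by blast
  then show ?thesis using S_diff[of "p0 + \<gamma>" p0] g_S[OF e0(3) e0(1)] by simp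
qed

lemma hc_total: "c \<in> Cc \<Longrightarrow> c x = (\<Sum>\<gamma>\<in>G c. hc c \<gamma> x)"
proof (induction x rule: hom_induct)
  case (1 p x)
  show ?case
  proof (rule co_ext)
    fix r
    have "co (\<Sum>\<gamma>\<in>G c. hc c \<gamma> x) r = (\<Sum>\<gamma>\<in>G c. if \<gamma> = r - p then hc c \<gamma> x else 0)"
      unfolding co_setsum
      by (rule sum.cong) (auto simp: co_hom[OF Ch_g[OF hc_Ch[OF 1(2)] 1(1)]])
    also have "\<dots> = hc c (r - p) x"
      using G_fin[OF 1(2)] by (simp add: G_def)
    also have "\<dots> = co (c x) r" using hc_hom[OF 1(2) 1(1)] by simp
    finally show "co (c x) r = co (\<Sum>\<gamma>\<in>G c. hc c \<gamma> x) r" by simp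
  qed
qed (simp add: Cc_add hc_add sum.distrib)

lemma co_C: "c \<in> Cc \<Longrightarrow> co (c x) r = (\<Sum>\<gamma>\<in>G c. hc c \<gamma> (co x (r - \<gamma>)))"
  by (subst hc_total) (simp_all add: co_setsum Ch_co[OF hc_Ch])

lemma co_supp_S: "{p. co x p \<noteq> 0} \<subseteq> S" using g_S[OF co_in] by blast

lemma top_co:
  assumes "x \<noteq> 0"
  obtains p where "co x p \<noteq> 0" "\<And>q. co x q \<noteq> 0 \<Longrightarrow> q \<noteq> p \<Longrightarrow> \<rho> q < \<rho> p"
proof -
  have "{p. co x p \<noteq> 0} \<noteq> {}" using co_nonzero[OF assms] by simp
  then obtain p where p: "p \<in> {p. co x p \<noteq> 0}" "\<And>q. q \<in> {p. co x p \<noteq> 0} \<Longrightarrow> q \<noteq> p \<Longrightarrow> \<rho> q < \<rho> p"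
    using exists_arg_max[OF co_fin _ inj_on_subset[OF \<rho>_inj co_supp_S], of x] by metis
  show thesis by (rule that[of p]) (use p in simp_all)
qed

lemma G_S: "c \<in> Cc \<Longrightarrow> G c \<subseteq> S" using Ch_S[OF hc_Ch] by (auto simp: G_def)

lemma G_nonempty: "c \<in> Cc \<Longrightarrow> c \<noteq> (\<lambda>_. 0) \<Longrightarrow> G c \<noteq> {}"
proof -
  assume c: "c \<in> Cc" "c \<noteq> (\<lambda>_. 0)"
  then obtain x where "c x \<noteq> 0" by auto
  then show ?thesis using hc_total[OF c(1), of x] by auto
qed

text \<open>The product of the leading part of \<open>c\<close> and the leading component of
  \<open>x\<close> is the only contribution in its degree, and it is nonzero by Schur.\<close>

lemma torsion_free:
  assumes c: "c \<in> Cc" "c x = 0" "x \<noteq> 0"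
  shows "c = (\<lambda>_. 0)"
proof (rule ccontr)
  assume "c \<noteq> (\<lambda>_. 0)"
  then obtain \<gamma> where \<gamma>: "\<gamma> \<in> G c" "\<And>q. q \<in> G c \<Longrightarrow> q \<noteq> \<gamma> \<Longrightarrow> \<rho> q < \<rho> \<gamma>"
    using exists_arg_max[OF G_fin[OF c(1)] G_nonempty[OF c(1)] inj_on_subset[OF \<rho>_inj G_S[OF c(1)]]] by metis
  obtain p where p: "co x p \<noteq> 0" "\<And>q. co x q \<noteq> 0 \<Longrightarrow> q \<noteq> p \<Longrightarrow> \<rho> q < \<rho> p"
    using top_co[OF c(3)] by blast
  have "0 = (\<Sum>\<delta>\<in>G c. hc c \<delta> (co x (p + \<gamma> - \<delta>)))" using co_C[OF c(1), of x "p + \<gamma>"] c(2) by simp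
  also have "\<dots> = (\<Sum>\<delta>\<in>{\<gamma>}. hc c \<delta> (co x (p + \<gamma> - \<delta>)))"
  proof (rule sum.mono_neutral_right[OF G_fin[OF c(1)]])
    show "\<forall>i\<in>G c - {\<gamma>}. hc c i (co x (p + \<gamma> - i)) = 0"
    proof
      fix \<delta> assume d: "\<delta> \<in> G c - {\<gamma>}"
      then have "\<rho> \<delta> < \<rho> \<gamma>" using \<gamma> by blast
      then have "\<rho> (p + \<gamma> - \<delta>) > \<rho> p" by (simp add: \<rho>_add \<rho>_diff)
      then have "co x (p + \<gamma> - \<delta>) = 0" using p(2)[of "p + \<gamma> - \<delta>"] by force
      then show "hc c \<delta> (co x (p + \<gamma> - \<delta>)) = 0" using Cc_0[OF Ch_Cc[OF hc_Ch[OF c(1)]]] by simp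
    qed
  qed (use \<gamma> in simp)
  finally have "hc c \<gamma> (co x p) = 0" by simp
  then show False using Ch_ker[OF hc_Ch[OF c(1)], of \<gamma> "co x p"] p(1) \<gamma>(1) by (simp add: G_def)
qed

sublocale C: endo_ring Cc
  by unfold_locales (use Cc_add Cc_plus Cc_neg Cc_comp Cc_one Cc_comm torsion_free e0(1) in auto)

section \<open>Graded modules over the centroid\<close>

definition hom :: "'a set" where "hom = (\<Union>p. g p)"

definition gmod :: "'a set \<Rightarrow> bool" where "gmod N \<longleftrightarrow> C.cmod N \<and> (\<forall>x\<in>N. \<forall>p. co x p \<in> N)"

lemma gmod_UNIV: "gmod UNIV" by (simp add: gmod_def C.cmod_def)

lemma gmod_subset: "C.cmod N \<Longrightarrow> (\<And>p x. x \<in> M \<Longrightarrow> co x p \<in> N) \<Longrightarrow> M \<subseteq> N"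
  using co_total C.cmod_sum by (metis subsetI)

lemma gmod_cspan: "finite B \<Longrightarrow> B \<subseteq> hom \<Longrightarrow> gmod (C.cspan B)"
  unfolding gmod_def
proof (intro conjI ballI allI)
  fix x p assume B: "finite B" "B \<subseteq> hom" "x \<in> C.cspan B"
  then obtain c where c: "\<forall>b\<in>B. c b \<in> Cc" "x = (\<Sum>b\<in>B. c b b)" by (auto simp: C.cspan_def)
  have "co (c b b) p \<in> C.cspan B" if b: "b \<in> B" for b
  proof -
    obtain q where q: "b \<in> g q" using B b by (auto simp: hom_def)
    have "co (c b b) p = hc (c b) (p - q) b" using hc_hom[of "c b" b q "p - q"] q c b by simp
    then show ?thesis using C.cmod_C[OF C.cmod_cspan] Ch_Cc[OF hc_Ch] c b C.cspan_base B by metis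
  qed
  then show "co x p \<in> C.cspan B" unfolding c(2) co_setsum by (intro C.cmod_sum C.cmod_cspan)
qed (rule C.cmod_cspan)

text \<open>Over a general domain a vector outside a span can still be dependent on it. Here a
  suitable homogeneous component of the relation puts a nonzero homogeneous centroid multiple of
  \<open>x\<close> into the span, and that multiplier is invertible.\<close>

lemma cind_insert:
  assumes B: "C.cind B" "B \<subseteq> hom" and x: "x \<in> g p" "x \<notin> C.cspan B"
  shows "C.cind (insert x B)"
  unfolding C.cfree_def
proof (intro conjI allI impI)
  have fin: "finite B" using C.cfree_finite[OF B(1)] .
  then show "finite (insert x B)" by simp
  have xB: "x \<notin> B" using x(2) C.cspan_base[OF fin] by blast
  fix c assume c: "(\<forall>i\<in>insert x B. c i \<in> Cc) \<and> (\<Sum>i\<in>insert x B. c i i) = 0"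
  then have cx: "c x \<in> Cc" by simp
  have s: "c x x + (\<Sum>i\<in>B. c i i) = 0" using c fin xB by simp
  have "c x = (\<lambda>_. 0)"
  proof (rule ccontr)
    assume "c x \<noteq> (\<lambda>_. 0)"
    then obtain \<gamma> where g: "\<gamma> \<in> G (c x)" using G_nonempty[OF cx] by blast
    have "co (c x x + (\<Sum>i\<in>B. c i i)) (p + \<gamma>) = 0" using s by simp
    then have e: "hc (c x) \<gamma> x + co (\<Sum>i\<in>B. c i i) (p + \<gamma>) = 0"
      by (simp add: co_add hc_hom[OF cx x(1)])
    have "(\<Sum>i\<in>B. c i i) \<in> C.cspan B" using c by (auto simp: C.cspan_def)
    then have m: "co (\<Sum>i\<in>B. c i i) (p + \<gamma>) \<in> C.cspan B" using gmod_cspan[OF fin B(2)] by (simp add: gmod_def)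
    have "hc (c x) \<gamma> x = - co (\<Sum>i\<in>B. c i i) (p + \<gamma>)" using e by (simp add: eq_neg_iff_add_eq_0)
    then have h: "hc (c x) \<gamma> x \<in> C.cspan B" using m C.cmod_neg[OF C.cmod_cspan] by simp
    have "hc (c x) \<gamma> \<noteq> (\<lambda>_. 0)" using g by (simp add: G_def)
    then obtain d where d: "d \<in> Ch (- \<gamma>)" "\<And>x'. d (hc (c x) \<gamma> x') = x'"
      using Ch_inverse[OF hc_Ch[OF cx]] by metis
    then have "x \<in> C.cspan B" using C.cmod_C[OF C.cmod_cspan Ch_Cc[OF d(1)] h] by simp
    then show False using x(2) by simp
  qed
  moreover from this have "c i = (\<lambda>_. 0)" if "i \<in> B" for i
    using C.cfreeD[OF B(1), of c i] s c that by simp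
  ultimately show "\<forall>i\<in>insert x B. c i = (\<lambda>_. 0)" by blast
qed

lemma cind_bounded: "\<exists>K. \<forall>A. C.cind A \<longrightarrow> card A \<le> K"
proof -
  obtain F where F: "finite F" "\<forall>x. \<exists>c. (\<forall>f\<in>F. c f \<in> Cc) \<and> x = (\<Sum>f\<in>F. c f f)"
    using fgc by (auto simp: fgc_def)
  then have "x \<in> C.cspan F" for x by (auto simp: C.cspan_def)
  then show ?thesis using C.steinitz[OF F(1), of _ "\<lambda>x. x"] by blast
qed

text \<open>A maximal homogeneous independent set already spans, by \<open>cind_insert\<close>; one
  exists because finite generation over the centroid bounds the size of independent sets. Thus every
  graded submodule is free, with a basis extending any given homogeneous one.\<close>

lemma hom_basis:
  assumes N: "gmod N" and B0: "C.cind B0" "B0 \<subseteq> N" "B0 \<subseteq> hom"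
  obtains B where "B0 \<subseteq> B" "B \<subseteq> hom" "B \<subseteq> N" "cbasis Cc N B"
proof -
  define Q where "Q B \<longleftrightarrow> B0 \<subseteq> B \<and> B \<subseteq> hom \<and> B \<subseteq> N \<and> C.cind B" for B
  obtain K where K: "\<forall>A. C.cind A \<longrightarrow> card A \<le> K" using cind_bounded by blast
  have "Q B0" using B0 by (simp add: Q_def)
  moreover have "\<forall>y. Q y \<longrightarrow> card y < Suc K" using K by (simp add: Q_def less_Suc_eq_le)
  ultimately have "\<exists>B. Q B \<and> (\<forall>A. Q A \<longrightarrow> card A \<le> card B)"
    by (rule ex_has_greatest_nat)
  then obtain B where B: "Q B" "\<And>A. Q A \<Longrightarrow> card A \<le> card B" by blast
  have fin: "finite B" using B(1) C.cfree_finite by (auto simp: Q_def)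
  have hs: "x \<in> C.cspan B" if x: "x \<in> N" "x \<in> g p" for x p
  proof (rule ccontr)
    assume n: "x \<notin> C.cspan B"
    then have "x \<notin> B" using C.cspan_base[OF fin] by blast
    moreover have "Q (insert x B)"
      using B(1) cind_insert[OF _ _ x(2) n] x unfolding Q_def hom_def by auto
    ultimately show False using B(2)[of "insert x B"] fin by simp
  qed
  have "N \<subseteq> C.cspan B" by (rule gmod_subset[OF C.cmod_cspan], rule hs) (use N co_in in \<open>auto simp: gmod_def\<close>)
  moreover have "C.cspan B \<subseteq> N" using C.cspan_least N B(1) by (simp add: gmod_def Q_def)
  ultimately show thesis using that B(1) C.cbasis_iff by (auto simp: Q_def)
qed

lemma cind_empty: "C.cind {}" by (simp add: C.cfree_def)

abbreviation rk where "rk \<equiv> crank Cc"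

lemma ex_hom_basis:
  assumes "gmod N"
  obtains B where "B \<subseteq> hom" "B \<subseteq> N" "cbasis Cc N B" "C.cind B" "finite B" "rk N = card B" "N = C.cspan B"
proof -
  obtain B where "B \<subseteq> hom" "B \<subseteq> N" "cbasis Cc N B" using hom_basis[OF assms cind_empty] by auto
  then show thesis using that C.crank_eq C.cbasis_iff C.cfree_finite by metis
qed

lemma card_le_rk: "gmod N \<Longrightarrow> C.cind A \<Longrightarrow> A \<subseteq> N \<Longrightarrow> card A \<le> rk N"
  using ex_hom_basis C.cind_card_le_crank by metis

text \<open>The second part draws equality from ranks: with a full set of independent homogeneous
  vectors in \<open>M\<close> and \<open>N\<close>, a homogeneous vector outside their span would
  enlarge it beyond the total rank.\<close>

lemma rk_add:
  assumes M: "gmod M" and N: "gmod N" and MN: "M \<inter> N \<subseteq> {0}"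
  shows "rk M + rk N \<le> rk UNIV"
    and "rk M + rk N = rk UNIV \<Longrightarrow> x \<in> g p \<Longrightarrow> \<exists>a\<in>M. \<exists>b\<in>N. x = a + b"
proof -
  obtain A where A: "A \<subseteq> hom" "A \<subseteq> M" "C.cind A" "finite A" "rk M = card A" "M = C.cspan A" using ex_hom_basis[OF M] by metis
  obtain B where B: "B \<subseteq> hom" "B \<subseteq> N" "C.cind B" "finite B" "rk N = card B" "N = C.cspan B" using ex_hom_basis[OF N] by metis
  have m: "C.cmod M" "C.cmod N" using M N by (auto simp: gmod_def)
  have u: "C.cind (A \<union> B)" "A \<inter> B = {}" using C.cind_union[OF A(3,2) m(1) B(3,2) m(2) MN] by auto
  have cu: "card (A \<union> B) = rk M + rk N" using A B u by (simp add: card_Un_disjoint)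
  then show "rk M + rk N \<le> rk UNIV" using card_le_rk[OF gmod_UNIV u(1)] by simp
  assume eq: "rk M + rk N = rk UNIV" and x: "x \<in> g p"
  have "x \<in> C.cspan (A \<union> B)"
  proof (rule ccontr)
    assume n: "x \<notin> C.cspan (A \<union> B)"
    have fin: "finite (A \<union> B)" using A B by simp
    have "C.cind (insert x (A \<union> B))" by (rule cind_insert[OF u(1) _ x n]) (use A B in auto)
    then have "card (insert x (A \<union> B)) \<le> rk UNIV" using card_le_rk[OF gmod_UNIV] by simp
    moreover have "x \<notin> A \<union> B" using n C.cspan_base[OF fin] by blast
    ultimately show False using fin cu eq by simp
  qed
  then obtain c where c: "\<forall>b\<in>A \<union> B. c b \<in> Cc" "x = (\<Sum>b\<in>A \<union> B. c b b)" by (auto simp: C.cspan_def)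
  then have "x = (\<Sum>b\<in>A. c b b) + (\<Sum>b\<in>B. c b b)" using A B u by (simp add: sum.union_disjoint)
  moreover have "(\<Sum>b\<in>A. c b b) \<in> M" "(\<Sum>b\<in>B. c b b) \<in> N" using c A(6) B(6) by (auto simp: C.cspan_def)
  ultimately show "\<exists>a\<in>M. \<exists>b\<in>N. x = a + b" by blast
qed

subsection \<open>Leading terms\<close>

text \<open>Leading coefficients in degree \<open>p\<close>. The component at \<open>p\<close> is
  allowed to vanish, which makes this set closed under addition.\<close>

definition inp :: "'a set \<Rightarrow> 'p \<Rightarrow> 'a set" where
  "inp U p = {co x p | x. x \<in> U \<and> (\<forall>q. \<rho> q > \<rho> p \<longrightarrow> co x q = 0)}"

text \<open>The initial module of \<open>U\<close>, as in the theory of initial ideals for a degree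
  order.\<close>

definition IN :: "'a set \<Rightarrow> 'a set" where "IN U = {y. \<forall>p. co y p \<in> inp U p}"

lemma inp_0: "0 \<in> U \<Longrightarrow> 0 \<in> inp U p" unfolding inp_def by (intro CollectI exI[of _ 0]) simp

lemma inp_add: "C.cmod U \<Longrightarrow> x \<in> inp U p \<Longrightarrow> y \<in> inp U p \<Longrightarrow> x + y \<in> inp U p"
proof -
  assume U: "C.cmod U" "x \<in> inp U p" "y \<in> inp U p"
  then obtain u v where "x = co u p" "u \<in> U" "\<forall>q. \<rho> q > \<rho> p \<longrightarrow> co u q = 0"
      "y = co v p" "v \<in> U" "\<forall>q. \<rho> q > \<rho> p \<longrightarrow> co v q = 0"
    unfolding inp_def by blast
  then show ?thesis unfolding inp_def by (intro CollectI exI[of _ "u + v"]) (simp add: co_add C.cmod_add[OF U(1)])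
qed

lemma inp_sum: "C.cmod U \<Longrightarrow> (\<And>i. i \<in> A \<Longrightarrow> f i \<in> inp U p) \<Longrightarrow> sum f A \<in> inp U p"
  by (induction A rule: infinite_finite_induct) (auto intro: inp_add simp: inp_0 C.cmod_0)

lemma inp_Ch: "C.cmod U \<Longrightarrow> c \<in> Ch \<gamma> \<Longrightarrow> x \<in> inp U p \<Longrightarrow> c x \<in> inp U (p + \<gamma>)"
proof -
  assume U: "C.cmod U" "c \<in> Ch \<gamma>" "x \<in> inp U p"
  then obtain u where u: "x = co u p" "u \<in> U" "\<forall>q. \<rho> q > \<rho> p \<longrightarrow> co u q = 0"
    unfolding inp_def by blast
  have "co (c u) q = 0" if "\<rho> q > \<rho> (p + \<gamma>)" for q
  proof -
    have "\<rho> (q - \<gamma>) > \<rho> p" using that by (simp add: \<rho>_add \<rho>_diff)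
    then show ?thesis using Ch_co[OF U(2)] u(3) Cc_0[OF Ch_Cc[OF U(2)]] by simp
  qed
  moreover have "co (c u) (p + \<gamma>) = c x" using Ch_co[OF U(2)] u(1) by simp
  ultimately show ?thesis unfolding inp_def using C.cmod_C[OF U(1) Ch_Cc[OF U(2)] u(2)]
    by (intro CollectI exI[of _ "c u"]) auto
qed

lemma gmod_IN:
  assumes U: "C.cmod U"
  shows "gmod (IN U)"
  unfolding gmod_def C.cmod_def
proof (intro conjI ballI allI)
  show "0 \<in> IN U" using inp_0[OF C.cmod_0[OF U]] by (simp add: IN_def)
  fix x assume x: "x \<in> IN U"
  show "x + y \<in> IN U" if "y \<in> IN U" for y using x that inp_add[OF U] by (simp add: IN_def co_add)
  show "co x p \<in> IN U" for p
    using x inp_0[OF C.cmod_0[OF U]] by (simp add: IN_def co_hom[OF co_in])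
next
  fix c x assume c: "c \<in> Cc" and x: "x \<in> IN U"
  show "c x \<in> IN U"
    unfolding IN_def
  proof (intro CollectI allI)
    fix p
    have "hc c \<gamma> (co x (p - \<gamma>)) \<in> inp U p" for \<gamma>
      using inp_Ch[OF U hc_Ch[OF c], of "co x (p - \<gamma>)" "p - \<gamma>" \<gamma>] x by (simp add: IN_def)
    then show "co (c x) p \<in> inp U p" unfolding co_C[OF c] by (intro inp_sum[OF U])
  qed
qed

lemma IN_mono: "U \<subseteq> V \<Longrightarrow> IN U \<subseteq> IN V" unfolding IN_def inp_def by blast

lemma IN_UNIV: "IN UNIV = UNIV"
proof -
  have "co y p \<in> inp UNIV p" for y p
    unfolding inp_def by (intro CollectI exI[of _ "co y p"]) (auto simp: co_hom[OF co_in])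
  then show ?thesis by (simp add: IN_def)
qed

lemma IN_zero: "IN {0} = {0}"
proof -
  have "inp {0} p = {0}" for p by (auto simp: inp_def)
  then show ?thesis using co_nonzero by (auto simp: IN_def)
qed

lemma IN_lead:
  assumes "C.cmod U" "x \<in> U" "x \<noteq> 0"
  obtains p where "co x p \<noteq> 0" "co x p \<in> IN U"
proof -
  obtain p where p: "co x p \<noteq> 0" "\<And>q. co x q \<noteq> 0 \<Longrightarrow> q \<noteq> p \<Longrightarrow> \<rho> q < \<rho> p"
    using top_co[OF assms(3)] by blast
  have "co x p \<in> inp U p" unfolding inp_def
  proof (intro CollectI exI[of _ x] conjI allI impI)
    fix q assume "\<rho> p < \<rho> q" then show "co x q = 0" using p(2)[of q] by force
  qed (use assms in simp_all)
  then have "co x p \<in> IN U" using inp_0[OF C.cmod_0[OF assms(1)]] by (simp add: IN_def co_hom[OF co_in])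
  then show thesis using that p(1) by blast
qed

text \<open>In degree \<open>p + q\<close> only the two leading terms can meet, since any other pair
  has one factor above its bound. Their bracket may be 0, which \<open>inp\<close>
  tolerates.\<close>

lemma inp_br:
  assumes W: "\<And>u v. u \<in> U \<Longrightarrow> v \<in> V \<Longrightarrow> br u v \<in> W" "C.cmod W" and x: "x \<in> inp U p" and y: "y \<in> inp V q"
  shows "br x y \<in> inp W (p + q)"
proof (cases "x = 0 \<or> y = 0")
  case True then show ?thesis using inp_0[OF C.cmod_0[OF W(2)]] by auto
next
  case False
  obtain u v where u: "x = co u p" "u \<in> U" "\<And>q. \<rho> q > \<rho> p \<Longrightarrow> co u q = 0"
      and v: "y = co v q" "v \<in> V" "\<And>p. \<rho> p > \<rho> q \<Longrightarrow> co v p = 0"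
    using x y unfolding inp_def by blast
  have pS: "p \<in> S" using u(1) False co_supp_S[of u] by blast
  have "co (br u v) (p + q) = (\<Sum>p'\<in>{p}. br (co u p') (co v (p + q - p')))"
    unfolding co_br
  proof (rule sum.mono_neutral_right[OF co_fin])
    show "{p} \<subseteq> {p. co u p \<noteq> 0}" using u(1) False by simp
    show "\<forall>i\<in>{p. co u p \<noteq> 0} - {p}. br (co u i) (co v (p + q - i)) = 0"
    proof
      fix i assume i: "i \<in> {p. co u p \<noteq> 0} - {p}"
      then have "\<rho> i \<noteq> \<rho> p" using inj_onD[OF \<rho>_inj, of i p] pS co_supp_S[of u] by blast
      moreover have "\<not> \<rho> i > \<rho> p" using u(3) i by auto
      ultimately have "\<rho> (p + q - i) > \<rho> q" by (simp add: \<rho>_add \<rho>_diff)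
      then show "br (co u i) (co v (p + q - i)) = 0" using v(3) by simp
    qed
  qed
  then have e: "co (br u v) (p + q) = br x y" using u v by simp
  have "co (br u v) r = 0" if r: "\<rho> r > \<rho> (p + q)" for r
    unfolding co_br
  proof (rule sum.neutral, rule ballI)
    fix i assume "i \<in> {p. co u p \<noteq> 0}"
    then have "\<not> \<rho> i > \<rho> p" using u(3) by auto
    then have "\<rho> (r - i) > \<rho> q" using r by (simp add: \<rho>_add \<rho>_diff)
    then show "br (co u i) (co v (r - i)) = 0" using v(3) by simp
  qed
  then show ?thesis unfolding inp_def using e W(1)[OF u(2) v(2)] by (intro CollectI exI[of _ "br u v"]) auto
qed

lemma IN_br:
  assumes "\<And>u v. u \<in> U \<Longrightarrow> v \<in> V \<Longrightarrow> br u v \<in> W" "C.cmod W" "x \<in> IN U" "y \<in> IN V"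
  shows "br x y \<in> IN W"
  unfolding IN_def
proof (intro CollectI allI)
  fix r
  have "br (co x p) (co y (r - p)) \<in> inp W r" for p
    using inp_br[OF assms(1,2), where p = p and q = "r - p" and x = "co x p" and y = "co y (r - p)"]
      assms(3,4) by (simp add: IN_def)
  then show "co (br x y) r \<in> inp W r" unfolding co_br by (intro inp_sum[OF assms(2)])
qed

lemma cspan_disjoint:
  assumes "C.cind (A \<union> B)" "A \<inter> B = {}"
  shows "C.cspan A \<inter> C.cspan B \<subseteq> {0}"
proof
  fix x assume "x \<in> C.cspan A \<inter> C.cspan B"
  then obtain c d where c: "\<forall>a\<in>A. c a \<in> Cc" "x = (\<Sum>a\<in>A. c a a)" and d: "\<forall>b\<in>B. d b \<in> Cc" "x = (\<Sum>b\<in>B. d b b)"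
    by (auto simp: C.cspan_def)
  define f where "f i = (if i \<in> A then c i else (\<lambda>x. - d i x))" for i
  have fin: "finite A" "finite B" using C.cfree_finite[OF assms(1)] by auto
  have "(\<Sum>i\<in>A \<union> B. f i i) = (\<Sum>i\<in>A. f i i) + (\<Sum>i\<in>B. f i i)" using fin assms(2) by (rule sum.union_disjoint)
  moreover have "(\<Sum>i\<in>A. f i i) = x" unfolding c(2) by (rule sum.cong) (auto simp: f_def)
  moreover have "(\<Sum>i\<in>B. f i i) = - x" unfolding d(2) sum_negf[symmetric]
    by (rule sum.cong) (use assms(2) in \<open>auto simp: f_def\<close>)
  ultimately have "(\<Sum>i\<in>A \<union> B. f i i) = 0" by simp
  moreover have "\<forall>i\<in>A \<union> B. f i \<in> Cc" using c d Cc_neg by (auto simp: f_def)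
  ultimately have "f i = (\<lambda>_. 0)" if "i \<in> A \<union> B" for i using C.cfreeD[OF assms(1), of f i] that by blast
  then have "\<forall>a\<in>A. c a = (\<lambda>_. 0)" unfolding f_def by (metis UnI1)
  then show "x \<in> {0}" using c(2) by simp
qed

text \<open>A graded complement of the leading-term module meets the original module trivially.\<close>
lemma card_le_rk_IN:
  assumes U: "C.cmod U" and A: "C.cind A" "A \<subseteq> U"
  shows "card A \<le> rk (IN U)"
proof -
  obtain B where B: "B \<subseteq> hom" "B \<subseteq> IN U" "C.cind B" "finite B" "rk (IN U) = card B" "IN U = C.cspan B"
    using ex_hom_basis[OF gmod_IN[OF U]] by metis
  obtain D where D: "B \<subseteq> D" "D \<subseteq> hom" "cbasis Cc UNIV D"
    using hom_basis[OF gmod_UNIV B(3) _ B(1)] by auto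
  define B' where "B' = D - B"
  have cD: "C.cind D" using D(3) by (simp add: C.cbasis_iff)
  have finD: "finite D" using C.cfree_finite[OF cD] .
  have un: "B \<union> B' = D" "B \<inter> B' = {}" using D(1) by (auto simp: B'_def)
  define K where "K = C.cspan B'"
  have B': "C.cind B'" "finite B'" "B' \<subseteq> hom" using C.cind_subset[OF cD] finD D by (auto simp: B'_def)
  have gK: "gmod K" unfolding K_def by (rule gmod_cspan[OF B'(2,3)])
  have IK: "IN U \<inter> K \<subseteq> {0}" using cspan_disjoint[of B B'] cD un B(6) K_def by simp
  have "U \<inter> K \<subseteq> {0}"
  proof
    fix x assume x: "x \<in> U \<inter> K"
    show "x \<in> {0}"
    proof (rule ccontr)
      assume "x \<notin> {0}"
      then obtain p where p: "co x p \<noteq> 0" "co x p \<in> IN U" using IN_lead[OF U] x by blast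
      moreover have "co x p \<in> K" using gK x by (simp add: gmod_def)
      ultimately show False using IK by blast
    qed
  qed
  moreover have "B' \<subseteq> K" unfolding K_def using C.cspan_base[OF B'(2)] by blast
  moreover have "C.cmod K" unfolding K_def by (rule C.cmod_cspan)
  ultimately have u: "C.cind (A \<union> B') \<and> A \<inter> B' = {}"
    using C.cind_union[OF A U B'(1), of K] by simp
  then have "card (A \<union> B') \<le> rk UNIV" using card_le_rk[OF gmod_UNIV] by blast
  moreover have "rk UNIV = card D" by (rule C.crank_eq[OF D(3)])
  moreover have "card D = card B + card B'" using un B(4) B'(2) by (metis card_Un_disjoint)
  moreover have "card (A \<union> B') = card A + card B'" using u C.cfree_finite[OF A(1)] B'(2) by (simp add: card_Un_disjoint)
  ultimately show ?thesis using B(5) by simp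
qed

end

section \<open>Lie tori\<close>

locale fgc_lie_torus =
  fixes sc :: "'k::field_char_0 \<Rightarrow> 'a::ab_group_add \<Rightarrow> 'a" and br :: "'a \<Rightarrow> 'a \<Rightarrow> 'a"
    and \<Delta> :: "'v::real_vector set" and n :: nat and gr :: "'v \<Rightarrow> (nat \<Rightarrow> int) \<Rightarrow> 'a set"
  assumes torus: "lie_torus sc br \<Delta> n gr" and is_fgc: "fgc sc br" and is_centreless: "centreless br"
begin

abbreviation D where "D \<equiv> \<Delta> - {0}"

lemma irr_finite: "irr_finite_rs \<Delta>" using torus by (simp add: lie_torus_def)
lemma fin_\<Delta>: "finite \<Delta>" and zero_\<Delta>: "0 \<in> \<Delta>" using irr_finite by (auto simp: irr_finite_rs_def)

sublocale R: irr_rsys D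
  using irr_finite by unfold_locales (auto simp: irr_finite_rs_def irreducible_rs_def)

definition g :: "'v \<times> (nat \<Rightarrow> int) \<Rightarrow> 'a set" where "g p = gr (fst p) (snd p)"
definition S :: "('v \<times> (nat \<Rightarrow> int)) set" where "S = root_lattice \<Delta> \<times> lat n"
text \<open>One generic ordering is fixed by choice, so that all leading terms in the locale refer
  to the same one.\<close>

definition \<rho> :: "'v \<times> (nat \<Rightarrow> int) \<Rightarrow> real" where
  "\<rho> = (SOME r. (\<forall>p q. r (p + q) = r p + r q) \<and> inj_on r S)"

lemma \<rho>_props: "(\<forall>p q. \<rho> (p + q) = \<rho> p + \<rho> q) \<and> inj_on \<rho> S"
proof -
  obtain h :: "'v \<Rightarrow> real" and k where hk: "linear h" "\<And>x y. k (x + y) = k x + k y"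
      "inj_on (\<lambda>p. h (fst p) + k (snd p)) (root_lattice \<Delta> \<times> lat n)"
    using generic_functional[OF fin_\<Delta>, of n] by blast
  define r where "r p = h (fst p) + k (snd p)" for p
  have "(\<forall>p q. r (p + q) = r p + r q) \<and> inj_on r S"
    using hk(3) unfolding S_def r_def by (simp add: hk(2) linear_add[OF hk(1)])
  then have "\<exists>r :: 'v \<times> (nat \<Rightarrow> int) \<Rightarrow> real. (\<forall>p q. r (p + q) = r p + r q) \<and> inj_on r S" by blast
  then show ?thesis unfolding \<rho>_def by (rule someI_ex)
qed

section \<open>The axioms of a Lie torus\<close>

lemma T_lie: "lie_algebra sc br"
  using torus unfolding lie_torus_def by (elim conjE)
lemma T_sub: "\<forall>\<alpha> l. ksubspace sc (gr \<alpha> l)"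
  using torus unfolding lie_torus_def by (elim conjE)
lemma T_out: "\<forall>\<alpha> l. (\<alpha> \<notin> root_lattice \<Delta> \<or> l \<notin> lat n) \<longrightarrow> gr \<alpha> l = {0}"
  using torus unfolding lie_torus_def by (elim conjE)
lemma T_dec: "\<forall>x. \<exists>!c::('v \<times> (nat \<Rightarrow> int)) \<Rightarrow> 'a. finite {p. c p \<noteq> 0} \<and>
            (\<forall>p. c p \<in> gr (fst p) (snd p)) \<and> x = sum c {p. c p \<noteq> 0}"
  using torus unfolding lie_torus_def by (elim conjE)
lemma T_br: "\<forall>\<alpha> l \<beta> \<mu>. \<forall>x\<in>gr \<alpha> l. \<forall>y\<in>gr \<beta> \<mu>. br x y \<in> gr (\<alpha> + \<beta>) (l + \<mu>)"
  using torus unfolding lie_torus_def by (elim conjE)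
lemma T_1: "{\<alpha>. root_space gr \<alpha> \<noteq> {0}} = \<Delta>"
  using torus unfolding lie_torus_def by (elim conjE)
lemma T_2i: "\<forall>\<alpha>\<in>\<Delta> - {0}. \<alpha> \<notin> (\<lambda>x. 2 *\<^sub>R x) ` (\<Delta> - {0}) \<longrightarrow> gr \<alpha> 0 \<noteq> {0}"
  using torus unfolding lie_torus_def by (elim conjE)
lemma T_2ii: "\<forall>\<alpha>\<in>\<Delta> - {0}. \<forall>l. gr \<alpha> l \<noteq> {0} \<longrightarrow>
        (\<exists>e f. gr \<alpha> l = range (\<lambda>a. sc a e) \<and> gr (- \<alpha>) (- l) = range (\<lambda>a. sc a f) \<and>
           (\<forall>\<beta>\<in>root_lattice \<Delta>. \<forall>m::int. coroot (\<Delta> - {0}) \<alpha> \<beta> = of_int m \<longrightarrow>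
              (\<forall>x\<in>root_space gr \<beta>. br (br e f) x = sc (of_int m) x)))"
  using torus unfolding lie_torus_def by (elim conjE)
lemma T_3: "\<forall>S. lie_subalgebra sc br S \<and> (\<Union>\<alpha>\<in>\<Delta> - {0}. root_space gr \<alpha>) \<subseteq> S \<longrightarrow> S = UNIV"
  using torus unfolding lie_torus_def by (elim conjE)
lemma T_4: "lat n = {\<mu>. \<exists>F m. finite F \<and> F \<subseteq> {l\<in>lat n. lat_space gr l \<noteq> {0}} \<and>
                      \<mu> = (\<lambda>i. \<Sum>l\<in>F. m l * l i)}"
  using torus unfolding lie_torus_def by (elim conjE)

sublocale graded_lie sc br g S \<rho>
proof -
  interpret vector_space sc using T_lie by (simp add: lie_algebra_def)
  show "graded_lie sc br g S \<rho>"
  proof (unfold_locales, goal_cases)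
    case (2 p) then show ?case using T_sub by (simp add: g_def)
  next
    case (3 p) then show ?case using T_out by (cases p) (auto simp: g_def S_def)
  next
    case (4 p q) then show ?case using root_lattice_diff[OF fin_\<Delta>] by (auto simp: S_def lat_def)
  next
    case (7 x) then show ?case using T_dec by (simp add: g_def)
  next
    case (8 x p y q) then show ?case using T_br by (simp add: g_def)
  qed (use T_lie \<rho>_props is_centreless in auto)
qed

abbreviation L where "L \<equiv> root_space gr"

lemma L_iff: "x \<in> L \<alpha> \<longleftrightarrow> (\<forall>p. co x p \<noteq> 0 \<longrightarrow> fst p = \<alpha>)"
proof
  assume "x \<in> L \<alpha>"
  then obtain I c where c: "finite I" "\<And>i. i \<in> I \<Longrightarrow> c i \<in> g (\<alpha>, i)" "x = sum c I"
    by (auto simp: root_space_def fsums_def g_def)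
  show "\<forall>p. co x p \<noteq> 0 \<longrightarrow> fst p = \<alpha>"
  proof (intro allI impI, rule ccontr)
    fix p assume p: "co x p \<noteq> 0" "fst p \<noteq> \<alpha>"
    have "co x p = 0" unfolding c(3) co_setsum
      by (rule sum.neutral) (use co_hom[OF c(2), of _ p] p(2) in auto)
    then show False using p by simp
  qed
next
  assume a: "\<forall>p. co x p \<noteq> 0 \<longrightarrow> fst p = \<alpha>"
  have inj: "inj_on snd {p. co x p \<noteq> 0}" using a by (auto simp: inj_on_def prod_eq_iff)
  have "x = (\<Sum>p | co x p \<noteq> 0. co x p)" by (rule co_total)
  also have "\<dots> = (\<Sum>p | co x p \<noteq> 0. co x (\<alpha>, snd p))"
    by (rule sum.cong) (use a in \<open>auto simp: prod_eq_iff\<close>)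
  also have "\<dots> = (\<Sum>l\<in>snd ` {p. co x p \<noteq> 0}. co x (\<alpha>, l))" using sum.reindex[OF inj, of "\<lambda>l. co x (\<alpha>, l)"] by simp
  finally show "x \<in> L \<alpha>" unfolding root_space_def fsums_def using co_fin[of x] co_in[of x "(\<alpha>, _)"]
    by (intro CollectI exI[of _ "snd ` {p. co x p \<noteq> 0}"] exI[of _ "\<lambda>l. co x (\<alpha>, l)"]) (auto simp: g_def)
qed

lemma g_L: "x \<in> g p \<Longrightarrow> x \<in> L (fst p)" by (auto simp: L_iff co_hom split: if_splits)

lemma L_0: "0 \<in> L \<alpha>" by (simp add: L_iff)
lemma LT1: "L \<alpha> \<noteq> {0} \<longleftrightarrow> \<alpha> \<in> \<Delta>"
proof -
  show ?thesis using T_1 by blast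
qed

lemma L_\<Delta>: "x \<in> L \<alpha> \<Longrightarrow> x \<noteq> 0 \<Longrightarrow> \<alpha> \<in> \<Delta>" using LT1 by blast
lemma g_\<Delta>: "x \<in> g p \<Longrightarrow> x \<noteq> 0 \<Longrightarrow> fst p \<in> \<Delta>" using g_L L_\<Delta> by blast

lemma L_br: "x \<in> L \<alpha> \<Longrightarrow> y \<in> L \<beta> \<Longrightarrow> br x y \<in> L (\<alpha> + \<beta>)"
  unfolding L_iff
proof (intro allI impI)
  fix r assume a: "\<forall>p. co x p \<noteq> 0 \<longrightarrow> fst p = \<alpha>" "\<forall>p. co y p \<noteq> 0 \<longrightarrow> fst p = \<beta>" "co (br x y) r \<noteq> 0"
  have "\<exists>p. co x p \<noteq> 0 \<and> br (co x p) (co y (r - p)) \<noteq> 0"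
  proof (rule ccontr)
    assume n: "\<not> ?thesis"
    have "co (br x y) r = 0" unfolding co_br by (rule sum.neutral) (use n in auto)
    then show False using a(3) by simp
  qed
  then obtain p where p: "co x p \<noteq> 0" "br (co x p) (co y (r - p)) \<noteq> 0" by blast
  then have "co y (r - p) \<noteq> 0" by auto
  then have "fst (r - p) = \<beta>" "fst p = \<alpha>" using a(1,2) p(1) by blast+
  then show "fst r = \<alpha> + \<beta>" by (simp add: algebra_simps)
qed

text \<open>The floor only changes the type to integers: on roots and 0 the coroot value is already
  integral (\<open>cr_pair\<close>).\<close>

definition pair :: "'v \<Rightarrow> 'v \<Rightarrow> int" where "pair \<alpha> \<beta> = \<lfloor>R.cr \<alpha> \<beta>\<rfloor>"

lemma \<Delta>_span: "\<beta> \<in> \<Delta> \<Longrightarrow> \<beta> \<in> Real_Vector_Spaces.span D"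
  by (cases "\<beta> = 0") (auto simp: real_vector.span_zero real_vector.span_base)

lemma cr_pair: "\<alpha> \<in> D \<Longrightarrow> \<beta> \<in> \<Delta> \<Longrightarrow> R.cr \<alpha> \<beta> = of_int (pair \<alpha> \<beta>)"
proof -
  assume a: "\<alpha> \<in> D" "\<beta> \<in> \<Delta>"
  have "R.cr \<alpha> \<beta> \<in> \<int>"
  proof (cases "\<beta> = 0")
    case True then show ?thesis using linear_0[OF R.coroot_linear[OF a(1)]] by simp
  next
    case False then show ?thesis using R.coroot_int a by simp
  qed
  then show ?thesis by (auto simp: pair_def elim: Ints_cases)
qed

lemma pair_neg: "\<alpha> \<in> D \<Longrightarrow> \<beta> \<in> \<Delta> \<Longrightarrow> pair (- \<alpha>) \<beta> = - pair \<alpha> \<beta>"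
  using cr_pair[of \<alpha> \<beta>] R.coroot_neg[of \<alpha> \<beta>] \<Delta>_span[of \<beta>] by (simp add: pair_def[of "- \<alpha>"])

lemma pair_self: "\<alpha> \<in> D \<Longrightarrow> pair \<alpha> \<alpha> = 2" by (simp add: pair_def R.coroot_self)
lemma pair_negr: "\<alpha> \<in> D \<Longrightarrow> \<beta> \<in> D \<Longrightarrow> pair \<alpha> (- \<beta>) = - pair \<alpha> \<beta>"
  using cr_pair[of \<alpha> \<beta>] linear_neg[OF R.coroot_linear[of \<alpha>], of \<beta>] by (simp add: pair_def[of _ "- \<beta>"])

lemma neg_D: "\<alpha> \<in> D \<Longrightarrow> - \<alpha> \<in> D" by (rule R.neg_in)

definition sl2 :: "'v \<Rightarrow> (nat \<Rightarrow> int) \<Rightarrow> 'a \<Rightarrow> 'a \<Rightarrow> bool" where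
  "sl2 \<alpha> l e f \<longleftrightarrow> e \<in> g (\<alpha>, l) \<and> f \<in> g (- \<alpha>, - l) \<and> e \<noteq> 0 \<and>
     (\<forall>\<beta>\<in>\<Delta>. \<forall>x\<in>L \<beta>. br (br e f) x = sc (of_int (pair \<alpha> \<beta>)) x)"

text \<open>The axiom provides one pair of vectors; the homogeneous space being a line, rescaling
  both vectors inversely makes any prescribed nonzero \<open>e\<close> part of a triple.\<close>

lemma LT2:
  assumes "\<alpha> \<in> D" "e \<in> g (\<alpha>, l)" "e \<noteq> 0"
  shows "g (\<alpha>, l) = range (\<lambda>a. sc a e)" "\<exists>f. sl2 \<alpha> l e f"
proof -
  have "gr \<alpha> l \<noteq> {0}" using assms by (auto simp: g_def)
  then have "\<exists>e f. gr \<alpha> l = range (\<lambda>a. sc a e) \<and> gr (- \<alpha>) (- l) = range (\<lambda>a. sc a f) \<and>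
           (\<forall>\<beta>\<in>root_lattice \<Delta>. \<forall>m::int. R.cr \<alpha> \<beta> = of_int m \<longrightarrow>
              (\<forall>x\<in>L \<beta>. br (br e f) x = sc (of_int m) x))"
    using T_2ii[rule_format, OF assms(1)] by simp
  then obtain e1 f1 where ef: "gr \<alpha> l = range (\<lambda>a. sc a e1)" "gr (- \<alpha>) (- l) = range (\<lambda>a. sc a f1)"
    "\<forall>\<beta>\<in>root_lattice \<Delta>. \<forall>m::int. R.cr \<alpha> \<beta> = of_int m \<longrightarrow> (\<forall>x\<in>L \<beta>. br (br e1 f1) x = sc (of_int m) x)"
    by (elim exE conjE)
  obtain a where a: "e = sc a e1" using assms(2) ef(1) by (auto simp: g_def)
  have a0: "a \<noteq> 0" using a assms(3) by auto
  have e1: "sc b e1 = sc (b / a) e" for b using a a0 by simp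
  have "range (\<lambda>b. sc b e1) = range (\<lambda>b. sc b e)"
  proof (intro subset_antisym subsetI)
    fix x assume "x \<in> range (\<lambda>b. sc b e1)" then show "x \<in> range (\<lambda>b. sc b e)" using e1 by auto
  next
    fix x assume "x \<in> range (\<lambda>b. sc b e)" then show "x \<in> range (\<lambda>b. sc b e1)" using a by auto
  qed
  then show "g (\<alpha>, l) = range (\<lambda>a. sc a e)" using ef(1) by (simp add: g_def)
  define f where "f = sc (1 / a) f1"
  have "br e f = br e1 f1" using a a0 by (simp add: f_def br_scl br_scr)
  moreover have "f \<in> g (- \<alpha>, - l)" unfolding g_def fst_conv snd_conv ef(2) f_def by (rule rangeI)
  ultimately have "sl2 \<alpha> l e f" unfolding sl2_def using assms(2,3) ef(3) cr_pair[OF assms(1)] root_lattice_base by auto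
  then show "\<exists>f. sl2 \<alpha> l e f" by blast
qed

lemma g_exists: "\<alpha> \<in> \<Delta> \<Longrightarrow> \<exists>l. \<exists>e\<in>g (\<alpha>, l). e \<noteq> 0"
proof -
  assume "\<alpha> \<in> \<Delta>"
  then obtain x where x: "x \<in> L \<alpha>" "x \<noteq> 0" using LT1[of \<alpha>] L_0 by blast
  then obtain p where "co x p \<noteq> 0" using co_nonzero by blast
  then show ?thesis using x co_in[of x p] by (cases p) (auto simp: L_iff)
qed

lemma LT3: "0 \<in> T \<Longrightarrow> (\<And>x y. x \<in> T \<Longrightarrow> y \<in> T \<Longrightarrow> x + y \<in> T) \<Longrightarrow> (\<And>a x. x \<in> T \<Longrightarrow> sc a x \<in> T) \<Longrightarrow>
  (\<And>x y. x \<in> T \<Longrightarrow> y \<in> T \<Longrightarrow> br x y \<in> T) \<Longrightarrow> (\<And>\<alpha> x. \<alpha> \<in> D \<Longrightarrow> x \<in> L \<alpha> \<Longrightarrow> x \<in> T) \<Longrightarrow> T = UNIV"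
proof -
  assume a: "0 \<in> T" "\<And>x y. x \<in> T \<Longrightarrow> y \<in> T \<Longrightarrow> x + y \<in> T" "\<And>a x. x \<in> T \<Longrightarrow> sc a x \<in> T"
    "\<And>x y. x \<in> T \<Longrightarrow> y \<in> T \<Longrightarrow> br x y \<in> T" "\<And>\<alpha> x. \<alpha> \<in> D \<Longrightarrow> x \<in> L \<alpha> \<Longrightarrow> x \<in> T"
  have "lie_subalgebra sc br T \<and> (\<Union>\<alpha>\<in>\<Delta> - {0}. L \<alpha>) \<subseteq> T"
  proof (rule conjI)
    show "lie_subalgebra sc br T" unfolding lie_subalgebra_def ksubspace_def
      using a(1-4) by (intro conjI ballI allI) simp_all
    show "(\<Union>\<alpha>\<in>\<Delta> - {0}. L \<alpha>) \<subseteq> T" using a(5) by auto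
  qed
  then show ?thesis by (rule T_3[rule_format])
qed

lemma sl2_neg: "\<alpha> \<in> D \<Longrightarrow> sl2 \<alpha> l e f \<Longrightarrow> sl2 (- \<alpha>) (- l) f e"
proof -
  assume a: "\<alpha> \<in> D" "sl2 \<alpha> l e f"
  have "br (br e f) e = sc (of_int 2) e"
    using a g_L[of e "(\<alpha>, l)"] pair_self[OF a(1)] unfolding sl2_def by fastforce
  then have "f \<noteq> 0" using a(2) by (auto simp: sl2_def)
  have "br (br f e) x = sc (of_int (pair (- \<alpha>) \<beta>)) x" if "\<beta> \<in> \<Delta>" "x \<in> L \<beta>" for \<beta> x
  proof -
    have "br (br f e) x = - br (br e f) x" unfolding br_anti[of f e] br_negl by simp
    also have "br (br e f) x = sc (of_int (pair \<alpha> \<beta>)) x" using a(2) that by (simp add: sl2_def)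
    finally show ?thesis using pair_neg[OF a(1) that(1)] by simp
  qed
  then show ?thesis using a(2) \<open>f \<noteq> 0\<close> by (simp add: sl2_def)
qed

subsection \<open>Representations of the sl2-triples\<close>

lemma weight_epow:
  assumes "br h e = sc 2 e" "br h x = sc \<mu> x"
  shows "br h ((br e ^^ i) x) = sc (\<mu> + 2 * of_nat i) ((br e ^^ i) x)"
proof (induction i)
  case (Suc i)
  have "br h (br e y) = br e (br h y) + br (br h e) y" for y using br_br[of h e y] by simp
  from this[of "(br e ^^ i) x"] have "br h (br e ((br e ^^ i) x)) = sc (\<mu> + 2 * of_nat i + 2) (br e ((br e ^^ i) x))"
    unfolding assms(1) Suc br_scr br_scl scale_left_distrib[of "_ + _"] .
  also have "\<mu> + 2 * of_nat i + 2 = \<mu> + 2 * of_nat (Suc i)" by (simp add: algebra_simps)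
  finally show ?case by simp
qed (simp add: assms)

text \<open>The usual sl2 commutation rule, for a weight vector that need not be primitive. At
  \<open>i = 0\<close> the truncated exponent \<open>i - 1\<close> is multiplied by 0.\<close>

lemma f_epow:
  assumes "br (br e f) e = sc 2 e" "br (br e f) x = sc \<mu> x"
  shows "br f ((br e ^^ i) x) = (br e ^^ i) (br f x) - sc (of_nat i * (\<mu> + of_nat i - 1)) ((br e ^^ (i - 1)) x)"
proof (induction i)
  case (Suc i)
  let ?y = "(br e ^^ i) x"
  have "br f (br e ?y) = br e (br f ?y) - br (br e f) ?y" using br_br[of e f ?y] by simp
  also have "\<dots> = (br e ^^ Suc i) (br f x) - sc (of_nat i * (\<mu> + of_nat i - 1)) (br e ((br e ^^ (i - 1)) x))
      - sc (\<mu> + 2 * of_nat i) ?y"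
    by (simp add: Suc br_diffr br_scr weight_epow[OF assms])
  also have "sc (of_nat i * (\<mu> + of_nat i - 1)) (br e ((br e ^^ (i - 1)) x)) = sc (of_nat i * (\<mu> + of_nat i - 1)) ?y"
    by (cases i) auto
  also have "(br e ^^ Suc i) (br f x) - sc (of_nat i * (\<mu> + of_nat i - 1)) ?y - sc (\<mu> + 2 * of_nat i) ?y
     = (br e ^^ Suc i) (br f x) - sc (of_nat i * (\<mu> + of_nat i - 1) + (\<mu> + 2 * of_nat i)) ?y"
    by (simp add: scale_left_distrib)
  also have "of_nat i * (\<mu> + of_nat i - 1) + (\<mu> + 2 * of_nat i) = of_nat (Suc i) * (\<mu> + of_nat (Suc i) - 1)"
    by (simp add: algebra_simps)
  finally show ?case by simp
qed simp

lemma bpow_0 [simp]: "(br e ^^ i) 0 = 0" by (induction i) auto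

text \<open>Injectivity of the m-th power of e on weight -m, with no finite dimension assumed.
  Induction on the nilpotency index of f: the vector f x has weight -(m + 2) and satisfies the same
  hypotheses there, so it vanishes and x is a lowest weight vector.\<close>

lemma sl2_injective:
  assumes "br (br e f) e = sc 2 e" "br (br e f) f = sc (- 2) f"
  shows "br (br e f) x = sc (- of_nat m) x \<Longrightarrow> (br f ^^ j) x = 0 \<Longrightarrow> (br e ^^ m) x = 0 \<Longrightarrow> x = 0"
proof (induction j arbitrary: x m)
  case (Suc j)
  define y where "y = br f x"
  have mono: "(br e ^^ (m + i)) x = 0" for i using Suc.prems(3) by (subst add.commute) (simp add: funpow_add)
  have "br (br e f) y = br f (br (br e f) x) + br (br (br e f) f) x"
    using br_br[of "br e f" f x] by (simp add: y_def)
  also have "\<dots> = sc (- of_nat (m + 2)) y"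
    using Suc.prems(1) assms(2) by (simp add: br_scr br_scl br_negr br_negl y_def scale_left_distrib algebra_simps)
  finally have wy: "br (br e f) y = sc (- of_nat (m + 2)) y" .
  have "(br f ^^ j) y = 0" using Suc.prems(2) by (simp add: y_def funpow_swap1)
  moreover have "(br e ^^ (m + 2)) y = 0"
    using f_epow[OF assms(1) Suc.prems(1), of "m + 2"] mono[of 2] mono[of 1] by (simp add: y_def)
  ultimately have y0: "br f x = 0" using Suc.IH[OF wy] by (simp add: y_def)
  \<comment> \<open>For a lowest weight vector, applying f lowers a power of e by one with
    coefficient (k + 1)(k - m) up to sign. In characteristic 0 this is nonzero for k < m, so the
    vanishing descends from the power m to x.\<close>
  have "(br e ^^ (m - i)) x = 0" if "i \<le> m" for i
    using that
  proof (induction i)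
    case si: (Suc i)
    define k where "k = m - Suc i"
    have k: "m - i = Suc k" "k < m" using si.prems by (auto simp: k_def)
    have "(br e ^^ Suc k) x = 0" using si k by simp
    then have "sc (of_nat (Suc k) * (- of_nat m + of_nat (Suc k) - 1)) ((br e ^^ k) x) = 0"
      using f_epow[OF assms(1) Suc.prems(1), of "Suc k"] y0 by simp
    moreover have "(of_nat (Suc k) * (- of_nat m + of_nat (Suc k) - 1) :: 'k) \<noteq> 0"
      using k(2) by (simp add: add_eq_0_iff del: of_nat_Suc) (simp add: algebra_simps)
    ultimately show ?case by (simp add: k_def)
  qed (use Suc.prems(3) in simp)
  from this[of m] show ?case by simp
qed simp

lemma L_bpow: "e \<in> L \<alpha> \<Longrightarrow> x \<in> L \<beta> \<Longrightarrow> (br e ^^ j) x \<in> L (\<beta> + of_nat j *\<^sub>R \<alpha>)"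
proof (induction j)
  case (Suc j)
  then have "br e ((br e ^^ j) x) \<in> L (\<alpha> + (\<beta> + of_nat j *\<^sub>R \<alpha>))" by (intro L_br) auto
  then show ?case by (simp add: algebra_simps)
qed simp

lemma locally_nilpotent:
  assumes "\<alpha> \<noteq> 0" "f \<in> L \<alpha>" "x \<in> L \<beta>"
  shows "\<exists>j. (br f ^^ j) x = 0"
proof (rule ccontr)
  assume "\<not> ?thesis"
  then have "\<beta> + of_nat j *\<^sub>R \<alpha> \<in> \<Delta>" for j using L_bpow[OF assms(2,3), of j] L_\<Delta> by blast
  from finite_shift_zero[OF fin_\<Delta> this] show False using assms(1) by simp
qed

lemma sl2_L: "sl2 \<alpha> l e f \<Longrightarrow> e \<in> L \<alpha>" "sl2 \<alpha> l e f \<Longrightarrow> f \<in> L (- \<alpha>)"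
  using g_L by (fastforce simp: sl2_def)+

lemma sl2_act: "sl2 \<alpha> l e f \<Longrightarrow> x \<in> L \<beta> \<Longrightarrow> br (br e f) x = sc (of_int (pair \<alpha> \<beta>)) x"
  using L_\<Delta>[of x \<beta>] by (cases "x = 0") (auto simp: sl2_def)

lemma sl2_act_e: "\<alpha> \<in> D \<Longrightarrow> sl2 \<alpha> l e f \<Longrightarrow> br (br e f) e = sc 2 e"
  using sl2_act[of \<alpha> l e f e \<alpha>] sl2_L(1)[of \<alpha> l e f] pair_self[of \<alpha>] by simp

lemma sl2_act_f: "\<alpha> \<in> D \<Longrightarrow> sl2 \<alpha> l e f \<Longrightarrow> br (br e f) f = sc (- 2) f"
  using sl2_act[of \<alpha> l e f f "- \<alpha>"] sl2_L(2)[of \<alpha> l e f] pair_negr[of \<alpha> \<alpha>] pair_self[of \<alpha>] by simp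

lemma epow_injective:
  assumes "\<alpha> \<in> D" "sl2 \<alpha> l e f" "x \<in> L \<beta>" "pair \<alpha> \<beta> = - int m" "(br e ^^ m) x = 0"
  shows "x = 0"
proof -
  obtain j where "(br f ^^ j) x = 0" using locally_nilpotent[OF _ sl2_L(2)[OF assms(2)] assms(3)] assms(1) by auto
  moreover have "br (br e f) x = sc (- of_nat m) x" using sl2_act[OF assms(2,3)] assms(4) by simp
  ultimately show ?thesis using sl2_injective[OF sl2_act_e[OF assms(1,2)] sl2_act_f[OF assms(1,2)]] assms(5) by blast
qed

lemma e_injective:
  assumes "\<alpha> \<in> D" "sl2 \<alpha> l e f" "x \<in> L \<beta>" "pair \<alpha> \<beta> < 0" "br e x = 0"
  shows "x = 0"
proof (rule epow_injective[OF assms(1-3)])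
  define m where "m = nat (- pair \<alpha> \<beta>)"
  show "pair \<alpha> \<beta> = - int m" using assms(4) by (simp add: m_def)
  obtain k where "m = Suc k" using assms(4) by (cases m) (auto simp: m_def)
  then show "(br e ^^ m) x = 0" using assms(5) by (simp add: funpow_swap1)
qed

text \<open>The main supply of nonzero brackets: a root vector acts injectively on every root space
  with which its coroot pairs negatively.\<close>

lemma br_nonzero:
  assumes "\<alpha> \<in> D" "e \<in> g (\<alpha>, l)" "e \<noteq> 0" "x \<in> L \<beta>" "x \<noteq> 0" "pair \<alpha> \<beta> < 0"
  shows "br e x \<noteq> 0"
  using e_injective[OF assms(1) _ assms(4,6)] LT2(2)[OF assms(1-3)] assms(5) by blast

subsection \<open>Graded simplicity\<close>

text \<open>The centralizer of \<open>x\<close> is a subalgebra; if it contained all spaces of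
  nonzero root it would be everything by (LT3), against centrelessness.\<close>

lemma exists_noncommuting: "x \<noteq> 0 \<Longrightarrow> \<exists>\<alpha>\<in>D. \<exists>l. \<exists>e\<in>g (\<alpha>, l). br x e \<noteq> 0"
proof (rule ccontr)
  assume x: "x \<noteq> 0" and c: "\<not> (\<exists>\<alpha>\<in>D. \<exists>l. \<exists>e\<in>g (\<alpha>, l). br x e \<noteq> 0)"
  have "{y. br x y = 0} = UNIV"
  proof (rule LT3)
    fix y z assume "y \<in> {y. br x y = 0}" "z \<in> {y. br x y = 0}"
    then show "br y z \<in> {y. br x y = 0}" using br_br[of x y z] by simp
  next
    fix \<alpha> y assume a: "\<alpha> \<in> D" "y \<in> L \<alpha>"
    have "br x (co y p) = 0" for p
    proof (cases "co y p = 0")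
      case False
      then have "co y p \<in> g (\<alpha>, snd p)" using a(2) co_in[of y p] by (cases p) (auto simp: L_iff)
      then show ?thesis using c a(1) by blast
    qed simp
    then have "br x y = 0" by (subst co_total[of y]) (simp add: br_sumr)
    then show "y \<in> {y. br x y = 0}" by simp
  qed (auto simp: br_addr br_scr)
  then show False using central_zero[of x] x by blast
qed

text \<open>The bracket of \<open>e\<close> with its sl2 partner lies in the ideal and acts on
  \<open>L \<beta>\<close> by a nonzero scalar.\<close>

lemma ideal_L:
  assumes add: "\<And>x y. x \<in> I \<Longrightarrow> y \<in> I \<Longrightarrow> x + y \<in> I" and sc: "\<And>a x. x \<in> I \<Longrightarrow> sc a x \<in> I"
    and br: "\<And>x y. x \<in> I \<Longrightarrow> br y x \<in> I"
    and e: "\<alpha> \<in> D" "e \<in> g (\<alpha>, l)" "e \<noteq> 0" "e \<in> I" and \<beta>: "\<beta> \<in> \<Delta>" "R.cr \<alpha> \<beta> \<noteq> 0"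
  shows "L \<beta> \<subseteq> I"
proof
  fix x assume x: "x \<in> L \<beta>"
  obtain f where f: "sl2 \<alpha> l e f" using LT2(2)[OF e(1-3)] by blast
  have "br (br e f) x = br x (br f e)"
    using br_anti[of x "br e f"] br_anti[of f e] by (simp add: br_negr br_negl)
  then have "sc (of_int (pair \<alpha> \<beta>)) x \<in> I" using sl2_act[OF f x] br e(4) by simp
  from sc[OF this, of "1 / of_int (pair \<alpha> \<beta>)"] show "x \<in> I"
    using cr_pair[OF e(1) \<beta>(1)] \<beta>(2) by simp
qed

text \<open>A nonzero graded ideal contains a homogeneous vector. If its root degree is 0, a
  noncommuting root vector moves it to a nonzero root. Irreducibility then captures all root spaces,
  and (LT3) the whole algebra.\<close>

sublocale graded_simple_lie sc br g S \<rho>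
proof (unfold_locales)
  show "fgc sc br" by (rule is_fgc)
  obtain \<alpha> where a: "\<alpha> \<in> D" using R.nonempty by blast
  then obtain l e where "e \<in> g (\<alpha>, l)" "e \<noteq> 0" using g_exists[of \<alpha>] by auto
  then show "\<exists>p e. e \<noteq> 0 \<and> g p = range (\<lambda>a. sc a e)" using LT2(1)[OF a] by metis
  fix I assume I: "0 \<in> I" "\<And>x y. x \<in> I \<Longrightarrow> y \<in> I \<Longrightarrow> x + y \<in> I" "\<And>a x. x \<in> I \<Longrightarrow> sc a x \<in> I"
      "\<And>x y. x \<in> I \<Longrightarrow> br y x \<in> I" "\<And>x p. x \<in> I \<Longrightarrow> co x p \<in> I"
  show "I = {0} \<or> I = UNIV"
  proof (rule disjCI)
    assume "I \<noteq> UNIV"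
    have gen: False if e: "\<alpha> \<in> D" "e \<in> g (\<alpha>, l)" "e \<noteq> 0" "e \<in> I" for \<alpha> l e
    proof -
      have "L \<beta> \<subseteq> I" if "\<beta> \<in> D" for \<beta>
      proof (rule R.irreducible_induct[OF e(1), where P = "\<lambda>\<gamma>. L \<gamma> \<subseteq> I"])
        show "L \<alpha> \<subseteq> I" by (rule ideal_L[OF I(2-4) e]) (use e(1) R.coroot_self in auto)
        fix \<gamma> \<delta> assume g: "\<gamma> \<in> D" "L \<gamma> \<subseteq> I" "\<delta> \<in> D" "R.cr \<gamma> \<delta> \<noteq> 0"
        obtain m d where d: "d \<in> g (\<gamma>, m)" "d \<noteq> 0" using g_exists[of \<gamma>] g(1) by auto
        then have "d \<in> I" using g_L[OF d(1)] g(2) by auto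
        then show "L \<delta> \<subseteq> I" by (intro ideal_L[OF I(2-4) g(1) d]) (use g in auto)
      qed (rule that)
      then have "I = UNIV" by (intro LT3) (use I in auto)
      then show False using \<open>I \<noteq> UNIV\<close> by simp
    qed
    have "x = 0" if "x \<in> I" for x
    proof (rule ccontr)
      assume "x \<noteq> 0"
      then obtain p where p: "co x p \<noteq> 0" using co_nonzero by blast
      define z where "z = co x p"
      have z: "z \<in> I" "z \<noteq> 0" "z \<in> g (fst p, snd p)" "fst p \<in> \<Delta>"
        using p I(5)[OF that] co_in[of x p] g_\<Delta>[OF co_in] by (auto simp: z_def)
      show False
      proof (cases "fst p = 0")
        case False then show False using gen[OF _ z(3,2,1)] z(4) by simp
      next
        case True
        obtain \<alpha> l e where e: "\<alpha> \<in> D" "e \<in> g (\<alpha>, l)" "br z e \<noteq> 0" using exists_noncommuting[OF z(2)] by blast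
        have "br z e \<in> g (\<alpha>, snd p + l)" using g_br[OF z(3) e(2)] True by simp
        moreover have "br z e \<in> I" using I(4)[OF z(1), of "- e"] br_anti[of z e] by (simp add: br_negl)
        ultimately show False using gen[OF e(1) _ e(3)] by blast
      qed
    qed
    then show "I = {0}" using I(1) by blast
  qed
qed

text \<open>All iterates on \<open>e0\<close> are nonzero, so a nonzero root component of the degree
  would produce infinitely many roots.\<close>

lemma Ch_fst: "c \<in> Ch \<gamma> \<Longrightarrow> c \<noteq> (\<lambda>_. 0) \<Longrightarrow> fst \<gamma> = 0"
proof -
  assume c: "c \<in> Ch \<gamma>" "c \<noteq> (\<lambda>_. 0)"
  have "(c ^^ j) e0 \<in> L (fst p0 + of_nat j *\<^sub>R fst \<gamma>) \<and> (c ^^ j) e0 \<noteq> 0 \<and> (c ^^ j) e0 \<in> hom" for j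
  proof (induction j)
    case 0 then show ?case using e0(1) e0(3) g_L[OF e0(3)] unfolding hom_def by (simp del: split_paired_Ex) blast
  next
    case (Suc j)
    then obtain p where p: "(c ^^ j) e0 \<in> g p" by (auto simp: hom_def)
    have "co ((c ^^ j) e0) p \<noteq> 0" using Suc co_hom[OF p, of p] by simp
    then have "fst p = fst p0 + of_nat j *\<^sub>R fst \<gamma>" using Suc unfolding L_iff by blast
    moreover have cg: "c ((c ^^ j) e0) \<in> g (p + \<gamma>)" using Ch_g[OF c(1) p] .
    moreover have "c ((c ^^ j) e0) \<in> hom" using cg by (auto simp: hom_def simp del: split_paired_Ex)
    ultimately show ?case using g_L[OF cg] Suc Ch_ker[OF c] by (auto simp: algebra_simps)
  qed
  then have "fst p0 + of_nat j *\<^sub>R fst \<gamma> \<in> \<Delta>" for j using L_\<Delta> by blast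
  then show ?thesis by (rule finite_shift_zero[OF fin_\<Delta>])
qed

lemma hc_fst: "c \<in> Cc \<Longrightarrow> hc c \<gamma> x \<noteq> 0 \<Longrightarrow> fst \<gamma> = 0"
  by (rule Ch_fst[OF hc_Ch]) auto

lemma co_C_supp:
  assumes "c \<in> Cc" "co (c x) r \<noteq> 0"
  obtains q \<gamma> where "co x q \<noteq> 0" "r = q + \<gamma>" "fst \<gamma> = 0" "\<gamma> \<in> G c" "hc c \<gamma> \<noteq> (\<lambda>_. 0)"
proof -
  have "\<exists>\<gamma>\<in>G c. hc c \<gamma> (co x (r - \<gamma>)) \<noteq> 0"
  proof (rule ccontr)
    assume n: "\<not> ?thesis"
    have "co (c x) r = 0" unfolding co_C[OF assms(1)] by (rule sum.neutral) (use n in blast)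
    then show False using assms(2) by simp
  qed
  then obtain \<gamma> where g: "\<gamma> \<in> G c" "hc c \<gamma> (co x (r - \<gamma>)) \<noteq> 0" by blast
  have "co x (r - \<gamma>) \<noteq> 0" using g(2) Cc_0[OF Ch_Cc[OF hc_Ch[OF assms(1)]], of \<gamma>] by auto
  then show thesis
    by (rule that) (use hc_fst[OF assms(1) g(2)] g(1) in \<open>simp_all add: G_def\<close>)
qed

lemma gmod_graded_part:
  assumes "\<And>p q. P p \<Longrightarrow> (\<exists>c\<in>Ch q. c \<noteq> (\<lambda>_. 0)) \<Longrightarrow> P (p + q)"
  shows "gmod {x. \<forall>p. co x p \<noteq> 0 \<longrightarrow> P p}"
  unfolding gmod_def C.cmod_def
proof (intro conjI ballI allI)
  fix x assume x: "x \<in> {x. \<forall>p. co x p \<noteq> 0 \<longrightarrow> P p}"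
  show "x + y \<in> {x. \<forall>p. co x p \<noteq> 0 \<longrightarrow> P p}" if "y \<in> {x. \<forall>p. co x p \<noteq> 0 \<longrightarrow> P p}" for y
    using x that unfolding mem_Collect_eq co_add by (metis add_0)
  show "co x p \<in> {x. \<forall>p. co x p \<noteq> 0 \<longrightarrow> P p}" for p using x by (auto simp: co_hom[OF co_in])
next
  fix c x assume c: "c \<in> Cc" and x: "x \<in> {x. \<forall>p. co x p \<noteq> 0 \<longrightarrow> P p}"
  have "P r" if r: "co (c x) r \<noteq> 0" for r
  proof -
    obtain q \<gamma> where q: "co x q \<noteq> 0" "r = q + \<gamma>" "hc c \<gamma> \<noteq> (\<lambda>_. 0)"
      using co_C_supp[OF c r] by blast
    have "P q" using x q(1) by blast
    then show ?thesis unfolding q(2) by (rule assms) (use hc_Ch[OF c] q(3) in blast)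
  qed
  then show "c x \<in> {x. \<forall>p. co x p \<noteq> 0 \<longrightarrow> P p}" by simp
qed simp

lemma gmod_L: "gmod (L \<alpha>)"
proof -
  have "L \<alpha> = {x. \<forall>p. co x p \<noteq> 0 \<longrightarrow> fst p = \<alpha>}" using L_iff by blast
  then show ?thesis using gmod_graded_part[of "\<lambda>p. fst p = \<alpha>"] Ch_fst by fastforce
qed

text \<open>A power of a root vector maps \<open>L \<beta>\<close> injectively and linearly over the
  centroid into the reflected root space. For a positive pairing the root - \<alpha> is used in
  place of \<alpha>.\<close>

lemma rk_s_le:
  assumes "\<alpha> \<in> D" "\<beta> \<in> D"
  shows "rk (L \<beta>) \<le> rk (L (R.s \<alpha> \<beta>))"
proof -
  have main: "rk (L \<beta>) \<le> rk (L (\<beta> - of_int (pair \<alpha> \<beta>) *\<^sub>R \<alpha>))" if a: "\<alpha> \<in> D" "pair \<alpha> \<beta> \<le> 0" for \<alpha>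
  proof -
    define m where "m = nat (- pair \<alpha> \<beta>)"
    have m: "pair \<alpha> \<beta> = - int m" using a by (simp add: m_def)
    obtain l e where e: "e \<in> g (\<alpha>, l)" "e \<noteq> 0" using g_exists[of \<alpha>] a by auto
    obtain f where f: "sl2 \<alpha> l e f" using LT2(2)[OF a(1) e] by blast
    obtain B where B: "B \<subseteq> hom" "B \<subseteq> L \<beta>" "cbasis Cc (L \<beta>) B" "C.cind B" "finite B" "rk (L \<beta>) = card B"
      using ex_hom_basis[OF gmod_L[of \<beta>]] by metis
    let ?T = "br e ^^ m"
    have "C.cfree B ?T"
    proof (rule C.cfree_map[OF B(4,2)])
      show "C.cmod (L \<beta>)" using gmod_L by (simp add: gmod_def)
      show "?T (x + y) = ?T x + ?T y" for x y by (induction m) (auto simp: br_addr)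
      show "?T (c x) = c (?T x)" if "c \<in> Cc" for c x by (induction m) (auto simp: Cc_brr[OF that])
      show "x = 0" if "x \<in> L \<beta>" "?T x = 0" for x by (rule epow_injective[OF a(1) f that(1) m that(2)])
    qed
    from C.cfree_imp_cind[OF this] have "inj_on ?T B" "C.cind (?T ` B)" .
    moreover have "?T ` B \<subseteq> L (\<beta> + of_nat m *\<^sub>R \<alpha>)" using L_bpow[OF sl2_L(1)[OF f]] B(2) by auto
    ultimately have "card B \<le> rk (L (\<beta> + of_nat m *\<^sub>R \<alpha>))"
      using card_le_rk[OF gmod_L, of "?T ` B"] by (simp add: card_image)
    then show ?thesis using B(6) m by simp
  qed
  have b: "\<beta> \<in> \<Delta>" using assms by simp
  have e: "R.s \<alpha> \<beta> = \<beta> - of_int (pair \<alpha> \<beta>) *\<^sub>R \<alpha>" using cr_pair[OF assms(1) b] by (simp add: R.s_def)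
  show ?thesis
  proof (cases "pair \<alpha> \<beta> \<le> 0")
    case True then show ?thesis using main[OF assms(1)] e by simp
  next
    case False then show ?thesis using main[OF neg_D[OF assms(1)]] pair_neg[OF assms(1) b] e by simp
  qed
qed

lemma rk_s: "\<alpha> \<in> D \<Longrightarrow> \<beta> \<in> D \<Longrightarrow> rk (L (R.s \<alpha> \<beta>)) = rk (L \<beta>)"
  using rk_s_le[of \<alpha> \<beta>] rk_s_le[of \<alpha> "R.s \<alpha> \<beta>"] R.s_in[of \<alpha> \<beta>] R.s_invol[of \<alpha> \<beta>] by simp

lemma rk_neg: "\<alpha> \<in> \<Delta> \<Longrightarrow> rk (L (- \<alpha>)) = rk (L \<alpha>)"
  using rk_s[of \<alpha> \<alpha>] R.s_self[of \<alpha>] by (cases "\<alpha> = 0") auto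

subsection \<open>The degree zero part\<close>

text \<open>The part of degree l of the space spanned by brackets of opposite root spaces. By
  \<open>g_zero_J\<close> this exhausts the homogeneous space of root degree 0.\<close>

definition J :: "(nat \<Rightarrow> int) \<Rightarrow> 'a set" where
  "J l = span {br x y | x y \<alpha> m. \<alpha> \<in> D \<and> x \<in> g (\<alpha>, m) \<and> y \<in> g (- \<alpha>, l - m)}"

lemma J_0: "0 \<in> J l" and J_add: "x \<in> J l \<Longrightarrow> y \<in> J l \<Longrightarrow> x + y \<in> J l" and J_sc: "x \<in> J l \<Longrightarrow> sc a x \<in> J l"
  by (simp_all add: J_def span_zero span_add span_scale)

lemma J_base: "\<alpha> \<in> D \<Longrightarrow> x \<in> g (\<alpha>, m) \<Longrightarrow> y \<in> g (- \<alpha>, k) \<Longrightarrow> br x y \<in> J (m + k)"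
  unfolding J_def by (intro span_base CollectI exI[of _ x] exI[of _ y] exI[of _ \<alpha>] exI[of _ m]) simp

lemma J_sum: "(\<And>i. i \<in> A \<Longrightarrow> f i \<in> J l) \<Longrightarrow> sum f A \<in> J l"
  by (simp add: J_def span_sum)

lemma J_br: "z \<in> J l \<Longrightarrow> w \<in> g (0, k) \<Longrightarrow> br w z \<in> J (k + l)"
  unfolding J_def[of l]
proof (induction z rule: span_induct_alt)
  case (step c z y)
  then obtain x u \<alpha> m where z: "z = br x u" "\<alpha> \<in> D" "x \<in> g (\<alpha>, m)" "u \<in> g (- \<alpha>, l - m)" by blast
  have "br w (br x u) = br (br w x) u + br x (br w u)" using br_br[of w x u] by simp
  moreover have "br (br w x) u \<in> J ((k + m) + (l - m))" "br x (br w u) \<in> J (m + (k + (l - m)))"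
    using J_base[OF z(2) _ z(4), of "br w x" "k + m"] J_base[OF z(2,3), of "br w u" "k + (l - m)"]
      g_br[OF step.prems z(3)] g_br[OF step.prems z(4)] by (simp_all only: add_Pair add_0)
  ultimately have "br w z \<in> J (k + l)" using z(1) J_add by (simp add: algebra_simps)
  moreover have "br w y \<in> J (k + l)" using step by blast
  ultimately show ?case unfolding br_addr br_scr by (intro J_add J_sc)
qed (simp add: J_0)

text \<open>The elements whose components of root degree 0 all lie in the spaces \<open>J l\<close>
  form a subalgebra containing every other root space, so (LT3) applies.\<close>

lemma g_zero_J: "x \<in> g (0, l) \<Longrightarrow> x \<in> J l"
proof -
  have "{x. \<forall>l. co x (0, l) \<in> J l} = UNIV"
  proof (rule LT3)
    fix x y assume x: "x \<in> {x. \<forall>l. co x (0, l) \<in> J l}" and y: "y \<in> {x. \<forall>l. co x (0, l) \<in> J l}"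
    then show "x + y \<in> {x. \<forall>l. co x (0, l) \<in> J l}" by (simp add: co_add J_add)
    have "br (co x p) (co y ((0, l) - p)) \<in> J l" for l p
    proof (cases "co x p = 0")
      case False
      obtain \<alpha> m where p: "p = (\<alpha>, m)" by (cases p)
      have xm: "co x p \<in> g (\<alpha>, m)" using co_in[of x p] p by simp
      have ym: "co y ((0, l) - p) \<in> g (- \<alpha>, l - m)" using co_in[of y "(0, l) - p"] p by simp
      show ?thesis
      proof (cases "\<alpha> = 0")
        case True
        then have "co y ((0, l) - p) \<in> J (l - m)" using y p by simp
        then show ?thesis using J_br[of _ "l - m" "co x p" m] xm True by simp
      next
        case f: False
        then have "\<alpha> \<in> D" using g_\<Delta>[OF xm False] by simp
        then show ?thesis using J_base[OF _ xm ym] by simp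
      qed
    qed (simp add: J_0)
    then show "br x y \<in> {x. \<forall>l. co x (0, l) \<in> J l}" by (simp add: co_br J_sum)
  next
    fix \<alpha> x assume a: "\<alpha> \<in> D" "x \<in> L \<alpha>"
    have "co x (0, l) = 0" for l using a unfolding L_iff by fastforce
    then show "x \<in> {x. \<forall>l. co x (0, l) \<in> J l}" by (simp add: J_0)
  qed (simp_all add: J_0 co_sc J_sc)
  then have "co x (0, l) \<in> J l" by blast
  then show "x \<in> g (0, l) \<Longrightarrow> x \<in> J l" by (simp add: co_hom)
qed

text \<open>In lattice degree 0 the spanning brackets have factors of exactly opposite degrees,
  hence are multiples of the semisimple elements of sl2-triples. For other lattice degrees no such
  scalar action is claimed.\<close>

lemma g_zero_scalar:
  assumes "z \<in> g (0, 0)" "\<beta> \<in> \<Delta>"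
  shows "\<exists>s. \<forall>v\<in>L \<beta>. br z v = sc s v"
proof -
  have "z \<in> J 0" by (rule g_zero_J[OF assms(1)])
  then show ?thesis unfolding J_def
  proof (induction z rule: span_induct_alt)
    case base show ?case by (intro exI[of _ 0]) simp
  next
    case (step c z y)
    then obtain x u \<alpha> m where z: "z = br x u" "\<alpha> \<in> D" "x \<in> g (\<alpha>, m)" "u \<in> g (- \<alpha>, - m)" by auto
    have "\<exists>s. \<forall>v\<in>L \<beta>. br z v = sc s v"
    proof (cases "x = 0 \<or> u = 0")
      case True then show ?thesis using z(1) by (intro exI[of _ 0]) auto
    next
      case False
      obtain f where f: "sl2 \<alpha> m x f" using LT2(2)[OF z(2,3)] False by blast
      then obtain a where a: "f = sc a u" using LT2(1)[OF neg_D[OF z(2)] z(4)] False by (auto simp: sl2_def)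
      have "f \<noteq> 0" using sl2_neg[OF z(2) f] by (simp add: sl2_def)
      then have "a \<noteq> 0" using a by auto
      then have "u = sc (1 / a) f" using a by simp
      then have "br z v = sc (1 / a * of_int (pair \<alpha> \<beta>)) v" if "v \<in> L \<beta>" for v
        using sl2_act[OF f that] z(1) by (simp add: br_scl br_scr)
      then show ?thesis by blast
    qed
    then obtain s t where "\<forall>v\<in>L \<beta>. br z v = sc s v" "\<forall>v\<in>L \<beta>. br y v = sc t v" using step.IH by blast
    then have "\<forall>v\<in>L \<beta>. br (sc c z + y) v = sc (c * s + t) v" by (simp add: br_addl br_scl scale_left_distrib)
    then show ?case by blast
  qed
qed

text \<open>The lattice degrees of \<open>e\<close> and \<open>e'\<close> may differ, so
  \<open>br e f\<close> need not come from a triple. Nonvanishing rests on weights: f acts on e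
  twice without killing it, and if e' killed y = [f, e], then, y having weight 0, it would also kill
  [f, y], which has negative weight.\<close>

lemma opposite_bracket:
  assumes "\<alpha> \<in> D" "sl2 \<alpha> l e' f" "e \<in> g (\<alpha>, m)" "e \<noteq> 0"
  obtains c where "br (br e f) e' = sc c e" "c \<noteq> 0"
proof -
  have eL: "e \<in> L \<alpha>" using g_L[OF assms(3)] by simp
  have e'g: "e' \<in> g (\<alpha>, l)" and fg: "f \<in> g (- \<alpha>, - l)" using assms(2) by (auto simp: sl2_def)
  note fs = sl2_neg[OF assms(1,2)]
  have p2: "pair (- \<alpha>) \<alpha> = - int 2" using pair_neg[OF assms(1)] pair_self[OF assms(1)] assms(1) by simp
  have ffe: "br f (br f e) \<noteq> 0"
    using epow_injective[OF neg_D[OF assms(1)] fs eL p2] assms(4) by (auto simp: numeral_2_eq_2)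
  define y where "y = br f e"
  have yL: "y \<in> L 0" using L_br[OF sl2_L(2)[OF assms(2)] eL] by (simp add: y_def)
  have "br e' y \<noteq> 0"
  proof
    assume 0: "br e' y = 0"
    have "pair \<alpha> 0 = 0" using cr_pair[OF assms(1) zero_\<Delta>] linear_0[OF R.coroot_linear[OF assms(1)]] by simp
    then have "br (br e' f) y = 0" using sl2_act[OF assms(2) yL] by simp
    then have "br e' (br f y) = 0" using br_br[of e' f y] 0 by simp
    moreover have "br f y \<in> L (- \<alpha>)" using L_br[OF sl2_L(2)[OF assms(2)] yL] by simp
    moreover have "pair \<alpha> (- \<alpha>) < 0" using pair_negr[OF assms(1,1)] pair_self[OF assms(1)] by simp
    ultimately have "br f y = 0" using e_injective[OF assms(1,2)] by blast
    then show False using ffe by (simp add: y_def)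
  qed
  moreover have "br e' y \<in> g (\<alpha>, m)"
    using g_br[OF e'g g_br[OF fg assms(3)]] by (simp add: y_def)
  moreover have "br (br e f) e' = br e' y"
    using br_anti[of e' "br e f"] br_anti[of f e] by (simp add: y_def br_negr)
  ultimately show thesis using that LT2(1)[OF assms(1,3,4)] by (metis imageE scale_zero_left)
qed

lemma br_opposite_nonzero:
  assumes "\<alpha> \<in> D" "e \<in> g (\<alpha>, l)" "e \<noteq> 0" "f \<in> g (- \<alpha>, m)" "f \<noteq> 0"
  shows "br e f \<noteq> 0"
  by (rule br_nonzero[OF assms(1-3) _ assms(5)])
    (use g_L[OF assms(4)] pair_negr[OF assms(1,1)] pair_self[OF assms(1)] in auto)

text \<open>Choose y of opposite degree taking \<open>e' = br x e\<close> back to a nonzero multiple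
  of \<open>e\<close>. The bracket [x, y] acts on \<open>L \<alpha>\<close> by a scalar s, so x and
  y either commute there or satisfy a Heisenberg relation, and both cases contradict
  nilpotency.\<close>

lemma degree_zero_not_nilpotent:
  assumes x: "x \<in> g (0, l)" "x \<noteq> 0"
  shows "\<exists>z. (br x ^^ K) z \<noteq> 0"
proof (rule ccontr)
  assume "\<not> ?thesis"
  then have nil: "(br x ^^ K) z = 0" for z by blast
  have nil': "(br x ^^ (K + i)) z = 0" for z i using nil[of "(br x ^^ i) z"] by (simp add: funpow_add)
  obtain \<alpha> m e where e: "\<alpha> \<in> D" "e \<in> g (\<alpha>, m)" "br x e \<noteq> 0" using exists_noncommuting[OF x(2)] by blast
  define e' where "e' = br x e"
  have e': "e' \<in> g (\<alpha>, l + m)" using g_br[OF x(1) e(2)] by (simp add: e'_def)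
  obtain f where f: "sl2 \<alpha> (l + m) e' f" using LT2(2)[OF e(1) e'] e(3) by (auto simp: e'_def)
  have e0: "e \<noteq> 0" using e(3) by auto
  define y where "y = br e f"
  obtain c where c: "br y e' = sc c e" "c \<noteq> 0"
    using opposite_bracket[OF e(1) f e(2) e0] unfolding y_def by blast
  have y: "y \<in> g (0, - l)" using g_br[OF e(2), of f "(- \<alpha>, - (l + m))"] f by (simp add: y_def sl2_def)
  have "br x y \<in> g (0, 0)" using g_br[OF x(1) y] by (simp add: zero_prod_def)
  then obtain s where s: "\<And>v. v \<in> L \<alpha> \<Longrightarrow> br (br x y) v = sc s v" using g_zero_scalar e(1) by blast
  have comm: "br x (br y v) = br y (br x v) + sc s v" if "v \<in> L \<alpha>" for v
    using br_br[of x y v] s[OF that] by (simp add: algebra_simps)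
  have Lx: "br x v \<in> L \<alpha>" "br y v \<in> L \<alpha>" if "v \<in> L \<alpha>" for v
    using L_br[of x 0 v \<alpha>] L_br[of y 0 v \<alpha>] g_L[OF x(1)] g_L[OF y] that by auto
  have eL: "e \<in> L \<alpha>" using g_L[OF e(2)] by simp
  have Ly: "(br y ^^ i) v \<in> L \<alpha>" if "v \<in> L \<alpha>" for v i by (induction i) (auto simp: Lx that)
  show False
  proof (cases "s = 0")
    \<comment> \<open>Commuting case: y x scales \<open>e\<close> by \<open>c\<close>, so applying x
      and then y the same number of times gives a nonzero multiple of \<open>e\<close>.\<close>
    case True
    have xy: "br x ((br y ^^ i) v) = (br y ^^ i) (br x v)" if "v \<in> L \<alpha>" for i v
      by (induction i) (use comm[OF Ly[OF that]] True in auto)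
    have "sc (c ^ i) e = (br y ^^ i) ((br x ^^ i) e)" for i
    proof (induction i)
      case (Suc i)
      have xL: "(br x ^^ j) e \<in> L \<alpha>" for j by (induction j) (auto simp: Lx eL)
      have "(br y ^^ Suc i) ((br x ^^ Suc i) e) = br y ((br y ^^ i) (br x ((br x ^^ i) e)))" by simp
      also have "\<dots> = br y (br x ((br y ^^ i) ((br x ^^ i) e)))" by (simp add: xy[OF xL])
      also have "\<dots> = br y (br x (sc (c ^ i) e))" using Suc by simp
      also have "\<dots> = sc (c ^ Suc i) e" using c(1) by (simp add: br_scr e'_def mult.commute)
      finally show ?case by simp
    qed simp
    from this[of K] nil have "sc (c ^ K) e = 0" by simp
    then show False using c(2) e0 by simp
  next
    case False
    \<comment> \<open>Heisenberg case: \<open>v\<close> is the last nonzero iterate of x on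
      \<open>e\<close>. Applying y and then x each i times multiplies \<open>v\<close> by i! times
      the i-th power of s, which is nonzero in characteristic 0.\<close>
    define j where "j = (LEAST j. (br x ^^ Suc j) e = 0)"
    have ex: "\<exists>j. (br x ^^ Suc j) e = 0" using nil'[of 1 e] by auto
    define v where "v = (br x ^^ j) e"
    have xv: "br x v = 0" using LeastI_ex[OF ex] by (simp add: v_def j_def)
    have v0: "v \<noteq> 0"
    proof (cases j)
      case 0 then show ?thesis using e0 by (simp add: v_def)
    next
      case (Suc i)
      then have "i < (LEAST j. (br x ^^ Suc j) e = 0)" by (simp add: j_def[symmetric] del: funpow.simps)
      then show ?thesis using not_less_Least[of i "\<lambda>j. (br x ^^ Suc j) e = 0"] Suc unfolding v_def by blast
    qed
    have vL: "v \<in> L \<alpha>" unfolding v_def by (induction j) (auto simp: Lx eL)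
    have step: "br x ((br y ^^ Suc i) v) = sc (of_nat (Suc i) * s) ((br y ^^ i) v)" for i
    proof (induction i)
      case 0 then show ?case using comm[OF vL] xv by simp
    next
      case (Suc i)
      have "br x ((br y ^^ Suc (Suc i)) v) = br y (br x ((br y ^^ Suc i) v)) + sc s ((br y ^^ Suc i) v)"
        using comm[OF Ly[OF vL, of "Suc i"]] by simp
      also have "\<dots> = sc (of_nat (Suc i) * s + s) ((br y ^^ Suc i) v)"
        unfolding Suc by (simp add: br_scr scale_left_distrib)
      finally show ?case by (simp add: algebra_simps)
    qed
    have "\<exists>a. a \<noteq> 0 \<and> (br x ^^ i) ((br y ^^ i) v) = sc a v" for i
    proof (induction i)
      case 0 then show ?case by (intro exI[of _ 1]) simp
    next
      case (Suc i)
      then obtain a where a: "a \<noteq> 0" "(br x ^^ i) ((br y ^^ i) v) = sc a v" by blast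
      have sc: "(br x ^^ i) (sc b z) = sc b ((br x ^^ i) z)" for b z by (induction i) (auto simp: br_scr)
      have "(br x ^^ Suc i) ((br y ^^ Suc i) v) = (br x ^^ i) (br x ((br y ^^ Suc i) v))" by (simp add: funpow_swap1)
      also have "\<dots> = sc (of_nat (Suc i) * s * a) v" unfolding step sc a(2) by simp
      finally show ?case using a(1) False by (intro exI[of _ "of_nat (Suc i) * s * a"]) (simp del: of_nat_Suc)
    qed
    from this[of K] nil v0 show False by auto
  qed
qed

subsection \<open>Degrees of the centroid\<close>

text \<open>The lattice degrees of the centroid. Nonzero homogeneous elements are units, so this is
  a group, not merely a monoid.\<close>

definition \<Gamma> :: "(nat \<Rightarrow> int) set" where "\<Gamma> = {l. \<exists>c\<in>Ch (0, l). c \<noteq> (\<lambda>_. 0)}"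

lemma Ch_neg_nonzero: "c \<in> Ch \<gamma> \<Longrightarrow> c \<noteq> (\<lambda>_. 0) \<Longrightarrow> \<exists>d\<in>Ch (- \<gamma>). d \<noteq> (\<lambda>_. 0)"
  using Ch_inverse[of c \<gamma>] e0(1) by metis

lemma Ch_add_nonzero:
  assumes "c \<in> Ch \<gamma>" "c \<noteq> (\<lambda>_. 0)" "d \<in> Ch \<delta>" "d \<noteq> (\<lambda>_. 0)"
  shows "\<exists>u\<in>Ch (\<gamma> + \<delta>). u \<noteq> (\<lambda>_. 0)"
  using Ch_comp[OF assms(1,3)] C.C_domain[OF Ch_Cc[OF assms(1)] Ch_Cc[OF assms(3)]] assms(2,4) by blast

lemma \<Gamma>_neg: "l \<in> \<Gamma> \<Longrightarrow> - l \<in> \<Gamma>" unfolding \<Gamma>_def using Ch_neg_nonzero by fastforce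
lemma \<Gamma>_add: "l \<in> \<Gamma> \<Longrightarrow> m \<in> \<Gamma> \<Longrightarrow> l + m \<in> \<Gamma>" unfolding \<Gamma>_def using Ch_add_nonzero by fastforce
lemma \<Gamma>_lat: "l \<in> \<Gamma> \<Longrightarrow> l \<in> lat n" unfolding \<Gamma>_def using Ch_S by (fastforce simp: S_def)
lemma \<Gamma>_0: "0 \<in> \<Gamma>" unfolding \<Gamma>_def using Ch_scale[of 1] C.one_nonzero
  by (intro CollectI bexI[of _ "sc 1"]) (auto simp: zero_prod_def fun_eq_iff)

text \<open>Modulo \<Gamma>, every degree of a nonzero homogeneous vector is that of an element of a
  finite homogeneous basis. Enough nonzero iterates of \<open>br x\<close> must repeat a class, and
  the difference of two of them is a multiple of \<open>l\<close>.\<close>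

lemma torsion_mod_\<Gamma>:
  assumes x: "x \<in> g (0, l)" "x \<noteq> 0"
  shows "\<exists>m>0. (\<lambda>i. int m * l i) \<in> \<Gamma>"
proof -
  obtain B where B: "B \<subseteq> hom" "finite B" "UNIV = C.cspan B" using ex_hom_basis[OF gmod_UNIV] by metis
  have "\<forall>b\<in>B. \<exists>q. b \<in> g q" using B(1) unfolding hom_def by blast
  then obtain dg where dg: "\<And>b. b \<in> B \<Longrightarrow> b \<in> g (dg b)" by metis
  have supp: "\<exists>b\<in>B. \<exists>k\<in>\<Gamma>. p = dg b + (0, k)" if p: "w \<in> g p" "w \<noteq> 0" for w p
  proof -
    obtain c where c: "\<forall>b\<in>B. c b \<in> Cc" "w = (\<Sum>b\<in>B. c b b)" using B(3) by (auto simp: C.cspan_def)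
    have "co w p \<noteq> 0" using p by (simp add: co_hom)
    then have "\<exists>b\<in>B. co (c b b) p \<noteq> 0" unfolding c(2) co_setsum by (meson sum.neutral)
    then obtain b where b: "b \<in> B" "co (c b b) p \<noteq> 0" by blast
    obtain q \<gamma> where q: "co b q \<noteq> 0" "p = q + \<gamma>" "fst \<gamma> = 0" "hc (c b) \<gamma> \<noteq> (\<lambda>_. 0)"
      using co_C_supp[OF bspec[OF c(1) b(1)] b(2)] by blast
    have "q = dg b" using q(1) co_hom[OF dg[OF b(1)], of q] by (auto split: if_splits)
    moreover have "(0, snd \<gamma>) = \<gamma>" by (rule prod_eqI) (simp_all add: q(3))
    then have "hc (c b) \<gamma> \<in> Ch (0, snd \<gamma>)" using hc_Ch[OF bspec[OF c(1) b(1)], of \<gamma>] by (simp only:)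
    then have "snd \<gamma> \<in> \<Gamma>" unfolding \<Gamma>_def using q(4) by blast
    moreover have "p = q + (0, snd \<gamma>)" unfolding q(2) by (rule prod_eqI) (simp_all add: q(3))
    ultimately show ?thesis using b(1) by blast
  qed
  \<comment> \<open>The iterates 0 to K are one more than the basis elements, which is what the
    pigeonhole argument needs.\<close>
  define K where "K = card B"
  obtain z0 where "(br x ^^ K) z0 \<noteq> 0" using degree_zero_not_nilpotent[OF x] by blast
  moreover have lin: "(br x ^^ K) (a + b) = (br x ^^ K) a + (br x ^^ K) b" for a b
    by (induction K) (auto simp: br_addr)
  ultimately have "\<not> (\<forall>p. \<forall>z\<in>g p. (br x ^^ K) z = 0)"
    using hom_induct[of "\<lambda>z. (br x ^^ K) z = 0" z0] by auto
  then obtain p z where z: "z \<in> g p" "(br x ^^ K) z \<noteq> 0" by blast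
  have nz: "(br x ^^ i) z \<noteq> 0" if "i \<le> K" for i
  proof
    assume "(br x ^^ i) z = 0"
    then have "(br x ^^ (K - i)) ((br x ^^ i) z) = 0" by simp
    moreover have "(br x ^^ K) z = (br x ^^ (K - i)) ((br x ^^ i) z)"
      using funpow_add[of "K - i" i "br x"] that by simp
    ultimately show False using z(2) by simp
  qed
  have deg: "(br x ^^ i) z \<in> g (p + (0, (\<lambda>k. int i * l k)))" for i
  proof (induction i)
    case 0
    have "p + (0, (\<lambda>k. int 0 * l k)) = p" by (rule prod_eqI) (simp_all add: fun_eq_iff)
    then show ?case using z(1) by simp
  next
    case (Suc i)
    have e: "(0, l) + (p + (0, (\<lambda>k. int i * l k))) = p + (0, (\<lambda>k. int (Suc i) * l k))"
      by (simp add: prod_eq_iff fun_eq_iff algebra_simps)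
    show ?case using g_br[OF x(1) Suc] unfolding e by simp
  qed
  have "\<forall>i\<in>{..K}. \<exists>b. b \<in> B \<and> (\<exists>k\<in>\<Gamma>. p + (0, (\<lambda>k. int i * l k)) = dg b + (0, k))"
    using supp[OF deg nz] by blast
  then obtain bb where bb: "\<And>i. i \<le> K \<Longrightarrow> bb i \<in> B"
      "\<And>i. i \<le> K \<Longrightarrow> \<exists>k\<in>\<Gamma>. p + (0, (\<lambda>k. int i * l k)) = dg (bb i) + (0, k)"
    by (metis atMost_iff)
  have "\<not> inj_on bb {..K}"
    using card_inj_on_le[of bb "{..K}" B] bb(1) B(2) by (auto simp: K_def)
  then obtain i j where ij: "i < j" "j \<le> K" "bb i = bb j"
    unfolding inj_on_def by (metis atMost_iff linorder_neqE_nat)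
  obtain k1 k2 where k: "k1 \<in> \<Gamma>" "p + (0, (\<lambda>k. int i * l k)) = dg (bb i) + (0, k1)"
      "k2 \<in> \<Gamma>" "p + (0, (\<lambda>k. int j * l k)) = dg (bb i) + (0, k2)"
    using bb(2)[of i] bb(2)[of j] ij by auto
  have "(0, (\<lambda>k. int (j - i) * l k)) = (p + (0, (\<lambda>k. int j * l k))) - (p + (0, (\<lambda>k. int i * l k)))"
    using ij by (auto simp: prod_eq_iff fun_eq_iff of_nat_diff algebra_simps)
  also have "\<dots> = (0, k2 - k1)" unfolding k by simp
  finally have "(\<lambda>k. int (j - i) * l k) = k2 - k1" by simp
  moreover have "k2 - k1 \<in> \<Gamma>" using \<Gamma>_add[OF k(3) \<Gamma>_neg[OF k(1)]] by simp
  ultimately show ?thesis using ij by (intro exI[of _ "j - i"]) simp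
qed

lemma L_direct:
  assumes "U \<subseteq> \<Delta>" "\<And>\<alpha>. \<alpha> \<in> U \<Longrightarrow> m \<alpha> \<in> L \<alpha>" "sum m U = 0" "\<alpha> \<in> U"
  shows "m \<alpha> = 0"
proof (rule co_ext)
  fix p
  show "co (m \<alpha>) p = co 0 p"
  proof (cases "fst p = \<alpha>")
    case True
    have finU: "finite U" using assms(1) fin_\<Delta> finite_subset by blast
    have "0 = co (sum m U) p" using assms(3) by simp
    also have "\<dots> = (\<Sum>\<beta>\<in>U. if \<beta> = \<alpha> then co (m \<beta>) p else 0)"
      unfolding co_setsum
    proof (rule sum.cong)
      fix \<beta> assume "\<beta> \<in> U"
      then have "co (m \<beta>) p \<noteq> 0 \<longrightarrow> fst p = \<beta>" using assms(2)[of \<beta>] unfolding L_iff by blast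
      then show "co (m \<beta>) p = (if \<beta> = \<alpha> then co (m \<beta>) p else 0)" using True by auto
    qed simp
    finally show ?thesis using finU assms(4) by simp
  next
    case False
    have "co (m \<alpha>) p \<noteq> 0 \<longrightarrow> fst p = \<alpha>" using assms(2)[OF assms(4)] unfolding L_iff by blast
    then show ?thesis using False by simp
  qed
qed

lemma L_sum: "\<exists>m. (\<forall>\<alpha>\<in>\<Delta>. m \<alpha> \<in> L \<alpha>) \<and> x = sum m \<Delta>"
proof -
  define P where "P = {p. co x p \<noteq> 0}"
  have P: "finite P" using co_fin by (simp add: P_def)
  have "fst ` P \<subseteq> \<Delta>"
  proof
    fix \<alpha> assume "\<alpha> \<in> fst ` P"
    then obtain p where p: "\<alpha> = fst p" "co x p \<noteq> 0" by (auto simp: P_def simp del: split_paired_Ex)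
    show "\<alpha> \<in> \<Delta>" using g_\<Delta>[OF co_in p(2)] p(1) by simp
  qed
  then have "x = (\<Sum>\<alpha>\<in>\<Delta>. \<Sum>p\<in>{p\<in>P. fst p = \<alpha>}. co x p)"
    using sum.group[OF P fin_\<Delta>, of fst "co x"] co_total[of x] by (simp add: P_def)
  moreover have "(\<Sum>p\<in>{p\<in>P. fst p = \<alpha>}. co x p) \<in> L \<alpha>" for \<alpha>
    using gmod_L g_L[OF co_in] by (intro C.cmod_sum) (auto simp: gmod_def)
  ultimately show ?thesis by (intro exI[of _ "\<lambda>\<alpha>. \<Sum>p\<in>{p\<in>P. fst p = \<alpha>}. co x p"]) simp
qed

lemma rk_pos: "\<alpha> \<in> \<Delta> \<Longrightarrow> rk (L \<alpha>) > 0"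
proof -
  assume a: "\<alpha> \<in> \<Delta>"
  obtain b where b: "finite b" "rk (L \<alpha>) = card b" "L \<alpha> = C.cspan b" using ex_hom_basis[OF gmod_L] by metis
  have "C.cspan {} = {0}" by (auto simp: C.cspan_def)
  then have "b \<noteq> {}" using b(3) LT1[of \<alpha>] a by auto
  then show ?thesis using b by (simp add: card_gt_0_iff)
qed

section \<open>Units of the centroid\<close>

text \<open>The leading parts of \<open>c\<close> and \<open>d\<close> multiply to a nonzero part of
  the identity, which has degree 0 only. The order function is left general so that highest and
  lowest degrees are handled alike.\<close>

lemma unit_extreme:
  assumes c: "c \<in> Cc" and d: "d \<in> Cc" and cd: "\<And>x. c (d x) = x"
    and \<sigma>: "\<And>p q. \<sigma> (p + q) = \<sigma> p + (\<sigma> q :: real)"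
    and \<gamma>: "\<gamma> \<in> G c" "\<And>q. q \<in> G c \<Longrightarrow> q \<noteq> \<gamma> \<Longrightarrow> \<sigma> q < \<sigma> \<gamma>"
    and \<delta>: "\<delta> \<in> G d" "\<And>q. q \<in> G d \<Longrightarrow> q \<noteq> \<delta> \<Longrightarrow> \<sigma> q < \<sigma> \<delta>"
  shows "\<gamma> + \<delta> = 0"
proof (rule ccontr)
  assume ne: "\<gamma> + \<delta> \<noteq> 0"
  have cod: "co (d e0) (p0 + r) = hc d r e0" for r using hc_hom[OF d e0(3)] by simp
  have "co (c (d e0)) (p0 + (\<gamma> + \<delta>)) = 0" using cd[of e0] co_hom[OF e0(3)] ne by simp
  then have "(\<Sum>\<eta>\<in>G c. hc c \<eta> (co (d e0) (p0 + (\<gamma> + \<delta> - \<eta>)))) = 0"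
    unfolding co_C[OF c] by (simp add: algebra_simps)
  moreover have "(\<Sum>\<eta>\<in>G c. hc c \<eta> (co (d e0) (p0 + (\<gamma> + \<delta> - \<eta>)))) = (\<Sum>\<eta>\<in>{\<gamma>}. hc c \<eta> (co (d e0) (p0 + (\<gamma> + \<delta> - \<eta>))))"
  proof (rule sum.mono_neutral_right[OF G_fin[OF c]])
    show "\<forall>\<eta>\<in>G c - {\<gamma>}. hc c \<eta> (co (d e0) (p0 + (\<gamma> + \<delta> - \<eta>))) = 0"
    proof
      fix \<eta> assume e: "\<eta> \<in> G c - {\<gamma>}"
      have "\<sigma> (\<gamma> + \<delta> - \<eta>) + \<sigma> \<eta> = \<sigma> \<gamma> + \<sigma> \<delta>" using \<sigma>[of "\<gamma> + \<delta> - \<eta>" \<eta>] \<sigma>[of \<gamma> \<delta>] by simp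
      moreover have "\<sigma> \<eta> < \<sigma> \<gamma>" using \<gamma>(2) e by blast
      ultimately have "\<sigma> (\<gamma> + \<delta> - \<eta>) > \<sigma> \<delta>" by simp
      then have "\<gamma> + \<delta> - \<eta> \<notin> G d" using \<delta>(2)[of "\<gamma> + \<delta> - \<eta>"] by force
      then have "hc d (\<gamma> + \<delta> - \<eta>) e0 = 0" by (simp add: G_def)
      then show "hc c \<eta> (co (d e0) (p0 + (\<gamma> + \<delta> - \<eta>))) = 0"
        unfolding cod using Cc_0[OF Ch_Cc[OF hc_Ch[OF c]]] by simp
    qed
  qed (use \<gamma>(1) in simp)
  ultimately have "hc c \<gamma> (hc d \<delta> e0) = 0" by (simp add: cod)
  then show False using Ch_ker[OF hc_Ch[OF c], of \<gamma>] Ch_ker[OF hc_Ch[OF d], of \<delta> e0] \<gamma>(1) \<delta>(1) e0(1) by (auto simp: G_def)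
qed

text \<open>The highest degrees of \<open>c\<close> and \<open>d\<close> are opposite, and so are
  the lowest. Since the lowest degree of \<open>d\<close> is at most its highest, the highest degree
  of \<open>c\<close> is at most its lowest, and only one degree is left.\<close>

lemma unit_homogeneous:
  assumes c: "c \<in> Cc" and d: "d \<in> Cc" and cd: "\<And>x. c (d x) = x"
  shows "\<exists>\<gamma>. c \<in> Ch \<gamma>"
proof -
  have d0: "d \<noteq> (\<lambda>_. 0)" using cd[of e0] e0(1) Cc_0[OF c] by auto
  have c0: "c \<noteq> (\<lambda>_. 0)" using cd[of e0] e0(1) by auto
  note fc = G_fin[OF c] G_nonempty[OF c c0] and fd = G_fin[OF d] G_nonempty[OF d d0]
  have i: "inj_on \<rho> (G c)" "inj_on \<rho> (G d)" "inj_on (\<lambda>p. - \<rho> p) (G c)" "inj_on (\<lambda>p. - \<rho> p) (G d)"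
    using inj_on_subset[OF \<rho>_inj G_S[OF c]] inj_on_subset[OF \<rho>_inj G_S[OF d]] by (auto simp: inj_on_def)
  obtain \<gamma> where g: "\<gamma> \<in> G c" "\<And>q. q \<in> G c \<Longrightarrow> q \<noteq> \<gamma> \<Longrightarrow> \<rho> q < \<rho> \<gamma>" using exists_arg_max[OF fc i(1)] by metis
  obtain \<delta> where dl: "\<delta> \<in> G d" "\<And>q. q \<in> G d \<Longrightarrow> q \<noteq> \<delta> \<Longrightarrow> \<rho> q < \<rho> \<delta>" using exists_arg_max[OF fd i(2)] by metis
  obtain \<gamma>' where g': "\<gamma>' \<in> G c" "\<And>q. q \<in> G c \<Longrightarrow> q \<noteq> \<gamma>' \<Longrightarrow> - \<rho> q < - \<rho> \<gamma>'" using exists_arg_max[OF fc i(3)] by metis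
  obtain \<delta>' where dl': "\<delta>' \<in> G d" "\<And>q. q \<in> G d \<Longrightarrow> q \<noteq> \<delta>' \<Longrightarrow> - \<rho> q < - \<rho> \<delta>'" using exists_arg_max[OF fd i(4)] by metis
  have "\<gamma> + \<delta> = 0" by (rule unit_extreme[OF c d cd \<rho>_add g dl])
  moreover have "\<gamma>' + \<delta>' = 0" by (rule unit_extreme[OF c d cd _ g' dl']) (simp_all add: \<rho>_add)
  ultimately have "\<rho> \<delta> = - \<rho> \<gamma>" "\<rho> \<delta>' = - \<rho> \<gamma>'" using \<rho>_add[of \<gamma> \<delta>] \<rho>_add[of \<gamma>' \<delta>'] \<rho>_0 by simp_all
  moreover have "\<rho> \<delta>' \<le> \<rho> \<delta>" using dl(2)[OF dl'(1)] by fastforce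
  ultimately have "\<rho> \<gamma> \<le> \<rho> \<gamma>'" by simp
  then have "\<gamma>' = \<gamma>" using g(2)[OF g'(1)] by force
  then have "q = \<gamma>" if "q \<in> G c" for q using g(2)[OF that] g'(2)[OF that] by force
  then have "G c = {\<gamma>}" using g(1) by blast
  then have "c x = hc c \<gamma> x" for x using hc_total[OF c, of x] by simp
  then have "c = hc c \<gamma>" by (rule ext)
  then show ?thesis using hc_Ch[OF c] by metis
qed

lemma Ch_degree_unique: "c \<in> Ch \<gamma> \<Longrightarrow> c \<in> Ch \<delta> \<Longrightarrow> c \<noteq> (\<lambda>_. 0) \<Longrightarrow> \<gamma> = \<delta>"
proof -
  assume c: "c \<in> Ch \<gamma>" "c \<in> Ch \<delta>" "c \<noteq> (\<lambda>_. 0)"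
  have "c e0 \<noteq> 0" using Ch_ker[OF c(1,3)] e0(1) by blast
  then have "p0 + \<gamma> = p0 + \<delta>"
    using co_hom[OF Ch_g[OF c(1) e0(3)], of "p0 + \<gamma>"] co_hom[OF Ch_g[OF c(2) e0(3)], of "p0 + \<gamma>"] by (auto split: if_splits)
  then show ?thesis by simp
qed

lemma Ch_proportional:
  assumes "c \<in> Ch \<gamma>" "d \<in> Ch \<gamma>" "c \<noteq> (\<lambda>_. 0)"
  shows "\<exists>a. \<forall>x. d x = sc a (c x)"
proof -
  obtain u where u: "u \<in> Ch (- \<gamma>)" "\<And>x. c (u x) = x" using Ch_inverse[OF assms(1,3)] by metis
  have "(\<lambda>x. d (u x)) \<in> Ch 0" using Ch_comp[OF assms(2) u(1)] by simp
  then obtain a where "(\<lambda>x. d (u x)) = sc a" using Ch_0_scalar by blast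
  then have "d (u (c x)) = sc a (c x)" for x by metis
  moreover have "u (c x) = x" for x using Cc_comm[OF Ch_Cc[OF u(1)] Ch_Cc[OF assms(1)]] u(2) by simp
  ultimately show ?thesis by metis
qed

lemma \<Gamma>_int: "l \<in> \<Gamma> \<Longrightarrow> (\<lambda>i. k * l i) \<in> \<Gamma>"
proof -
  assume l: "l \<in> \<Gamma>"
  have nat: "(\<lambda>i. int m * l i) \<in> \<Gamma>" for m
  proof (induction m)
    case 0 then show ?case using \<Gamma>_0 by (simp add: zero_fun_def)
  next
    case (Suc m)
    have "(\<lambda>i. int (Suc m) * l i) = (\<lambda>i. int m * l i) + l" by (simp add: fun_eq_iff algebra_simps)
    then show ?case using \<Gamma>_add[OF Suc l] by simp
  qed
  show ?thesis
  proof (cases "k \<ge> 0")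
    case True then show ?thesis using nat[of "nat k"] by simp
  next
    case False
    have "(\<lambda>i. k * l i) = - (\<lambda>i. int (nat (- k)) * l i)" using False by (simp add: fun_eq_iff)
    then show ?thesis using \<Gamma>_neg[OF nat[of "nat (- k)"]] by simp
  qed
qed

section \<open>The lattice is torsion modulo the degrees of the centroid\<close>

definition tors :: "(nat \<Rightarrow> int) \<Rightarrow> bool" where "tors l \<longleftrightarrow> (\<exists>m>0. (\<lambda>i. int m * l i) \<in> \<Gamma>)"

lemma tors_add: "tors l \<Longrightarrow> tors k \<Longrightarrow> tors (\<lambda>i. a * l i + k i)"
proof -
  assume "tors l" "tors k"
  then obtain m m' where m: "m > 0" "(\<lambda>i. int m * l i) \<in> \<Gamma>" "m' > 0" "(\<lambda>i. int m' * k i) \<in> \<Gamma>" by (auto simp: tors_def)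
  have "(\<lambda>i. int (m * m') * (a * l i + k i)) = (\<lambda>i. (int m' * a) * (int m * l i)) + (\<lambda>i. int m * (int m' * k i))"
    by (simp add: fun_eq_iff algebra_simps)
  also have "\<dots> \<in> \<Gamma>" by (intro \<Gamma>_add \<Gamma>_int m)
  finally show ?thesis unfolding tors_def using m by (intro exI[of _ "m * m'"]) simp
qed

lemma tors_zero_root: "x \<in> g (0, l) \<Longrightarrow> x \<noteq> 0 \<Longrightarrow> tors l" using torsion_mod_\<Gamma> by (simp add: tors_def)

lemma tors_indivisible:
  assumes "\<alpha> \<in> D" "\<alpha> \<notin> (\<lambda>x. 2 *\<^sub>R x) ` D"
  obtains f where "f \<in> g (- \<alpha>, 0)" "f \<noteq> 0"
proof -
  have "gr \<alpha> 0 \<noteq> {0}" using T_2i assms by blast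
  then obtain e where e: "e \<in> g (\<alpha>, 0)" "e \<noteq> 0" using g_0[of "(\<alpha>, 0)"] by (auto simp: g_def)
  then obtain f where f: "sl2 \<alpha> 0 e f" using LT2(2)[OF assms(1)] by blast
  then have "f \<in> g (- \<alpha>, 0)" by (simp add: sl2_def)
  moreover have "f \<noteq> 0" using sl2_neg[OF assms(1) f] by (simp add: sl2_def)
  ultimately show thesis using that by blast
qed

text \<open>Bracketing with a vector of lattice degree 0 moves the root without changing
  \<open>l\<close>. By (LT2)(i) an indivisible root reaches 0 in one step; a doubled root first
  moves to its half.\<close>

lemma tors_support:
  assumes x: "x \<in> g (\<alpha>, l)" "x \<noteq> 0"
  shows "tors l"
proof (cases "\<alpha> = 0")
  case True then show ?thesis using tors_zero_root x by simp
next
  case False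
  have ind: "tors l" if x: "x \<in> g (\<alpha>, l)" "x \<noteq> 0" "\<alpha> \<in> D" "\<alpha> \<notin> (\<lambda>x. 2 *\<^sub>R x) ` D" for x \<alpha>
  proof -
    obtain f where f: "f \<in> g (- \<alpha>, 0)" "f \<noteq> 0" using tors_indivisible[OF x(3,4)] .
    have "br f x \<noteq> 0"
      by (rule br_nonzero[OF neg_D[OF x(3)] f _ x(2)]) (use g_L[OF x(1)] pair_neg[OF x(3)] pair_self[OF x(3)] x(3) in auto)
    moreover have "br f x \<in> g (0, l)" using g_br[OF f(1) x(1)] by simp
    ultimately show ?thesis using tors_zero_root by blast
  qed
  have a: "\<alpha> \<in> D" using g_\<Delta>[OF x] False by simp
  show ?thesis
  proof (cases "\<alpha> \<in> (\<lambda>x. 2 *\<^sub>R x) ` D")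
    case False then show ?thesis using ind x a by blast
  next
    case True
    then obtain \<delta> where d: "\<delta> \<in> D" "\<alpha> = 2 *\<^sub>R \<delta>" by auto
    \<comment> \<open>Otherwise \<alpha> would be four times a root \<epsilon>, and its coroot would
      take the value 1/2 on \<epsilon>.\<close>
    have di: "\<delta> \<notin> (\<lambda>x. 2 *\<^sub>R x) ` D"
    proof
      assume "\<delta> \<in> (\<lambda>x. 2 *\<^sub>R x) ` D"
      then obtain \<epsilon> where e: "\<epsilon> \<in> D" "\<delta> = 2 *\<^sub>R \<epsilon>" by auto
      have "R.cr (4 *\<^sub>R \<epsilon>) \<epsilon> = R.cr \<epsilon> \<epsilon> / 4"
        by (rule R.coroot_scale[OF e(1)]) (use a d e \<Delta>_span[of \<epsilon>] in auto)
      moreover have "R.cr (4 *\<^sub>R \<epsilon>) \<epsilon> \<in> \<int>" by (rule R.coroot_int) (use a d e in auto)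
      moreover have "R.cr \<epsilon> \<epsilon> / 4 = 1/2" using R.coroot_self[OF e(1)] by simp
      ultimately have "(1/2::real) \<in> \<int>" by metis
      then obtain z :: int where "(1/2::real) = of_int z" by (rule Ints_cases)
      then have "real_of_int (2 * z) = real_of_int 1" by simp
      then have "2 * z = 1" by (rule of_int_eq_iff[THEN iffD1])
      then show False by presburger
    qed
    obtain f where f: "f \<in> g (- \<delta>, 0)" "f \<noteq> 0" using tors_indivisible[OF d(1) di] .
    have "R.cr \<delta> \<alpha> = 4" using linear_cmul[OF R.coroot_linear[OF d(1)]] R.coroot_self[OF d(1)] d(2) by simp
    then have "pair \<delta> \<alpha> = 4" by (simp add: pair_def)
    then have "br f x \<noteq> 0"
      by (intro br_nonzero[OF neg_D[OF d(1)] f _ x(2), of \<alpha>]) (use g_L[OF x(1)] pair_neg[OF d(1), of \<alpha>] a in auto)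
    moreover have "br f x \<in> g (\<delta>, l)" using g_br[OF f(1) x(1)] d(2) by (simp add: scaleR_2)
    ultimately show ?thesis using ind d(1) di by blast
  qed
qed

text \<open>By (LT4) the lattice is generated by degrees of support, which are all torsion modulo
  \<Gamma>. Hence \<Gamma> has full rank and remembers the nullity.\<close>

lemma tors_lat:
  assumes "l \<in> lat n"
  shows "tors l"
proof -
  have "l \<in> {\<mu>. \<exists>F m. finite F \<and> F \<subseteq> {l\<in>lat n. lat_space gr l \<noteq> {0}} \<and> \<mu> = (\<lambda>i. \<Sum>l\<in>F. m l * l i)}"
    using assms by (subst (asm) T_4)
  then obtain F m where F: "finite F" "F \<subseteq> {l\<in>lat n. lat_space gr l \<noteq> {0}}" "l = (\<lambda>i. \<Sum>k\<in>F. m k * k i)"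
    by (elim CollectE exE conjE)
  have supp: "tors k" if "k \<in> F" for k
  proof -
    have "lat_space gr k \<noteq> {0}" using F(2) that by auto
    moreover have "0 \<in> lat_space gr k" unfolding lat_space_def fsums_def by (intro CollectI exI[of _ "{}"]) simp
    ultimately obtain y where "y \<in> lat_space gr k" "y \<noteq> 0" by blast
    then obtain I c where c: "\<forall>i\<in>I. c i \<in> gr i k" "y = sum c I" "y \<noteq> 0" by (auto simp: lat_space_def fsums_def)
    then obtain i where "i \<in> I" "c i \<noteq> 0" by (meson sum.neutral)
    then show ?thesis using tors_support[of "c i" i k] c(1) by (simp add: g_def)
  qed
  have "tors (\<lambda>i. \<Sum>k\<in>F'. m k * k i)" if "F' \<subseteq> F" for F'
    using finite_subset[OF that F(1)] that
  proof (induction F' rule: finite_induct)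
    case empty then show ?case using \<Gamma>_0 by (auto simp: tors_def zero_fun_def intro: exI[of _ 1])
  next
    case (insert k F') then show ?case using tors_add[OF supp[of k], of "\<lambda>i. \<Sum>k\<in>F'. m k * k i" "m k"] by simp
  qed
  from this[of F] show ?thesis using F(3) by simp
qed

end

section \<open>Comparison with a second grading\<close>

text \<open>An abstract form of the root spaces of the second torus, carried into the first algebra.
  The spaces \<open>M \<beta>\<close> are submodules over the centroid with bases
  \<open>B \<beta>\<close>, but are not assumed graded for the first torus. Opposite spaces have
  equal rank.\<close>

locale second_grading = fgc_lie_torus sc br \<Delta> n gr
  for sc :: "'k::field_char_0 \<Rightarrow> 'a::ab_group_add \<Rightarrow> 'a" and br
    and \<Delta> :: "'v::real_vector set" and n and gr +
  fixes E :: "'w::real_vector set" and M :: "'w \<Rightarrow> 'a set" and B :: "'w \<Rightarrow> 'a set" and h :: "'w \<Rightarrow> real"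
  assumes E_fin: "finite E" and E_0: "0 \<in> E" and E_neg: "\<beta> \<in> E \<Longrightarrow> - \<beta> \<in> E"
    and M_out: "\<beta> \<notin> E \<Longrightarrow> M \<beta> = {0}"
    and M_sum: "\<exists>m. (\<forall>\<beta>\<in>E. m \<beta> \<in> M \<beta>) \<and> x = sum m E"
    and M_dir: "(\<And>\<beta>. \<beta> \<in> E \<Longrightarrow> m \<beta> \<in> M \<beta>) \<Longrightarrow> sum m E = 0 \<Longrightarrow> \<beta> \<in> E \<Longrightarrow> m \<beta> = 0"
    and M_br: "x \<in> M \<beta> \<Longrightarrow> y \<in> M \<gamma> \<Longrightarrow> br x y \<in> M (\<beta> + \<gamma>)"
    and M_basis: "\<beta> \<in> E \<Longrightarrow> cbasis Cc (M \<beta>) (B \<beta>)"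
    and B_neg: "\<beta> \<in> E \<Longrightarrow> card (B (- \<beta>)) = card (B \<beta>)" and B_pos: "\<beta> \<in> E \<Longrightarrow> card (B \<beta>) > 0"
    and h_lin: "linear h" and h_inj: "inj_on h (root_lattice E)"
begin

section \<open>The filtration by values of the generic functional\<close>

definition Vals where "Vals = h ` E"

lemma Vals_fin: "finite Vals" and Vals_0: "0 \<in> Vals" and Vals_neg: "v \<in> Vals \<Longrightarrow> - v \<in> Vals"
  using E_fin E_0 linear_0[OF h_lin] E_neg linear_neg[OF h_lin, symmetric] by (auto simp: Vals_def image_iff)

lemma cmod_M: "C.cmod (M \<beta>)"
proof (cases "\<beta> \<in> E")
  case True then show ?thesis using M_basis[OF True] C.cmod_cspan by (simp add: C.cbasis_iff)
next
  case False then show ?thesis using M_out by (auto simp: C.cmod_def C.C_0)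
qed

definition Eq where "Eq q = {\<beta>\<in>E. q \<le> h \<beta>}"
definition F where "F q = {x. \<exists>m. (\<forall>\<beta>\<in>Eq q. m \<beta> \<in> M \<beta>) \<and> x = sum m (Eq q)}"
definition f where "f q = (\<Sum>\<beta>\<in>Eq q. card (B \<beta>))"

lemma Eq_fin: "finite (Eq q)" using E_fin by (simp add: Eq_def)

lemma M_dir_sub:
  assumes "U \<subseteq> E" "\<And>\<beta>. \<beta> \<in> U \<Longrightarrow> m \<beta> \<in> M \<beta>" "sum m U = 0" "\<beta> \<in> U"
  shows "m \<beta> = 0"
proof -
  have "sum (\<lambda>\<beta>. if \<beta> \<in> U then m \<beta> else 0) E = sum m U"
    by (rule sum.mono_neutral_cong_right) (use E_fin assms(1) in auto)
  then have "(\<lambda>\<beta>. if \<beta> \<in> U then m \<beta> else 0) \<beta> = 0"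
    using M_dir[of "\<lambda>\<beta>. if \<beta> \<in> U then m \<beta> else 0" \<beta>] assms C.cmod_0[OF cmod_M] by auto
  then show ?thesis using assms(4) by simp
qed

lemma F_basis: "cbasis Cc (F q) (\<Union>\<beta>\<in>Eq q. B \<beta>)" "card (\<Union>\<beta>\<in>Eq q. B \<beta>) = f q"
proof -
  have "cbasis Cc {x. \<exists>m. (\<forall>\<beta>\<in>Eq q. m \<beta> \<in> M \<beta>) \<and> x = sum m (Eq q)} (\<Union>\<beta>\<in>Eq q. B \<beta>) \<and>
    card (\<Union>\<beta>\<in>Eq q. B \<beta>) = (\<Sum>\<beta>\<in>Eq q. card (B \<beta>))"
    by (rule C.direct_sum_basis[OF Eq_fin]) (use M_basis M_dir_sub[of "Eq q"] in \<open>auto simp: Eq_def\<close>)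
  then show "cbasis Cc (F q) (\<Union>\<beta>\<in>Eq q. B \<beta>)" "card (\<Union>\<beta>\<in>Eq q. B \<beta>) = f q" by (auto simp: F_def f_def)
qed

lemma F_cmod: "C.cmod (F q)" using F_basis(1)[of q] C.cmod_cspan by (simp add: C.cbasis_iff)

lemma F_eq: "(\<And>v. v \<in> Vals \<Longrightarrow> q \<le> v \<longleftrightarrow> r \<le> v) \<Longrightarrow> F q = F r"
proof -
  assume "\<And>v. v \<in> Vals \<Longrightarrow> q \<le> v \<longleftrightarrow> r \<le> v"
  then have "Eq q = Eq r" by (auto simp: Eq_def Vals_def)
  then show ?thesis by (simp add: F_def)
qed

lemma F_top: "(\<And>v. v \<in> Vals \<Longrightarrow> v < q) \<Longrightarrow> F q = {0}"
proof -
  assume "\<And>v. v \<in> Vals \<Longrightarrow> v < q"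
  then have "Eq q = {}" by (force simp: Eq_def Vals_def)
  then show ?thesis by (auto simp: F_def)
qed

lemma F_bot: "(\<And>v. v \<in> Vals \<Longrightarrow> q \<le> v) \<Longrightarrow> F q = UNIV"
proof -
  assume "\<And>v. v \<in> Vals \<Longrightarrow> q \<le> v"
  then have "Eq q = E" by (auto simp: Eq_def Vals_def)
  then show ?thesis using M_sum by (auto simp: F_def)
qed

lemma M_F: "x \<in> M \<beta> \<Longrightarrow> q \<le> h \<beta> \<Longrightarrow> x \<in> F q"
proof (cases "\<beta> \<in> E")
  case True
  assume x: "x \<in> M \<beta>" "q \<le> h \<beta>"
  then have "\<beta> \<in> Eq q" using True by (simp add: Eq_def)
  then have "x = (\<Sum>\<gamma>\<in>Eq q. if \<gamma> = \<beta> then x else 0)" using Eq_fin by simp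
  then show ?thesis unfolding F_def using x C.cmod_0[OF cmod_M]
    by (intro CollectI exI[of _ "\<lambda>\<gamma>. if \<gamma> = \<beta> then x else 0"]) auto
next
  case False
  assume "x \<in> M \<beta>" then show ?thesis using M_out[OF False] C.cmod_0[OF F_cmod] by simp
qed

lemma F_anti: "q \<le> r \<Longrightarrow> F r \<subseteq> F q"
proof
  fix x assume qr: "q \<le> r" and "x \<in> F r"
  then obtain m where "\<forall>\<beta>\<in>Eq r. m \<beta> \<in> M \<beta>" "x = sum m (Eq r)" by (auto simp: F_def)
  then show "x \<in> F q" using qr by (auto intro!: C.cmod_sum[OF F_cmod] M_F simp: Eq_def)
qed

lemma F_br: "x \<in> F q \<Longrightarrow> y \<in> F r \<Longrightarrow> br x y \<in> F (q + r)"
proof -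
  assume "x \<in> F q" "y \<in> F r"
  then obtain m m' where m: "\<forall>\<beta>\<in>Eq q. m \<beta> \<in> M \<beta>" "x = sum m (Eq q)" "\<forall>\<beta>\<in>Eq r. m' \<beta> \<in> M \<beta>" "y = sum m' (Eq r)"
    by (auto simp: F_def)
  have "br (m \<beta>) (m' \<gamma>) \<in> F (q + r)" if "\<beta> \<in> Eq q" "\<gamma> \<in> Eq r" for \<beta> \<gamma>
    by (rule M_F[OF M_br]) (use m that linear_add[OF h_lin] in \<open>auto simp: Eq_def\<close>)
  then show ?thesis unfolding m br_suml br_sumr by (intro C.cmod_sum[OF F_cmod]) auto
qed

section \<open>Leading-term modules of the filtration\<close>

definition N where "N q = IN (F q)"

lemma gmod_N: "gmod (N q)" unfolding N_def by (rule gmod_IN[OF F_cmod])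
lemma N_cmod: "C.cmod (N q)" using gmod_N by (simp add: gmod_def)
lemma N_co: "x \<in> N q \<Longrightarrow> co x p \<in> N q" using gmod_N[of q] unfolding gmod_def by blast
lemma N_br: "x \<in> N q \<Longrightarrow> y \<in> N r \<Longrightarrow> br x y \<in> N (q + r)" unfolding N_def by (rule IN_br[OF F_br F_cmod])
lemma N_anti: "q \<le> r \<Longrightarrow> N r \<subseteq> N q" unfolding N_def by (rule IN_mono[OF F_anti])
lemma N_eq: "(\<And>v. v \<in> Vals \<Longrightarrow> q \<le> v \<longleftrightarrow> r \<le> v) \<Longrightarrow> N q = N r" unfolding N_def using F_eq by metis
lemma N_top: "(\<And>v. v \<in> Vals \<Longrightarrow> v < q) \<Longrightarrow> N q = {0}" unfolding N_def using F_top IN_zero by metis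
lemma N_bot: "(\<And>v. v \<in> Vals \<Longrightarrow> q \<le> v) \<Longrightarrow> N q = UNIV" unfolding N_def using F_bot IN_UNIV by metis

lemma f_le: "f q \<le> rk (N q)"
proof -
  have "C.cind (\<Union>\<beta>\<in>Eq q. B \<beta>)" "(\<Union>\<beta>\<in>Eq q. B \<beta>) \<subseteq> F q"
    using F_basis(1)[of q] C.cspan_base[OF C.cfree_finite] by (auto simp: C.cbasis_iff)
  then show ?thesis using card_le_rk_IN[OF F_cmod] F_basis(2) unfolding N_def by metis
qed

text \<open>When q is not a value of h, negation matches the roots at level - q with those below
  level q, and ranks are symmetric under negation.\<close>

lemma f_dual: "q \<notin> Vals \<Longrightarrow> f q + f (- q) = rk UNIV"
proof -
  assume q: "q \<notin> Vals"
  have "Eq (- q) = uminus ` (E - Eq q)"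
  proof (intro set_eqI iffI)
    fix \<beta> assume b: "\<beta> \<in> Eq (- q)"
    have "h (- \<beta>) \<noteq> q" using q b E_neg by (auto simp: Vals_def Eq_def)
    then have "- \<beta> \<in> E - Eq q" using b E_neg linear_neg[OF h_lin] by (auto simp: Eq_def)
    then show "\<beta> \<in> uminus ` (E - Eq q)" by (metis image_eqI minus_minus)
  qed (use E_neg linear_neg[OF h_lin] in \<open>auto simp: Eq_def\<close>)
  then have "f (- q) = (\<Sum>\<beta>\<in>E - Eq q. card (B (- \<beta>)))"
    unfolding f_def by (simp add: sum.reindex)
  also have "\<dots> = (\<Sum>\<beta>\<in>E - Eq q. card (B \<beta>))" by (rule sum.cong) (use B_neg in auto)
  finally have "f q + f (- q) = (\<Sum>\<beta>\<in>E. card (B \<beta>))"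
    using sum.subset_diff[of "Eq q" E "\<lambda>\<beta>. card (B \<beta>)"] E_fin by (simp add: f_def Eq_def)
  also have "\<dots> = rk UNIV"
  proof -
    define b where "b = Min Vals"
    have b: "b \<le> v" if "v \<in> Vals" for v using that Vals_fin by (simp add: b_def)
    then have "Eq b = E" by (auto simp: Eq_def Vals_def)
    then show ?thesis using C.crank_eq[OF F_basis(1)[of b]] F_basis(2)[of b] F_bot[OF b] by (simp add: f_def)
  qed
  finally show ?thesis .
qed

lemma gap: obtains \<epsilon> where "\<epsilon> > 0" "\<And>v. v \<in> Vals \<Longrightarrow> v \<noteq> q \<Longrightarrow> \<epsilon> < \<bar>v - q\<bar>"
proof -
  obtain d where d: "d > 0" "\<forall>x\<in>Vals. x \<noteq> q \<longrightarrow> d \<le> dist q x" using finite_set_avoid[OF Vals_fin, of q] by blast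
  show thesis
  proof (rule that[of "d / 2"])
    fix v assume "v \<in> Vals" "v \<noteq> q"
    then have "d \<le> \<bar>q - v\<bar>" using d(2) by (auto simp: dist_real_def)
    then show "d / 2 < \<bar>v - q\<bar>" using d(1) by linarith
  qed (use d in simp)
qed

lemma N_pos_zero_part:
  assumes "q > 0" "x \<in> N q" "x \<in> g (0, l)"
  shows "x = 0"
proof (rule ccontr)
  assume "x \<noteq> 0"
  \<comment> \<open>At the lowest value \<open>b\<close> the module \<open>N b\<close> is
    everything, and \<open>K\<close> steps of size \<open>q\<close> lead past the highest value,
    where \<open>N\<close> is zero.\<close>
  define b where "b = Min Vals"
  obtain K :: nat where "(Max Vals + 1 - b) / q < real K" using reals_Archimedean2 by blast
  then have K: "Max Vals < b + real K * q" using assms(1) by (simp add: field_simps)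
  have "(br x ^^ i) z \<in> N (b + real i * q)" for i z
  proof (induction i)
    case 0 then show ?case using N_bot[of b] Vals_fin by (simp add: b_def)
  next
    case (Suc i) then show ?case using N_br[OF assms(2) Suc] by (simp add: algebra_simps)
  qed
  moreover have "N (b + real K * q) = {0}"
    by (rule N_top) (use K Vals_fin in \<open>auto intro: le_less_trans[OF Max_ge]\<close>)
  ultimately have "(br x ^^ K) z = 0" for z by blast
  then show False using degree_zero_not_nilpotent[OF assms(3) \<open>x \<noteq> 0\<close>] by blast
qed

lemma opposite_not_both:
  assumes "\<alpha> \<in> D" "e \<in> g (\<alpha>, l)" "e \<noteq> 0" "e \<in> N q" "u \<in> g (- \<alpha>, m)" "u \<noteq> 0" "u \<in> N r"
  shows "q + r \<le> 0"
proof (rule ccontr)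
  assume "\<not> q + r \<le> 0"
  moreover have "br e u \<in> g (0, l + m)" using g_br[OF assms(2,5)] by simp
  ultimately have "br e u = 0" using N_pos_zero_part[OF _ N_br[OF assms(4,7)], of "l + m"] by simp
  then show False using br_opposite_nonzero[OF assms(1-3,5,6)] by simp
qed

lemma opposite_not_both_strict:
  assumes "q \<notin> Vals" "\<alpha> \<in> D" "e \<in> g (\<alpha>, l)" "e \<noteq> 0" "e \<in> N q" "u \<in> g (- \<alpha>, m)" "u \<noteq> 0" "u \<in> N (- q)"
  shows False
proof -
  obtain \<epsilon> where e: "\<epsilon> > 0" "\<And>v. v \<in> Vals \<Longrightarrow> v \<noteq> q \<Longrightarrow> \<epsilon> < \<bar>v - q\<bar>" using gap by metis
  \<comment> \<open>As q is not a value, raising it by less than the gap changes nothing but makes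
    the sum of the two levels strictly positive.\<close>
  have "N q = N (q + \<epsilon>)" by (rule N_eq) (use e assms(1) in force)
  then show False using opposite_not_both[OF assms(2-4) _ assms(6-8), of "q + \<epsilon>"] assms(5) e(1) by simp
qed

section \<open>Opposite degrees and the rank count\<close>

text \<open>The intended graded complement of \<open>N (- q)\<close>: the sum of the homogeneous
  spaces of nonzero root whose opposites lie in \<open>N q\<close>.\<close>

definition star where "star q = {x. \<forall>p. co x p \<noteq> 0 \<longrightarrow> fst p \<noteq> 0 \<and> g (- p) \<subseteq> N q}"

lemma gmod_star: "gmod (star q)"
  unfolding star_def
proof (rule gmod_graded_part)
  fix p \<gamma> assume p: "fst p \<noteq> 0 \<and> g (- p) \<subseteq> N q" and "\<exists>c\<in>Ch \<gamma>. c \<noteq> (\<lambda>_. 0)"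
  then obtain c where c: "c \<in> Ch \<gamma>" "c \<noteq> (\<lambda>_. 0)" by blast
  obtain d where d: "d \<in> Ch (- \<gamma>)" "\<And>x. d (c x) = x" using Ch_inverse[OF c] by metis
  have "y \<in> N q" if "y \<in> g (- (p + \<gamma>))" for y
  proof -
    have "c y \<in> N q" using Ch_g[OF c(1) that] p by auto
    then show ?thesis using C.cmod_C[OF N_cmod Ch_Cc[OF d(1)], of "c y" q] d(2) by simp
  qed
  then show "fst (p + \<gamma>) \<noteq> 0 \<and> g (- (p + \<gamma>)) \<subseteq> N q" using p Ch_fst[OF c] by auto
qed

lemma opposite_exists: "x \<in> g p \<Longrightarrow> x \<noteq> 0 \<Longrightarrow> fst p \<noteq> 0 \<Longrightarrow> \<exists>u\<in>g (- p). u \<noteq> 0"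
proof -
  assume x: "x \<in> g p" "x \<noteq> 0" "fst p \<noteq> 0"
  obtain \<alpha> l where p: "p = (\<alpha>, l)" by (cases p)
  have a: "\<alpha> \<in> D" using g_\<Delta>[OF x(1,2)] x(3) p by simp
  obtain u where "sl2 \<alpha> l x u" using LT2(2)[OF a] x p by blast
  then have "sl2 (- \<alpha>) (- l) u x" by (rule sl2_neg[OF a])
  then show ?thesis using p by (auto simp: sl2_def)
qed

lemma one_dim_subset:
  assumes "x \<in> g p" "x \<noteq> 0" "fst p \<noteq> 0" "x \<in> N q"
  shows "g p \<subseteq> N q"
proof -
  obtain \<alpha> l where p: "p = (\<alpha>, l)" by (cases p)
  have "\<alpha> \<in> D" using g_\<Delta>[OF assms(1,2)] assms(3) p by simp
  then have "g p = range (\<lambda>a. sc a x)" using LT2(1)[of \<alpha> x l] assms p by simp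
  then show ?thesis using C.cmod_C[OF N_cmod Cc_scale assms(4)] by auto
qed

text \<open>Each vector of a homogeneous basis of \<open>N q\<close> is replaced by one of opposite
  degree. Positivity of q keeps root degree 0 out of the basis, so opposites exist and homogeneous
  spaces are lines; independence carries over because centroid degrees relate two opposites exactly
  when they relate the original vectors.\<close>

lemma rk_star_ge:
  assumes "q > 0"
  shows "rk (N q) \<le> rk (star q)"
proof -
  obtain A where A: "A \<subseteq> hom" "A \<subseteq> N q" "C.cind A" "finite A" "rk (N q) = card A" "N q = C.cspan A"
    using ex_hom_basis[OF gmod_N] by metis
  have "\<forall>b\<in>A. \<exists>p. b \<in> g p" using A(1) unfolding hom_def by blast
  then obtain dg where dg: "\<And>b. b \<in> A \<Longrightarrow> b \<in> g (dg b)" by metis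
  have A0: "b \<noteq> 0" if "b \<in> A" for b
  proof
    assume "b = 0"
    then have "C.cind {0}" using C.cind_subset[OF A(3)] that by simp
    then show False using C.cfreeD[of "{0}" "\<lambda>x. x" "\<lambda>_ x. x" 0] C.C_one C.one_nonzero by simp
  qed
  have fst: "fst (dg b) \<noteq> 0" if "b \<in> A" for b
  proof
    assume "fst (dg b) = 0"
    then have "dg b = (0, snd (dg b))" by (intro prod_eqI) simp_all
    then have "b \<in> g (0, snd (dg b))" using dg[OF that] by simp
    moreover have "b \<in> N q" using A(2) that by blast
    ultimately have "b = 0" by (rule N_pos_zero_part[OF assms, rotated])
    then show False using A0[OF that] by simp
  qed
  have "\<forall>b\<in>A. \<exists>u. u \<in> g (- dg b) \<and> u \<noteq> 0"
  proof
    fix b assume b: "b \<in> A"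
    show "\<exists>u. u \<in> g (- dg b) \<and> u \<noteq> 0" using opposite_exists[OF dg[OF b] A0[OF b] fst[OF b]] by blast
  qed
  then obtain st where st: "\<And>b. b \<in> A \<Longrightarrow> st b \<in> g (- dg b)" "\<And>b. b \<in> A \<Longrightarrow> st b \<noteq> 0" by metis
  have "C.cfree A st"
    unfolding C.cfree_def
  proof (intro conjI allI impI ballI)
    fix c b0 assume c: "(\<forall>i\<in>A. c i \<in> Cc) \<and> (\<Sum>i\<in>A. c i (st i)) = 0" and b0: "b0 \<in> A"
    show "c b0 = (\<lambda>_. 0)"
    proof (rule ccontr)
      assume ne: "c b0 \<noteq> (\<lambda>_. 0)"
      have c0: "c b0 \<in> Cc" using c b0 by blast
      obtain \<gamma> where g: "\<gamma> \<in> G (c b0)" using G_nonempty[OF c0 ne] by blast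
      have un: "hc (c b0) \<gamma> \<noteq> (\<lambda>_. 0)" using g by (simp add: G_def)
      \<comment> \<open>In this degree the term of \<open>b0\<close> contributes its part of degree
        \<gamma>, which is nonzero; as the relation sums to 0, another basis index must contribute
        there as well.\<close>
      have hcb: "co (c b (st b)) (\<gamma> - dg b0) = hc (c b) (\<gamma> - dg b0 + dg b) (st b)" if "b \<in> A" for b
        using hc_hom[of "c b" "st b" "- dg b" "\<gamma> - dg b0 + dg b"] st(1)[OF that] c that by (simp add: algebra_simps)
      have "0 = co (\<Sum>i\<in>A. c i (st i)) (\<gamma> - dg b0)" using c by simp
      also have "\<dots> = (\<Sum>b\<in>A. hc (c b) (\<gamma> - dg b0 + dg b) (st b))"
        unfolding co_setsum by (rule sum.cong) (use hcb in auto)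
      also have "\<dots> = hc (c b0) \<gamma> (st b0) + (\<Sum>b\<in>A - {b0}. hc (c b) (\<gamma> - dg b0 + dg b) (st b))"
        using A(4) b0 by (simp add: sum.remove)
      finally have s: "hc (c b0) \<gamma> (st b0) + (\<Sum>b\<in>A - {b0}. hc (c b) (\<gamma> - dg b0 + dg b) (st b)) = 0" by simp
      have "hc (c b0) \<gamma> (st b0) \<noteq> 0" using Ch_ker[OF hc_Ch[OF c0] un] st(2)[OF b0] by blast
      have "\<exists>b\<in>A - {b0}. hc (c b) (\<gamma> - dg b0 + dg b) (st b) \<noteq> 0"
      proof (rule ccontr)
        assume "\<not> ?thesis"
        then have "(\<Sum>b\<in>A - {b0}. hc (c b) (\<gamma> - dg b0 + dg b) (st b)) = 0" by (intro sum.neutral) blast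
        then show False using s \<open>hc (c b0) \<gamma> (st b0) \<noteq> 0\<close> by simp
      qed
      then obtain b1 where b1: "b1 \<in> A" "b1 \<noteq> b0" "hc (c b1) (\<gamma> - dg b0 + dg b1) (st b1) \<noteq> 0" by blast
      have c1: "c b1 \<in> Cc" using c b1 by blast
      have u1: "hc (c b1) (\<gamma> - dg b0 + dg b1) \<noteq> (\<lambda>_. 0)" using b1(3) by auto
      \<comment> \<open>Combining the inverse degree with the part acting on the second vector gives
        a nonzero centroid element of degree \<open>dg b1 - dg b0\<close>. It carries
        \<open>b0\<close> into the line of \<open>b1\<close>, against independence of
        \<open>A\<close>.\<close>
      obtain d where d: "d \<in> Ch (- \<gamma>)" "d \<noteq> (\<lambda>_. 0)" using Ch_neg_nonzero[OF hc_Ch[OF c0] un] by blast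
      obtain v where "v \<in> Ch (- \<gamma> + (\<gamma> - dg b0 + dg b1))" "v \<noteq> (\<lambda>_. 0)"
        using Ch_add_nonzero[OF d hc_Ch[OF c1] u1] by blast
      then have v: "v \<in> Ch (dg b1 - dg b0)" "v \<noteq> (\<lambda>_. 0)" by (simp_all add: algebra_simps)
      have vb: "v b0 \<in> g (dg b1)" using Ch_g[OF v(1) dg[OF b0]] by simp
      have "dg b1 = (fst (dg b1), snd (dg b1))" by simp
      moreover have "fst (dg b1) \<in> D" using fst[OF b1(1)] g_\<Delta>[OF dg[OF b1(1)] A0[OF b1(1)]] by simp
      ultimately have "g (dg b1) = range (\<lambda>a. sc a b1)"
        using LT2(1)[of "fst (dg b1)" b1 "snd (dg b1)"] dg[OF b1(1)] A0[OF b1(1)] by simp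
      then obtain a where a: "v b0 = sc a b1" using vb by auto
      define c' where "c' i = (if i = b0 then v else if i = b1 then (\<lambda>x. - sc a x) else (\<lambda>_. 0))" for i
      have "(\<Sum>i\<in>A. c' i i) = (\<Sum>i\<in>{b0, b1}. c' i i)"
        by (rule sum.mono_neutral_right) (use A(4) b0 b1 in \<open>auto simp: c'_def\<close>)
      then have "(\<Sum>i\<in>A. c' i i) = 0" using b1(2) a by (simp add: c'_def)
      moreover have "c' i \<in> Cc" for i using Ch_Cc[OF v(1)] C.C_neg[OF Cc_scale] C.C_zero by (simp add: c'_def)
      ultimately have "c' b0 = (\<lambda>_. 0)" using C.cfreeD[OF A(3), of c' b0] b0 by blast
      then show False using v(2) by (simp add: c'_def)
    qed
  qed (rule A(4))
  from C.cfree_imp_cind[OF this] have ind: "inj_on st A" "C.cind (st ` A)" .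
  have "st b \<in> star q" if "b \<in> A" for b
    unfolding star_def
  proof (intro CollectI allI impI)
    fix p assume "co (st b) p \<noteq> 0"
    then have "p = - dg b" using co_hom[OF st(1)[OF that], of p] by (auto split: if_splits)
    then show "fst p \<noteq> 0 \<and> g (- p) \<subseteq> N q"
      using fst[OF that] one_dim_subset[OF dg[OF that] A0[OF that] fst[OF that], of q] A(2) that by auto
  qed
  then have "card (st ` A) \<le> rk (star q)" using card_le_rk[OF gmod_star ind(2)] by blast
  then show ?thesis using A(5) ind(1) by (simp add: card_image)
qed

lemma star_disjoint: "q \<notin> Vals \<Longrightarrow> N (- q) \<inter> star q \<subseteq> {0}"
proof (rule ccontr)
  assume q: "q \<notin> Vals" and "\<not> N (- q) \<inter> star q \<subseteq> {0}"
  then obtain x where x: "x \<in> N (- q)" "x \<in> star q" "x \<noteq> 0" by blast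
  obtain p where p: "co x p \<noteq> 0" using co_nonzero[OF x(3)] by blast
  obtain \<alpha> l where pl: "p = (\<alpha>, l)" by (cases p)
  have a: "fst p \<noteq> 0" "g (- p) \<subseteq> N q" using x(2) p unfolding star_def by blast+
  obtain u where u: "u \<in> g (- p)" "u \<noteq> 0" using opposite_exists[OF co_in p a(1)] by blast
  have aD: "\<alpha> \<in> D" using g_\<Delta>[OF co_in p] a(1) pl by simp
  show False
    by (rule opposite_not_both_strict[OF q neg_D[OF aD], of u "- l" "co x p" l])
      (use u a(2) co_in[of x p] p N_co[OF x(1), of p] pl in auto)
qed

text \<open>The total rank equals \<open>f q + f (- q)\<close>, hence is at most
  \<open>rk (N q) + rk (N (- q))\<close>, at most \<open>rk (star q) + rk (N (- q))\<close>, and so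
  at most the total rank by disjointness. Every inequality in this circle is an equality, and the
  two disjoint modules fill the algebra.\<close>

lemma rank_equality:
  assumes "q > 0" "q \<notin> Vals"
  shows "rk (N q) = f q" "rk (N (- q)) = f (- q)" "x \<in> g p \<Longrightarrow> \<exists>a\<in>N (- q). \<exists>b\<in>star q. x = a + b"
proof -
  note le = rk_add(1)[OF gmod_N gmod_star star_disjoint[OF assms(2)]] f_le[of q] f_le[of "- q"] rk_star_ge[OF assms(1)]
    f_dual[OF assms(2)]
  show "rk (N q) = f q" "rk (N (- q)) = f (- q)" using le by linarith+
  have "rk (N (- q)) + rk (star q) = rk UNIV" using le by linarith
  then show "x \<in> g p \<Longrightarrow> \<exists>a\<in>N (- q). \<exists>b\<in>star q. x = a + b"
    using rk_add(2)[OF gmod_N gmod_star star_disjoint[OF assms(2)]] by blast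
qed

lemma dichotomy:
  assumes "q > 0" "q \<notin> Vals" "x \<in> g p" "x \<noteq> 0"
  shows "x \<in> N (- q) \<or> fst p \<noteq> 0 \<and> g (- p) \<subseteq> N q"
proof -
  obtain a b where ab: "a \<in> N (- q)" "b \<in> star q" "x = a + b" using rank_equality(3)[OF assms(1-3)] by blast
  have x: "x = co a p + co b p" using ab(3) co_hom[OF assms(3), of p] by (simp add: co_add)
  show ?thesis
  proof (cases "co b p = 0")
    case True then show ?thesis using x N_co[OF ab(1), of p] by simp
  next
    case False then show ?thesis using ab(2) unfolding star_def by blast
  qed
qed

lemma rank_f: "q \<notin> Vals \<Longrightarrow> rk (N q) = f q"
proof -
  assume q: "q \<notin> Vals"
  then have "q \<noteq> 0" using Vals_0 by blast
  moreover have "- q \<notin> Vals" using q Vals_neg[of "- q"] by auto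
  ultimately show ?thesis using rank_equality(1)[of q] rank_equality(2)[of "- q"] q by (cases "q > 0") auto
qed

lemma zero_part_N: "x \<in> g (0, l) \<Longrightarrow> x \<noteq> 0 \<Longrightarrow> x \<in> N q \<longleftrightarrow> q \<le> 0"
proof
  assume x: "x \<in> g (0, l)" "x \<noteq> 0"
  show "q \<le> 0" if "x \<in> N q" using N_pos_zero_part[OF _ that x(1)] x(2) by force
  assume "q \<le> 0"
  obtain \<epsilon> where e: "\<epsilon> > 0" "\<And>v. v \<in> Vals \<Longrightarrow> v \<noteq> 0 \<Longrightarrow> \<epsilon> < \<bar>v - 0\<bar>" using gap by metis
  have "\<epsilon> \<notin> Vals" using e by force
  then have "x \<in> N (- \<epsilon>)" using dichotomy[OF e(1) _ x] by simp
  moreover have "N (- \<epsilon>) = N 0" by (rule N_eq) (use e in force)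
  ultimately show "x \<in> N q" using N_anti[OF \<open>q \<le> 0\<close>] by auto
qed

section \<open>Weights of degrees and the induced map of roots\<close>

definition Wt :: "'v \<times> (nat \<Rightarrow> int) \<Rightarrow> real" where "Wt p = Max {v\<in>Vals. g p \<subseteq> N v}"

lemma Wt:
  assumes x: "x \<in> g p" "x \<noteq> 0"
  shows "Wt p \<in> Vals" "g p \<subseteq> N q \<longleftrightarrow> q \<le> Wt p"
proof -
  have fin: "finite {v\<in>Vals. g p \<subseteq> N v}" using Vals_fin by simp
  have "N (Min Vals) = UNIV" by (rule N_bot) (use Vals_fin in simp)
  then have "Min Vals \<in> {v\<in>Vals. g p \<subseteq> N v}" using Vals_fin Vals_0 Min_in by auto
  then have W: "Wt p \<in> {v\<in>Vals. g p \<subseteq> N v}" unfolding Wt_def by (intro Max_in[OF fin]) auto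
  then show "Wt p \<in> Vals" by simp
  show "g p \<subseteq> N q \<longleftrightarrow> q \<le> Wt p"
  proof
    assume "q \<le> Wt p" then show "g p \<subseteq> N q" using W N_anti[of q "Wt p"] by blast
  next
    assume s: "g p \<subseteq> N q"
    have ne: "{v\<in>Vals. q \<le> v} \<noteq> {}"
    proof
      assume "{v\<in>Vals. q \<le> v} = {}"
      then have "N q = {0}" by (intro N_top) auto
      then show False using s x by blast
    qed
    define v where "v = Min {v\<in>Vals. q \<le> v}"
    have v: "v \<in> Vals" "q \<le> v" "\<And>u. u \<in> Vals \<Longrightarrow> q \<le> u \<Longrightarrow> v \<le> u"
      using Min_in[OF _ ne] Vals_fin by (auto simp: v_def)
    have "N q = N v" by (rule N_eq) (use v in force)
    then have "v \<le> Wt p" unfolding Wt_def using s v(1) by (intro Max_ge[OF fin]) auto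
    then show "q \<le> Wt p" using v(2) by simp
  qed
qed

lemma Wt_mem: "x \<in> g p \<Longrightarrow> x \<noteq> 0 \<Longrightarrow> fst p \<noteq> 0 \<Longrightarrow> x \<in> N q \<longleftrightarrow> q \<le> Wt p"
  using Wt(2)[of x p q] one_dim_subset[of x p q] by blast

text \<open>The sum of the two weights is at most 0 because opposite vectors bracket nontrivially
  into root degree 0. A gap between them would contain a positive level avoiding
  \<open>Vals\<close>, at which the dichotomy fails.\<close>

lemma Wt_neg:
  assumes x: "x \<in> g p" "x \<noteq> 0" "fst p \<noteq> 0"
  shows "Wt (- p) = - Wt p"
proof -
  have main: "Wt (- p) \<ge> - Wt p" if x: "x \<in> g p" "x \<noteq> 0" "fst p \<noteq> 0" and lt: "Wt p < 0" for x p
  proof (rule ccontr)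
    assume n: "\<not> Wt (- p) \<ge> - Wt p"
    \<comment> \<open>An open interval minus a finite set still offers a level; \<open>max 0\<close>
      makes that level positive, as the dichotomy requires.\<close>
    have "infinite ({max 0 (Wt (- p))<..<- Wt p} - Vals)" using n lt Vals_fin by simp
    then have "{max 0 (Wt (- p))<..<- Wt p} - Vals \<noteq> {}" by (metis finite.emptyI)
    then obtain q where "q \<in> {max 0 (Wt (- p))<..<- Wt p} - Vals" by blast
    then have q: "q > 0" "q > Wt (- p)" "q < - Wt p" "q \<notin> Vals" by auto
    obtain u where u: "u \<in> g (- p)" "u \<noteq> 0" using opposite_exists[OF x] by blast
    show False using dichotomy[OF q(1,4) x(1,2)] Wt_mem[OF x, of "- q"] Wt(2)[OF u, of q] q by auto
  qed
  obtain u where u: "u \<in> g (- p)" "u \<noteq> 0" using opposite_exists[OF x] by blast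
  have fu: "fst (- p) \<noteq> 0" using x(3) by simp
  obtain \<alpha> l where p: "p = (\<alpha>, l)" by (cases p)
  have a: "\<alpha> \<in> D" using g_\<Delta>[OF x(1,2)] x(3) p by simp
  have xN: "x \<in> N (Wt p)" "u \<in> N (Wt (- p))" using Wt_mem[OF x] Wt_mem[OF u fu] by auto
  have le: "Wt p + Wt (- p) \<le> 0"
    by (rule opposite_not_both[OF a, of x l _ u "- l"]) (use x u p xN in auto)
  show ?thesis
  proof (cases "Wt p < 0")
    case True then show ?thesis using main[OF x] le by simp
  next
    case F: False
    show ?thesis
    proof (cases "Wt (- p) < 0")
      case True then show ?thesis using main[OF u fu] le by simp
    next
      case False then show ?thesis using F le by simp
    qed
  qed
qed

text \<open>A vector of lattice degree \<open>l\<close> and an opposite of one of lattice degree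
  \<open>m\<close> still bracket nontrivially into root degree 0, which bounds the difference of the
  weights; exchanging the two gives equality.\<close>

lemma Wt_indep:
  assumes "\<alpha> \<in> D" "x \<in> g (\<alpha>, l)" "x \<noteq> 0" "y \<in> g (\<alpha>, m)" "y \<noteq> 0"
  shows "Wt (\<alpha>, l) = Wt (\<alpha>, m)"
proof -
  have le: "Wt (\<alpha>, l) \<le> Wt (\<alpha>, m)" if x: "x \<in> g (\<alpha>, l)" "x \<noteq> 0" and y: "y \<in> g (\<alpha>, m)" "y \<noteq> 0" for x y l m
  proof -
    have f: "fst (\<alpha>, l) \<noteq> 0" "fst (\<alpha>, m) \<noteq> 0" using assms(1) by auto
    obtain u where u: "u \<in> g (- (\<alpha>, m))" "u \<noteq> 0" using opposite_exists[OF y f(2)] by blast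
    have "x \<in> N (Wt (\<alpha>, l))" using Wt_mem[OF x f(1)] by simp
    moreover have "u \<in> N (- Wt (\<alpha>, m))" using Wt_mem[OF u] Wt_neg[OF y f(2)] f(2) by simp
    moreover have "u \<in> g (- \<alpha>, - m)" using u(1) by simp
    ultimately have "Wt (\<alpha>, l) + - Wt (\<alpha>, m) \<le> 0"
      by (intro opposite_not_both[OF assms(1) x _ _ u(2)])
    then show ?thesis by simp
  qed
  show ?thesis using le[OF assms(2-5)] le[OF assms(4,5,2,3)] by simp
qed

text \<open>The chosen lattice degree is immaterial by \<open>Wt_indep\<close>, and the value 0 at
  root 0 is the true level there by \<open>zero_part_N\<close>.\<close>

definition w :: "'v \<Rightarrow> real" where
  "w \<alpha> = (if \<alpha> = 0 then 0 else Wt (\<alpha>, SOME l. \<exists>e\<in>g (\<alpha>, l). e \<noteq> 0))"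

lemma w_Wt: "x \<in> g p \<Longrightarrow> x \<noteq> 0 \<Longrightarrow> fst p \<noteq> 0 \<Longrightarrow> w (fst p) = Wt p"
proof -
  assume x: "x \<in> g p" "x \<noteq> 0" "fst p \<noteq> 0"
  have a: "fst p \<in> D" using g_\<Delta>[OF x(1,2)] x(3) by simp
  define P where "P l \<longleftrightarrow> (\<exists>e\<in>g (fst p, l). e \<noteq> 0)" for l
  define l where "l = (SOME l. P l)"
  have "\<exists>l. P l" using g_exists[of "fst p"] a unfolding P_def by blast
  then have "P l" unfolding l_def by (rule someI_ex)
  then obtain e where e: "e \<in> g (fst p, l)" "e \<noteq> 0" unfolding P_def by blast
  have "x \<in> g (fst p, snd p)" using x(1) by simp
  then have "Wt (fst p, l) = Wt (fst p, snd p)" by (rule Wt_indep[OF a e _ x(2)])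
  then show ?thesis using x(3) by (simp add: w_def l_def P_def)
qed

lemma mem_N: "x \<in> g p \<Longrightarrow> x \<noteq> 0 \<Longrightarrow> x \<in> N q \<longleftrightarrow> q \<le> w (fst p)"
proof (cases "fst p = 0")
  case True
  assume "x \<in> g p" "x \<noteq> 0"
  then show ?thesis using zero_part_N[of x "snd p" q] True by (metis prod.collapse w_def)
next
  case False
  assume "x \<in> g p" "x \<noteq> 0"
  then show ?thesis using Wt_mem False w_Wt by metis
qed

lemma w_Vals: "\<alpha> \<in> \<Delta> \<Longrightarrow> w \<alpha> \<in> Vals"
proof (cases "\<alpha> = 0")
  case True then show ?thesis using Vals_0 by (simp add: w_def)
next
  case False
  assume "\<alpha> \<in> \<Delta>"
  then obtain l e where "e \<in> g (\<alpha>, l)" "e \<noteq> 0" using g_exists by blast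
  then show ?thesis using w_Wt[of e "(\<alpha>, l)"] Wt(1)[of e "(\<alpha>, l)"] False by simp
qed

lemma w_neg: "\<alpha> \<in> \<Delta> \<Longrightarrow> w (- \<alpha>) = - w \<alpha>"
proof (cases "\<alpha> = 0")
  case True then show ?thesis by (simp add: w_def)
next
  case False
  assume "\<alpha> \<in> \<Delta>"
  then obtain l e where e: "e \<in> g (\<alpha>, l)" "e \<noteq> 0" using g_exists by blast
  obtain u where u: "u \<in> g (- (\<alpha>, l))" "u \<noteq> 0" using opposite_exists[OF e] False by auto
  show ?thesis using w_Wt[OF e] w_Wt[OF u] Wt_neg[OF e] False by simp
qed

lemma w_add_le:
  assumes "\<alpha> \<in> D" "\<beta> \<in> D" "R.cr \<alpha> \<beta> < 0"
  shows "\<beta> + \<alpha> \<in> \<Delta>" "w \<beta> + w \<alpha> \<le> w (\<beta> + \<alpha>)"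
proof -
  obtain l e where e: "e \<in> g (\<alpha>, l)" "e \<noteq> 0" using g_exists[of \<alpha>] assms by blast
  obtain m x where x: "x \<in> g (\<beta>, m)" "x \<noteq> 0" using g_exists[of \<beta>] assms by blast
  have "pair \<alpha> \<beta> < 0" using cr_pair[of \<alpha> \<beta>] assms by auto
  then have nz: "br e x \<noteq> 0" using br_nonzero[OF assms(1) e _ x(2)] g_L[OF x(1)] by simp
  have gx: "br e x \<in> g (\<beta> + \<alpha>, l + m)" using g_br[OF e(1) x(1)] by (simp add: add.commute)
  show "\<beta> + \<alpha> \<in> \<Delta>" using g_\<Delta>[OF gx nz] by simp
  have "br e x \<in> N (w \<alpha> + w \<beta>)" using mem_N[OF e] mem_N[OF x] by (intro N_br) auto
  then show "w \<beta> + w \<alpha> \<le> w (\<beta> + \<alpha>)" using mem_N[OF gx nz] by simp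
qed

text \<open>Nonzero brackets give only superadditivity; applied to the negatives of both roots,
  oddness of \<open>w\<close> turns it into the reverse inequality.\<close>

lemma w_add:
  assumes "\<alpha> \<in> D" "\<beta> \<in> D" "R.cr \<alpha> \<beta> < 0"
  shows "w (\<beta> + \<alpha>) = w \<beta> + w \<alpha>"
proof -
  have "R.cr (- \<alpha>) (- \<beta>) = R.cr \<alpha> \<beta>"
    using R.coroot_neg[OF assms(1), of "- \<beta>"] \<Delta>_span[of "- \<beta>"] neg_D[OF assms(2)] linear_neg[OF R.coroot_linear[OF assms(1)]] by simp
  then have "w (- \<beta>) + w (- \<alpha>) \<le> w (- \<beta> + - \<alpha>)"
    using w_add_le(2)[OF neg_D[OF assms(1)] neg_D[OF assms(2)]] assms(3) by simp
  moreover have "w (- \<beta> + - \<alpha>) = - w (\<beta> + \<alpha>)" using w_neg[OF w_add_le(1)[OF assms]] by (simp add: add.commute)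
  ultimately show ?thesis using w_neg[of \<alpha>] w_neg[of \<beta>] assms w_add_le(2)[OF assms] by simp
qed

definition pr :: "'v \<Rightarrow> 'w" where "pr \<alpha> = inv_into E h (w \<alpha>)"

lemma pr: "\<alpha> \<in> \<Delta> \<Longrightarrow> pr \<alpha> \<in> E \<and> h (pr \<alpha>) = w \<alpha>"
  using w_Vals[of \<alpha>] inv_into_into[of "w \<alpha>" h E] f_inv_into_f[of "w \<alpha>" h E] by (simp add: pr_def Vals_def)

lemma h_eq: "x \<in> root_lattice E \<Longrightarrow> y \<in> root_lattice E \<Longrightarrow> h x = h y \<Longrightarrow> x = y"
  using h_inj by (rule inj_onD)

lemma E_lattice: "\<beta> \<in> E \<Longrightarrow> \<beta> \<in> root_lattice E" by (rule root_lattice_base)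
lemma E_lattice_neg: "\<beta> \<in> E \<Longrightarrow> - \<beta> \<in> root_lattice E" using root_lattice_base E_neg by blast

lemma pr_eq: "\<alpha> \<in> \<Delta> \<Longrightarrow> \<beta> \<in> E \<Longrightarrow> h \<beta> = w \<alpha> \<Longrightarrow> pr \<alpha> = \<beta>"
  using h_eq[OF E_lattice E_lattice, of "pr \<alpha>" \<beta>] pr[of \<alpha>] by simp

text \<open>Injectivity of h on the root lattice lifts the identities for the real numbers
  \<open>w\<close> to identities between roots of the second system.\<close>

lemma pr_linear: "\<exists>W. linear W \<and> (\<forall>\<alpha>\<in>\<Delta>. W \<alpha> = pr \<alpha>)"
proof -
  have p0: "pr 0 = 0" using pr_eq[OF zero_\<Delta> E_0] linear_0[OF h_lin] by (simp add: w_def)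
  have "\<exists>W. linear W \<and> (\<forall>\<alpha>\<in>D. W \<alpha> = pr \<alpha>)"
  proof (rule R.string_additive_extends)
    show "pr 0 = 0" by (rule p0)
    show "pr (- \<alpha>) = - pr \<alpha>" if "\<alpha> \<in> D" for \<alpha>
      using pr_eq[of "- \<alpha>" "- pr \<alpha>"] pr[of \<alpha>] E_neg w_neg[of \<alpha>] that neg_D[OF that] linear_neg[OF h_lin] by simp
    fix \<alpha> \<beta> assume a: "\<alpha> \<in> D" "\<beta> \<in> D" "R.cr \<alpha> \<beta> < 0"
    have in\<Delta>: "\<beta> + \<alpha> \<in> \<Delta>" using w_add_le(1)[OF a] .
    have l: "pr \<alpha> \<in> E" "pr \<beta> \<in> E" "pr (\<beta> + \<alpha>) \<in> E" using pr a in\<Delta> by auto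
    have "pr \<beta> - - pr \<alpha> \<in> root_lattice E"
      by (rule root_lattice_diff[OF E_fin E_lattice[OF l(2)] E_lattice_neg[OF l(1)]])
    then have "pr (\<beta> + \<alpha>) = pr \<beta> - - pr \<alpha>"
      by (intro h_eq E_lattice[OF l(3)]) (use pr a in\<Delta> w_add[OF a] linear_add[OF h_lin] in simp_all)
    then show "\<beta> + \<alpha> \<in> insert 0 D \<and> pr (\<beta> + \<alpha>) = pr \<beta> + pr \<alpha>" using in\<Delta> by simp
  qed
  then obtain W where W: "linear W" "\<forall>\<alpha>\<in>D. W \<alpha> = pr \<alpha>" by blast
  then have "\<forall>\<alpha>\<in>\<Delta>. W \<alpha> = pr \<alpha>" using p0 linear_0[OF W(1)] by fastforce
  then show ?thesis using W(1) by blast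
qed

lemma N_decomposition: "N q = {x. \<exists>m. (\<forall>\<alpha>\<in>{\<alpha>\<in>\<Delta>. q \<le> w \<alpha>}. m \<alpha> \<in> L \<alpha>) \<and> x = sum m {\<alpha>\<in>\<Delta>. q \<le> w \<alpha>}}"
  (is "_ = ?R")
proof (intro set_eqI iffI)
  fix x assume x: "x \<in> N q"
  define P where "P = {p. co x p \<noteq> 0}"
  have P: "finite P" using co_fin by (simp add: P_def)
  have "fst ` P \<subseteq> {\<alpha>\<in>\<Delta>. q \<le> w \<alpha>}"
  proof
    fix \<alpha> assume "\<alpha> \<in> fst ` P"
    then obtain p where p: "\<alpha> = fst p" "co x p \<noteq> 0" by (auto simp: P_def simp del: split_paired_Ex)
    show "\<alpha> \<in> {\<alpha>\<in>\<Delta>. q \<le> w \<alpha>}"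
      using mem_N[OF co_in p(2), of q] N_co[OF x, of p] g_\<Delta>[OF co_in p(2)] p(1) by simp
  qed
  then have "x = (\<Sum>\<alpha>\<in>{\<alpha>\<in>\<Delta>. q \<le> w \<alpha>}. \<Sum>p\<in>{p\<in>P. fst p = \<alpha>}. co x p)"
    using sum.group[OF P, of "{\<alpha>\<in>\<Delta>. q \<le> w \<alpha>}" fst "co x"] fin_\<Delta> co_total[of x] by (simp add: P_def)
  moreover have "(\<Sum>p\<in>{p\<in>P. fst p = \<alpha>}. co x p) \<in> L \<alpha>" for \<alpha>
    using gmod_L g_L[OF co_in] by (intro C.cmod_sum) (auto simp: gmod_def)
  ultimately show "x \<in> ?R"
    by (intro CollectI exI[of _ "\<lambda>\<alpha>. \<Sum>p\<in>{p\<in>P. fst p = \<alpha>}. co x p"]) simp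
next
  fix x assume "x \<in> ?R"
  then obtain m where m: "\<And>\<alpha>. \<alpha> \<in> \<Delta> \<Longrightarrow> q \<le> w \<alpha> \<Longrightarrow> m \<alpha> \<in> L \<alpha>" "x = sum m {\<alpha>\<in>\<Delta>. q \<le> w \<alpha>}" by blast
  have "L \<alpha> \<subseteq> N q" if "q \<le> w \<alpha>" for \<alpha>
  proof (rule gmod_subset[OF N_cmod])
    fix p x assume "x \<in> L \<alpha>"
    then have "co x p \<noteq> 0 \<longrightarrow> fst p = \<alpha>" unfolding L_iff by blast
    then show "co x p \<in> N q"
      using mem_N[OF co_in, of x p q] that C.cmod_0[OF N_cmod] by (cases "co x p = 0") auto
  qed
  then show "x \<in> N q" unfolding m(2) using m(1) by (intro C.cmod_sum[OF N_cmod]) blast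
qed

lemma rk_N: "rk (N q) = (\<Sum>\<alpha>\<in>{\<alpha>\<in>\<Delta>. q \<le> w \<alpha>}. rk (L \<alpha>))"
proof -
  have "\<exists>b. cbasis Cc (L \<alpha>) b" for \<alpha> using ex_hom_basis[OF gmod_L] by metis
  then obtain b where b: "\<And>\<alpha>. cbasis Cc (L \<alpha>) (b \<alpha>)" by metis
  have "cbasis Cc (N q) (\<Union>\<alpha>\<in>{\<alpha>\<in>\<Delta>. q \<le> w \<alpha>}. b \<alpha>) \<and>
      card (\<Union>\<alpha>\<in>{\<alpha>\<in>\<Delta>. q \<le> w \<alpha>}. b \<alpha>) = (\<Sum>\<alpha>\<in>{\<alpha>\<in>\<Delta>. q \<le> w \<alpha>}. card (b \<alpha>))"
    unfolding N_decomposition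
    by (rule C.direct_sum_basis) (use b fin_\<Delta> L_direct[of "{\<alpha>\<in>\<Delta>. q \<le> w \<alpha>}"] in auto)
  then show ?thesis using C.crank_eq b by (metis (no_types, lifting) sum.cong)
qed

text \<open>Between two levels just below and just above \<open>h \<beta>\<close>, the rank of
  \<open>N\<close> drops by both sides of the equation: once counted through \<open>f\<close>, once
  through the root spaces of the first torus.\<close>

lemma card_B:
  assumes b: "\<beta> \<in> E"
  shows "card (B \<beta>) = (\<Sum>\<alpha>\<in>{\<alpha>\<in>\<Delta>. pr \<alpha> = \<beta>}. rk (L \<alpha>))"
proof -
  define v where "v = h \<beta>"
  obtain \<epsilon> where e: "\<epsilon> > 0" "\<And>u. u \<in> Vals \<Longrightarrow> u \<noteq> v \<Longrightarrow> \<epsilon> < \<bar>u - v\<bar>" using gap by metis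
  have n: "v - \<epsilon> \<notin> Vals" "v + \<epsilon> \<notin> Vals" using e(1) e(2)[of "v - \<epsilon>"] e(2)[of "v + \<epsilon>"] by auto
  have lo: "v - \<epsilon> \<le> u \<longleftrightarrow> u = v \<or> v + \<epsilon> \<le> u" if "u \<in> Vals" for u using e(1) e(2)[OF that] by force
  have neq: "\<not> v + \<epsilon> \<le> v" using e(1) by simp
  have hb: "h \<gamma> = v \<longleftrightarrow> \<gamma> = \<beta>" if "\<gamma> \<in> E" for \<gamma>
    using h_eq[OF E_lattice[OF that] E_lattice[OF b]] by (auto simp: v_def)
  have "Eq (v - \<epsilon>) = insert \<beta> (Eq (v + \<epsilon>))"
    using lo hb b by (auto simp: Eq_def Vals_def v_def)
  moreover have "\<beta> \<notin> Eq (v + \<epsilon>)" using neq by (simp add: Eq_def v_def)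
  ultimately have f: "f (v - \<epsilon>) = card (B \<beta>) + f (v + \<epsilon>)" using Eq_fin by (simp add: f_def)
  have prv: "w \<alpha> = v \<longleftrightarrow> pr \<alpha> = \<beta>" if "\<alpha> \<in> \<Delta>" for \<alpha> using pr[OF that] hb[of "pr \<alpha>"] by simp
  have "{\<alpha>\<in>\<Delta>. v - \<epsilon> \<le> w \<alpha>} = {\<alpha>\<in>\<Delta>. pr \<alpha> = \<beta>} \<union> {\<alpha>\<in>\<Delta>. v + \<epsilon> \<le> w \<alpha>}"
    using lo[OF w_Vals] prv by blast
  moreover have "{\<alpha>\<in>\<Delta>. pr \<alpha> = \<beta>} \<inter> {\<alpha>\<in>\<Delta>. v + \<epsilon> \<le> w \<alpha>} = {}" using prv neq by force
  ultimately have "rk (N (v - \<epsilon>)) = (\<Sum>\<alpha>\<in>{\<alpha>\<in>\<Delta>. pr \<alpha> = \<beta>}. rk (L \<alpha>)) + rk (N (v + \<epsilon>))"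
    unfolding rk_N using fin_\<Delta> by (simp add: sum.union_disjoint)
  then show ?thesis using rank_f[OF n(1)] rank_f[OF n(2)] f by simp
qed

theorem comparison:
  "\<exists>\<pi>. linear \<pi> \<and> \<pi> ` \<Delta> = E \<and> (\<forall>\<beta>\<in>E. card (B \<beta>) = (\<Sum>\<alpha>\<in>{\<alpha>\<in>\<Delta>. \<pi> \<alpha> = \<beta>}. rk (L \<alpha>)))"
proof -
  obtain W where W: "linear W" "\<forall>\<alpha>\<in>\<Delta>. W \<alpha> = pr \<alpha>" using pr_linear by blast
  have c: "card (B \<beta>) = (\<Sum>\<alpha>\<in>{\<alpha>\<in>\<Delta>. W \<alpha> = \<beta>}. rk (L \<alpha>))" if "\<beta> \<in> E" for \<beta>
  proof -
    have "{\<alpha>\<in>\<Delta>. W \<alpha> = \<beta>} = {\<alpha>\<in>\<Delta>. pr \<alpha> = \<beta>}" using W(2) by auto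
    then show ?thesis using card_B[OF that] by simp
  qed
  have "\<beta> \<in> W ` \<Delta>" if "\<beta> \<in> E" for \<beta>
  proof (rule ccontr)
    assume "\<beta> \<notin> W ` \<Delta>"
    then have e: "{\<alpha>\<in>\<Delta>. W \<alpha> = \<beta>} = {}" by blast
    show False using c[OF that] B_pos[OF that] unfolding e by simp
  qed
  then have "W ` \<Delta> = E" using W(2) pr by auto
  then show ?thesis using W(1) c by blast
qed

end

section \<open>Transport along an isomorphism\<close>

lemma dim_image_finite_le:
  fixes f :: "'v::real_vector \<Rightarrow> 'w::real_vector"
  assumes f: "linear f" and X: "finite X"
  shows "dim (f ` X) \<le> dim X"
proof -
  obtain B where B: "B \<subseteq> X" "independent B" "X \<subseteq> span B" using maximal_independent_subset by metis
  have fin: "finite B" using B(1) X finite_subset by blast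
  have "f ` X \<subseteq> span (f ` B)" using B(3) linear_span_image[OF f, of B] by blast
  then have "dim (f ` X) \<le> card (f ` B)" using fin by (intro dim_le_card) auto
  also have "\<dots> \<le> card B" by (rule card_image_le[OF fin])
  also have "\<dots> = dim X" by (rule basis_card_eq_dim[OF B(1,3,2)])
  finally show ?thesis .
qed

text \<open>The map back shows that dimension is not lost, so the image of a basis of X must have as
  many independent elements as the basis itself.\<close>

lemma mutual_surjection_inj:
  fixes f :: "'v::real_vector \<Rightarrow> 'w::real_vector"
  assumes f: "linear f" "f ` X = Y" and h: "linear h" "h ` Y = X" and X: "finite X"
  shows "inj_on f (span X)"
proof -
  have Y: "finite Y" using f(2) X by blast
  obtain B where B: "B \<subseteq> X" "independent B" "X \<subseteq> span B" using maximal_independent_subset by metis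
  have fin: "finite B" using B(1) X finite_subset by blast
  obtain A where A: "A \<subseteq> f ` B" "independent A" "f ` B \<subseteq> span A" using maximal_independent_subset by metis
  have "Y \<subseteq> span (f ` B)" using f(2) B(3) linear_span_image[OF f(1), of B] by blast
  also have "\<dots> \<subseteq> span A" using A(3) span_mono[of "f ` B" "span A"] by (simp add: span_span)
  finally have YA: "Y \<subseteq> span A" .
  have AY: "A \<subseteq> Y" using A(1) B(1) f(2) by blast
  have "card B = dim X" by (rule basis_card_eq_dim[OF B(1,3,2)])
  also have "\<dots> \<le> dim Y" using dim_image_finite_le[OF h(1) Y] h(2) by simp
  also have "dim Y = card A" using basis_card_eq_dim[OF AY YA A(2)] by simp
  finally have BA: "card B \<le> card A" .
  have "card A \<le> card (f ` B)" using A(1) fin by (intro card_mono) auto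
  moreover have "card (f ` B) \<le> card B" by (rule card_image_le[OF fin])
  ultimately have e: "card (f ` B) = card B" "card A = card (f ` B)" using BA by simp_all
  have "A = f ` B" using card_subset_eq[OF _ A(1) e(2)] fin by simp
  then have "independent (f ` B)" using A(2) by simp
  moreover have "inj_on f B" by (rule eq_card_imp_inj_on[OF fin e(1)])
  ultimately have "inj_on f (span B)" by (rule linear_inj_on_span_independent_image[OF f(1)])
  moreover have "span X \<subseteq> span B" using B(3) span_mono[of X "span B"] by (simp add: span_span)
  ultimately show ?thesis by (rule inj_on_subset)
qed

lemma lie_alg_iso_inv:
  assumes "lie_alg_iso sc br sc' br' \<phi>"
  shows "lie_alg_iso sc' br' sc br (inv \<phi>)"
proof -
  have b: "bij \<phi>" and a: "\<And>x y. \<phi> (x + y) = \<phi> x + \<phi> y" "\<And>a x. \<phi> (sc a x) = sc' a (\<phi> x)"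
    "\<And>x y. \<phi> (br x y) = br' (\<phi> x) (\<phi> y)" using assms by (auto simp: lie_alg_iso_def)
  have i: "inv \<phi> (\<phi> x) = x" "\<phi> (inv \<phi> y) = y" for x y
    using b by (auto simp: bij_def surj_f_inv_f)
  show ?thesis unfolding lie_alg_iso_def
  proof (intro conjI allI)
    show "bij (inv \<phi>)" by (rule bij_imp_bij_inv[OF b])
    show "inv \<phi> (x + y) = inv \<phi> x + inv \<phi> y" for x y by (metis a(1) i)
    show "inv \<phi> (sc' c x) = sc c (inv \<phi> x)" for c x by (metis a(2) i)
    show "inv \<phi> (br' x y) = br (inv \<phi> x) (inv \<phi> y)" for x y by (metis a(3) i)
  qed
qed

locale lie_iso =
  fixes sc :: "'k::field \<Rightarrow> 'a::ab_group_add \<Rightarrow> 'a" and br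
    and sc' :: "'k \<Rightarrow> 'b::ab_group_add \<Rightarrow> 'b" and br' and \<phi> :: "'a \<Rightarrow> 'b"
  assumes iso: "lie_alg_iso sc br sc' br' \<phi>"
begin

lemma \<phi>_bij: "bij \<phi>" and \<phi>_add: "\<phi> (x + y) = \<phi> x + \<phi> y" and \<phi>_sc: "\<phi> (sc a x) = sc' a (\<phi> x)"
  and \<phi>_br: "\<phi> (br x y) = br' (\<phi> x) (\<phi> y)"
  using iso by (auto simp: lie_alg_iso_def)

lemma \<phi>_inv [simp]: "inv \<phi> (\<phi> x) = x" "\<phi> (inv \<phi> y) = y"
  using \<phi>_bij by (auto simp: bij_def surj_f_inv_f)

lemma \<phi>_inj: "inj_on \<phi> A" using \<phi>_bij by (meson bij_def inj_on_subset subset_UNIV)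

lemma \<phi>_0: "\<phi> 0 = 0" using \<phi>_add[of 0 0] by simp
lemma \<phi>_sum: "\<phi> (sum f A) = (\<Sum>i\<in>A. \<phi> (f i))"
  by (induction A rule: infinite_finite_induct) (auto simp: \<phi>_0 \<phi>_add)

definition conj :: "('a \<Rightarrow> 'a) \<Rightarrow> 'b \<Rightarrow> 'b" where "conj c y = \<phi> (c (inv \<phi> y))"

lemma lie_iso_inv: "lie_iso sc' br' sc br (inv \<phi>)"
  by unfold_locales (rule lie_alg_iso_inv[OF iso])

end

context lie_iso
begin

interpretation I: lie_iso sc' br' sc br "inv \<phi>" by (rule lie_iso_inv)

lemma inv_inv: "inv (inv \<phi>) = \<phi>" using \<phi>_bij by (rule inv_inv_eq)

lemma conj_centroid: "c \<in> centroid sc br \<Longrightarrow> conj c \<in> centroid sc' br'"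
proof -
  assume "c \<in> centroid sc br"
  then have c: "\<And>x y. c (x + y) = c x + c y" "\<And>a x. c (sc a x) = sc a (c x)"
    "\<And>x y. c (br x y) = br (c x) y" "\<And>x y. c (br x y) = br x (c y)" unfolding centroid_def by blast+
  show ?thesis unfolding centroid_def
  proof (intro CollectI conjI allI)
    show "conj c (x + y) = conj c x + conj c y" for x y by (simp add: conj_def I.\<phi>_add c(1) \<phi>_add)
    show "conj c (sc' a x) = sc' a (conj c x)" for a x by (simp add: conj_def I.\<phi>_sc c(2) \<phi>_sc)
    show "conj c (br' x y) = br' (conj c x) y" for x y by (simp add: conj_def I.\<phi>_br c(3) \<phi>_br)
    show "conj c (br' x y) = br' x (conj c y)" for x y by (simp add: conj_def I.\<phi>_br c(4) \<phi>_br)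
  qed
qed

lemma conj_conj: "I.conj (conj c) = c" "conj (I.conj d) = d"
  by (simp_all add: conj_def I.conj_def inv_inv fun_eq_iff)

lemma conj_comp: "conj (\<lambda>x. c (d x)) = (\<lambda>x. conj c (conj d x))" by (simp add: conj_def fun_eq_iff)

lemma conj_0: "conj c = (\<lambda>_. 0) \<longleftrightarrow> c = (\<lambda>_. 0)"
proof
  assume a: "conj c = (\<lambda>_. 0)"
  have "c x = inv \<phi> (conj c (\<phi> x))" for x by (simp add: conj_def)
  then show "c = (\<lambda>_. 0)" unfolding a by (simp add: I.\<phi>_0 fun_eq_iff)
qed (simp add: conj_def \<phi>_0 fun_eq_iff)

end

context lie_iso
begin

interpretation I: lie_iso sc' br' sc br "inv \<phi>" by (rule lie_iso_inv)

text \<open>Conjugation by \<phi> identifies the two centroids, so coefficients of a combination can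
  be carried in either direction.\<close>

lemma cbasis_iso:
  assumes b: "cbasis (centroid sc br) M B"
  shows "cbasis (centroid sc' br') (\<phi> ` M) (\<phi> ` B)"
proof -
  have fin: "finite B" and M: "M = {x. \<exists>c. (\<forall>b\<in>B. c b \<in> centroid sc br) \<and> x = (\<Sum>b\<in>B. c b b)}"
    and ind: "\<And>c. (\<forall>b\<in>B. c b \<in> centroid sc br) \<Longrightarrow> (\<Sum>b\<in>B. c b b) = 0 \<Longrightarrow> (\<forall>b\<in>B. c b = (\<lambda>_. 0))"
    using b unfolding cbasis_def by blast+
  have s: "(\<Sum>b\<in>\<phi> ` B. d b b) = \<phi> (\<Sum>b\<in>B. I.conj (d (\<phi> b)) b)" for d
    by (simp add: sum.reindex[OF \<phi>_inj] \<phi>_sum I.conj_def inv_inv)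
  have C: "I.conj d \<in> centroid sc br \<longleftrightarrow> d \<in> centroid sc' br'" for d
    using conj_centroid[of "I.conj d"] I.conj_centroid[of d] by (auto simp: conj_conj)
  show ?thesis unfolding cbasis_def
  proof (intro conjI allI impI)
    show "finite (\<phi> ` B)" using fin by simp
    show "\<phi> ` M = {x. \<exists>c. (\<forall>b\<in>\<phi> ` B. c b \<in> centroid sc' br') \<and> x = (\<Sum>b\<in>\<phi> ` B. c b b)}"
    proof (intro set_eqI iffI)
      fix y assume "y \<in> \<phi> ` M"
      then obtain c where c: "\<forall>b\<in>B. c b \<in> centroid sc br" "y = \<phi> (\<Sum>b\<in>B. c b b)" unfolding M by blast
      define d where "d b = conj (c (inv \<phi> b))" for b
      have "y = (\<Sum>b\<in>\<phi> ` B. d b b)" unfolding s c(2) by (simp add: d_def conj_conj)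
      moreover have "\<forall>b\<in>\<phi> ` B. d b \<in> centroid sc' br'" using c(1) conj_centroid by (auto simp: d_def)
      ultimately show "y \<in> {x. \<exists>c. (\<forall>b\<in>\<phi> ` B. c b \<in> centroid sc' br') \<and> x = (\<Sum>b\<in>\<phi> ` B. c b b)}" by blast
    next
      fix y assume "y \<in> {x. \<exists>c. (\<forall>b\<in>\<phi> ` B. c b \<in> centroid sc' br') \<and> x = (\<Sum>b\<in>\<phi> ` B. c b b)}"
      then obtain d where d: "\<forall>b\<in>\<phi> ` B. d b \<in> centroid sc' br'" "y = (\<Sum>b\<in>\<phi> ` B. d b b)" by blast
      define c where "c b = I.conj (d (\<phi> b))" for b
      have "\<forall>b\<in>B. c b \<in> centroid sc br" using d(1) C by (simp add: c_def)
      then have "(\<Sum>b\<in>B. c b b) \<in> M" unfolding M by blast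
      moreover have "y = \<phi> (\<Sum>b\<in>B. c b b)" using d(2) s by (simp add: c_def)
      ultimately show "y \<in> \<phi> ` M" by blast
    qed
    fix d assume d: "(\<forall>b\<in>\<phi> ` B. d b \<in> centroid sc' br') \<and> (\<Sum>b\<in>\<phi> ` B. d b b) = 0"
    then have "\<phi> (\<Sum>b\<in>B. I.conj (d (\<phi> b)) b) = \<phi> 0" unfolding s \<phi>_0 by simp
    then have "(\<Sum>b\<in>B. I.conj (d (\<phi> b)) b) = 0" by (rule injD[OF \<phi>_inj])
    then have "\<forall>b\<in>B. I.conj (d (\<phi> b)) = (\<lambda>_. 0)" using ind[of "\<lambda>b. I.conj (d (\<phi> b))"] d C by blast
    then show "\<forall>b\<in>\<phi> ` B. d b = (\<lambda>_. 0)" using I.conj_0 by auto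
  qed
qed

end

lemma second_grading_comparison:
  fixes sc :: "'k::field_char_0 \<Rightarrow> 'a::ab_group_add \<Rightarrow> 'a" and sc' :: "'k \<Rightarrow> 'b::ab_group_add \<Rightarrow> 'b"
    and \<Delta> :: "'v::real_vector set" and \<Delta>' :: "'w::real_vector set"
  assumes T: "fgc_lie_torus sc br \<Delta> n gr" and T': "fgc_lie_torus sc' br' \<Delta>' n' gr'"
    and iso: "lie_iso sc br sc' br' \<phi>"
  shows "\<exists>\<pi>. linear \<pi> \<and> \<pi> ` \<Delta> = \<Delta>' \<and> (\<forall>\<beta>\<in>\<Delta>'. crank (centroid sc' br') (root_space gr' \<beta>) =
    (\<Sum>\<alpha>\<in>{\<alpha>\<in>\<Delta>. \<pi> \<alpha> = \<beta>}. crank (centroid sc br) (root_space gr \<alpha>)))"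
proof -
  interpret A: fgc_lie_torus sc br \<Delta> n gr by (rule T)
  interpret B: fgc_lie_torus sc' br' \<Delta>' n' gr' by (rule T')
  interpret lie_iso sc br sc' br' \<phi> by (rule iso)
  interpret I: lie_iso sc' br' sc br "inv \<phi>" by (rule lie_iso_inv)
  have "\<exists>b. cbasis B.Cc (B.L \<beta>) b" for \<beta> using B.ex_hom_basis[OF B.gmod_L] by metis
  then obtain b where b: "\<And>\<beta>. cbasis B.Cc (B.L \<beta>) (b \<beta>)" by metis
  have cb: "card (inv \<phi> ` b \<beta>) = B.rk (B.L \<beta>)" for \<beta>
    using B.C.crank_eq[OF b[of \<beta>]] by (simp add: card_image[OF I.\<phi>_inj])
  \<comment> \<open>Only the root part of a generic functional is wanted here, hence the lattice of
    rank 0.\<close>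
  obtain h :: "'w \<Rightarrow> real" and k where hk: "linear h" "inj_on (\<lambda>p. h (fst p) + k (snd p)) (root_lattice \<Delta>' \<times> lat 0)"
    by (rule generic_functional[OF B.fin_\<Delta>, of 0]) blast
  have hinj: "inj_on h (root_lattice \<Delta>')"
  proof (rule inj_onI)
    fix x y assume xy: "x \<in> root_lattice \<Delta>'" "y \<in> root_lattice \<Delta>'" "h x = h y"
    then have "(x, (\<lambda>_. 0) :: nat \<Rightarrow> int) = (y, (\<lambda>_. 0))" by (intro inj_onD[OF hk(2)]) (auto simp: lat_def)
    then show "x = y" by simp
  qed
  have "second_grading sc br \<Delta> n gr \<Delta>' (\<lambda>\<beta>. inv \<phi> ` B.L \<beta>) (\<lambda>\<beta>. inv \<phi> ` b \<beta>) h"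
  proof (intro second_grading.intro second_grading_axioms.intro T)
    show "finite \<Delta>'" "0 \<in> \<Delta>'" by (rule B.fin_\<Delta> B.zero_\<Delta>)+
    show "- \<beta> \<in> \<Delta>'" if "\<beta> \<in> \<Delta>'" for \<beta> using B.neg_D[of \<beta>] that by (cases "\<beta> = 0") auto
    show "inv \<phi> ` B.L \<beta> = {0}" if "\<beta> \<notin> \<Delta>'" for \<beta> using B.LT1[of \<beta>] that by (simp add: I.\<phi>_0)
    show "\<exists>m. (\<forall>\<beta>\<in>\<Delta>'. m \<beta> \<in> inv \<phi> ` B.L \<beta>) \<and> x = sum m \<Delta>'" for x
    proof -
      obtain m where "\<forall>\<alpha>\<in>\<Delta>'. m \<alpha> \<in> B.L \<alpha>" "\<phi> x = sum m \<Delta>'" using B.L_sum by blast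
      then show ?thesis using I.\<phi>_sum[of m \<Delta>'] \<phi>_inv(1)[of x] by (intro exI[of _ "\<lambda>\<beta>. inv \<phi> (m \<beta>)"]) simp
    qed
    show "m \<beta> = 0" if m: "\<And>\<beta>. \<beta> \<in> \<Delta>' \<Longrightarrow> m \<beta> \<in> inv \<phi> ` B.L \<beta>" "sum m \<Delta>' = 0" "\<beta> \<in> \<Delta>'" for m \<beta>
    proof -
      have "\<phi> (m \<gamma>) \<in> B.L \<gamma>" if "\<gamma> \<in> \<Delta>'" for \<gamma> using m(1)[OF that] by auto
      moreover have "(\<Sum>\<gamma>\<in>\<Delta>'. \<phi> (m \<gamma>)) = 0" using \<phi>_sum[of m \<Delta>'] m(2) \<phi>_0 by simp
      ultimately have "\<phi> (m \<beta>) = \<phi> 0" using B.L_direct[of \<Delta>' "\<lambda>\<gamma>. \<phi> (m \<gamma>)" \<beta>] m(3) \<phi>_0 by simp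
      then show ?thesis by (rule injD[OF \<phi>_inj])
    qed
    show "br x y \<in> inv \<phi> ` B.L (\<beta> + \<gamma>)" if "x \<in> inv \<phi> ` B.L \<beta>" "y \<in> inv \<phi> ` B.L \<gamma>" for x y \<beta> \<gamma>
      using that B.L_br by (auto simp flip: I.\<phi>_br)
    show "cbasis A.Cc (inv \<phi> ` B.L \<beta>) (inv \<phi> ` b \<beta>)" for \<beta> by (rule I.cbasis_iso[OF b])
    show "card (inv \<phi> ` b (- \<beta>)) = card (inv \<phi> ` b \<beta>)" if "\<beta> \<in> \<Delta>'" for \<beta> using cb B.rk_neg[OF that] by simp
    show "card (inv \<phi> ` b \<beta>) > 0" if "\<beta> \<in> \<Delta>'" for \<beta> using cb B.rk_pos[OF that] by simp
    show "linear h" by (rule hk(1))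
    show "inj_on h (root_lattice \<Delta>')" by (rule hinj)
  qed
  then interpret second_grading sc br \<Delta> n gr \<Delta>' "\<lambda>\<beta>. inv \<phi> ` B.L \<beta>" "\<lambda>\<beta>. inv \<phi> ` b \<beta>" h .
  show ?thesis using comparison unfolding cb by simp
qed

section \<open>Nullity\<close>

definition zmul :: "int \<Rightarrow> (nat \<Rightarrow> int) \<Rightarrow> nat \<Rightarrow> int" where "zmul a l = (\<lambda>i. a * l i)"

text \<open>With the integers as scalars the exchange lemma bounds ranks of subgroups of a
  lattice.\<close>

interpretation Z: endo_ring "range zmul"
proof unfold_locales
  fix c d x y assume c: "c \<in> range zmul"
  then obtain a where a: "c = zmul a" by auto
  show "c (x + y) = c x + c y" by (simp add: a zmul_def fun_eq_iff algebra_simps)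
  have "(\<lambda>x. - c x) = zmul (- a)" by (simp add: a zmul_def fun_eq_iff)
  then show "(\<lambda>x. - c x) \<in> range zmul" by simp
  show "c = (\<lambda>_. 0)" if x: "c x = 0" "x \<noteq> 0"
  proof -
    obtain i where "x i \<noteq> 0" using x(2) by (auto simp: fun_eq_iff)
    moreover have "a * x i = 0" using fun_cong[OF x(1), of i] by (simp add: a zmul_def)
    ultimately show ?thesis by (simp add: a zmul_def fun_eq_iff)
  qed
  assume "d \<in> range zmul"
  then obtain b where b: "d = zmul b" by auto
  have "(\<lambda>x. c x + d x) = zmul (a + b)" by (simp add: a b zmul_def fun_eq_iff algebra_simps)
  then show "(\<lambda>x. c x + d x) \<in> range zmul" by simp
  have "(\<lambda>x. c (d x)) = zmul (a * b)" by (simp add: a b zmul_def fun_eq_iff)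
  then show "(\<lambda>x. c (d x)) \<in> range zmul" by simp
  show "c (d x) = d (c x)" by (simp add: a b zmul_def fun_eq_iff)
next
  have "(\<lambda>x. x) = zmul 1" by (simp add: zmul_def fun_eq_iff)
  then show "(\<lambda>x. x) \<in> range zmul" by simp
  show "\<exists>x::nat \<Rightarrow> int. x \<noteq> 0" by (rule exI[of _ "\<lambda>_. 1"]) (simp add: fun_eq_iff)
qed

lemma independent_in_lat:
  fixes v :: "nat \<Rightarrow> nat \<Rightarrow> int"
  assumes v: "\<And>i. i < n \<Longrightarrow> v i \<in> lat m"
    and ind: "\<And>a. (\<Sum>i<n. zmul (a i) (v i)) = 0 \<Longrightarrow> (\<And>i. i < n \<Longrightarrow> a i = 0)"
  shows "n \<le> m"
proof -
  define \<delta> where "\<delta> j = (\<lambda>i::nat. if i = j then 1 else 0 :: int)" for j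
  have inj: "inj_on \<delta> {..<m}" by (auto simp: inj_on_def \<delta>_def fun_eq_iff split: if_splits)
  have "Z.cfree {..<n} v"
    unfolding Z.cfree_def
  proof (intro conjI allI impI)
    fix c assume c: "(\<forall>i\<in>{..<n}. c i \<in> range zmul) \<and> (\<Sum>i<n. c i (v i)) = 0"
    then have "\<forall>i. \<exists>a. i < n \<longrightarrow> c i = zmul a" by auto
    then obtain a where a: "\<And>i. i < n \<Longrightarrow> c i = zmul (a i)" by metis
    have "(\<Sum>i<n. zmul (a i) (v i)) = (\<Sum>i<n. c i (v i))" by (rule sum.cong) (use a in auto)
    then have "a i = 0" if "i < n" for i using ind[of a i] c that by simp
    then show "\<forall>i\<in>{..<n}. c i = (\<lambda>_. 0)" using a by (simp add: zmul_def fun_eq_iff)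
  qed simp
  moreover have "v i \<in> Z.cspan (\<delta> ` {..<m})" if i: "i \<in> {..<n}" for i
  proof -
    have "v i = (\<Sum>j<m. zmul (v i j) (\<delta> j))"
    proof
      fix k
      have "(\<Sum>j<m. zmul (v i j) (\<delta> j)) k = (\<Sum>j<m. if j = k then v i j else 0)"
        by (induction m) (auto simp: zmul_def \<delta>_def)
      then show "v i k = (\<Sum>j<m. zmul (v i j) (\<delta> j)) k" using v[of i] i by (auto simp: lat_def)
    qed
    moreover have "(\<Sum>j<m. zmul (v i j) (\<delta> j)) \<in> Z.cspan (\<delta> ` {..<m})"
      using Z.cspan_base[of "\<delta> ` {..<m}"]
      by (intro Z.cmod_sum[OF Z.cmod_cspan] Z.cmod_C[OF Z.cmod_cspan rangeI]) auto
    ultimately show ?thesis by simp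
  qed
  ultimately have "card {..<n} \<le> card (\<delta> ` {..<m})" by (intro Z.steinitz) auto
  then show ?thesis using inj by (simp add: card_image)
qed

text \<open>Up to scalars the units of the centroid form the group of its degrees, which has finite
  index in the grading lattice.\<close>
lemma nullity_le:
  fixes sc :: "'k::field_char_0 \<Rightarrow> 'a::ab_group_add \<Rightarrow> 'a" and sc' :: "'k \<Rightarrow> 'b::ab_group_add \<Rightarrow> 'b"
    and \<Delta> :: "'v::real_vector set" and \<Delta>' :: "'w::real_vector set"
  assumes T: "fgc_lie_torus sc br \<Delta> n gr" and T': "fgc_lie_torus sc' br' \<Delta>' n' gr'"
    and iso: "lie_iso sc br sc' br' \<phi>"
  shows "n \<le> n'"
proof -
  interpret A: fgc_lie_torus sc br \<Delta> n gr by (rule T)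
  interpret B: fgc_lie_torus sc' br' \<Delta>' n' gr' by (rule T')
  interpret lie_iso sc br sc' br' \<phi> by (rule iso)
  interpret I: lie_iso sc' br' sc br "inv \<phi>" by (rule lie_iso_inv)
  have "\<forall>l. \<exists>u. l \<in> A.\<Gamma> \<longrightarrow> u \<in> A.Ch (0, l) \<and> u \<noteq> (\<lambda>_. 0)" by (auto simp: A.\<Gamma>_def)
  then obtain u where u: "\<And>l. l \<in> A.\<Gamma> \<Longrightarrow> u l \<in> A.Ch (0, l)" "\<And>l. l \<in> A.\<Gamma> \<Longrightarrow> u l \<noteq> (\<lambda>_. 0)" by metis
  \<comment> \<open>A homogeneous unit becomes a unit of the other centroid, and units there are
    homogeneous. This defines a map \<theta> on degrees although the isomorphism respects neither
    grading.\<close>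
  have "\<exists>k. conj (u l) \<in> B.Ch (0, k)" if l: "l \<in> A.\<Gamma>" for l
  proof -
    obtain d where d: "d \<in> A.Ch (- (0, l))" "\<And>x. u l (d x) = x" using A.Ch_inverse[OF u[OF l]] by metis
    have "conj (u l) (conj d y) = y" for y using d(2) by (simp add: conj_def)
    then obtain \<gamma> where g: "conj (u l) \<in> B.Ch \<gamma>"
      using B.unit_homogeneous[OF conj_centroid[OF A.Ch_Cc[OF u(1)[OF l]]] conj_centroid[OF A.Ch_Cc[OF d(1)]]] by blast
    have "fst \<gamma> = 0" using B.Ch_fst[OF g] u(2)[OF l] conj_0 by blast
    then have "\<gamma> = (0, snd \<gamma>)" by (intro prod_eqI) simp_all
    then show ?thesis using g by metis
  qed
  then obtain \<theta> where \<theta>: "\<And>l. l \<in> A.\<Gamma> \<Longrightarrow> conj (u l) \<in> B.Ch (0, \<theta> l)" by metis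
  \<comment> \<open>Homogeneous elements of one degree are proportional, so \<theta> does not depend
    on the representative \<open>u l\<close>.\<close>
  have deg: "conj c \<in> B.Ch (0, \<theta> l)" if c: "c \<in> A.Ch (0, l)" "l \<in> A.\<Gamma>" for c l
  proof -
    obtain a where a: "\<forall>x. c x = sc a (u l x)" using A.Ch_proportional[OF u(1)[OF c(2)] c(1) u(2)[OF c(2)]] by blast
    then have "conj c = (\<lambda>x. sc' a (conj (u l) x))" by (simp add: conj_def \<phi>_sc fun_eq_iff)
    then show ?thesis using B.Ch_comp[OF B.Ch_scale \<theta>[OF c(2)], of a] by simp
  qed
  have \<theta>_unique: "\<theta> l = k" if "c \<in> A.Ch (0, l)" "c \<noteq> (\<lambda>_. 0)" "l \<in> A.\<Gamma>" "conj c \<in> B.Ch (0, k)" for c l k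
    using B.Ch_degree_unique[OF deg[OF that(1,3)] that(4)] that(2) conj_0 by blast
  have \<theta>_add: "\<theta> (l + m) = \<theta> l + \<theta> m" if l: "l \<in> A.\<Gamma>" and m: "m \<in> A.\<Gamma>" for l m
  proof (rule \<theta>_unique)
    show "(\<lambda>x. u l (u m x)) \<in> A.Ch (0, l + m)" using A.Ch_comp[OF u(1)[OF l] u(1)[OF m]] by simp
    show "(\<lambda>x. u l (u m x)) \<noteq> (\<lambda>_. 0)"
      using A.C.C_domain[OF A.Ch_Cc[OF u(1)[OF l]] A.Ch_Cc[OF u(1)[OF m]]] u(2) l m by blast
    show "l + m \<in> A.\<Gamma>" by (rule A.\<Gamma>_add[OF l m])
    show "conj (\<lambda>x. u l (u m x)) \<in> B.Ch (0, \<theta> l + \<theta> m)"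
      unfolding conj_comp using B.Ch_comp[OF \<theta>[OF l] \<theta>[OF m]] by simp
  qed
  \<comment> \<open>A unit that becomes homogeneous of degree 0 is a scalar there, hence a scalar
    already on the first side.\<close>
  have \<theta>_inj: "l = 0" if l: "l \<in> A.\<Gamma>" "\<theta> l = 0" for l
  proof -
    have "conj (u l) \<in> B.Ch 0" using \<theta>[OF l(1)] l(2) by (simp add: zero_prod_def)
    then obtain a where a: "conj (u l) = sc' a" using B.Ch_0_scalar by blast
    have "u l x = sc a x" for x
    proof -
      have "\<phi> (u l x) = \<phi> (sc a x)" using fun_cong[OF a, of "\<phi> x"] by (simp add: conj_def \<phi>_sc)
      then show ?thesis by (rule injD[OF \<phi>_inj])
    qed
    then have "u l = sc a" by (rule ext)
    then have "u l \<in> A.Ch 0" using A.Ch_scale by simp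
    then have "(0, l) = (0 :: 'v \<times> (nat \<Rightarrow> int))" using A.Ch_degree_unique[OF u(1)[OF l(1)] _ u(2)[OF l(1)]] by blast
    then show ?thesis by (simp add: zero_prod_def)
  qed
  have zG: "zmul a l \<in> A.\<Gamma>" if "l \<in> A.\<Gamma>" for a l using A.\<Gamma>_int[OF that, of a] by (simp add: zmul_def)
  have \<theta>_0: "\<theta> 0 = 0" using \<theta>_add[OF A.\<Gamma>_0 A.\<Gamma>_0] by simp
  have \<theta>_nat: "\<theta> (zmul (int i) l) = zmul (int i) (\<theta> l)" if l: "l \<in> A.\<Gamma>" for i l
  proof (induction i)
    case 0
    have "zmul 0 l = 0" "zmul 0 (\<theta> l) = 0" by (simp_all add: zmul_def fun_eq_iff)
    then show ?case using \<theta>_0 by (simp only: of_nat_0)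
  next
    case (Suc i)
    have e: "zmul (int (Suc i)) k = zmul (int i) k + k" for k by (simp add: zmul_def fun_eq_iff algebra_simps)
    show ?case unfolding e \<theta>_add[OF zG[OF l] l] Suc by (rule refl)
  qed
  have \<theta>_int: "\<theta> (zmul a l) = zmul a (\<theta> l)" if l: "l \<in> A.\<Gamma>" for a l
  proof (cases "a \<ge> 0")
    case True then show ?thesis using \<theta>_nat[OF l, of "nat a"] by simp
  next
    case False
    then have e: "zmul a k + zmul (int (nat (- a))) k = 0" for k by (simp add: zmul_def fun_eq_iff)
    have "\<theta> (zmul a l) + zmul (int (nat (- a))) (\<theta> l) = 0"
      using \<theta>_add[OF zG[OF l] zG[OF l], of a "int (nat (- a))"] e \<theta>_0 \<theta>_nat[OF l, of "nat (- a)"] by simp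
    then show ?thesis using e[of "\<theta> l"] by (metis add_right_cancel)
  qed
  define \<delta> where "\<delta> i = (\<lambda>j::nat. if j = i then 1 else 0 :: int)" for i
  \<comment> \<open>Torsion modulo \<Gamma> supplies \<open>n\<close> independent degrees, namely
    multiples of the unit vectors, whose images under \<theta> stay independent.\<close>
  have "\<exists>m>0. zmul (int m) (\<delta> i) \<in> A.\<Gamma>" if "i < n" for i
    using A.tors_lat[of "\<delta> i"] that by (auto simp: A.tors_def zmul_def lat_def \<delta>_def)
  then obtain m where m: "\<And>i. i < n \<Longrightarrow> m i > 0" "\<And>i. i < n \<Longrightarrow> zmul (int (m i)) (\<delta> i) \<in> A.\<Gamma>" by metis
  define l where "l i = zmul (int (m i)) (\<delta> i)" for i
  have lG: "l i \<in> A.\<Gamma>" if "i < n" for i using m(2)[OF that] by (simp add: l_def)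
  show ?thesis
  proof (rule independent_in_lat)
    show "\<theta> (l i) \<in> lat n'" if "i < n" for i
      using B.\<Gamma>_lat[of "\<theta> (l i)"] \<theta>[OF lG[OF that]] u(2)[OF lG[OF that]] conj_0 by (auto simp: B.\<Gamma>_def)
    fix a i assume s: "(\<Sum>i<n. zmul (a i) (\<theta> (l i))) = 0" and i: "i < n"
    have sum: "(\<Sum>i<k. zmul (a i) (l i)) \<in> A.\<Gamma> \<and> \<theta> (\<Sum>i<k. zmul (a i) (l i)) = (\<Sum>i<k. zmul (a i) (\<theta> (l i)))"
      if "k \<le> n" for k
      using that
    proof (induction k)
      case 0 show ?case by (simp only: lessThan_0 sum.empty A.\<Gamma>_0 \<theta>_0 simp_thms)
    next
      case (Suc k)
      then have k: "l k \<in> A.\<Gamma>" using lG by simp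
      have IH: "(\<Sum>i<k. zmul (a i) (l i)) \<in> A.\<Gamma>" "\<theta> (\<Sum>i<k. zmul (a i) (l i)) = (\<Sum>i<k. zmul (a i) (\<theta> (l i)))"
        using Suc by simp_all
      show ?case unfolding sum.lessThan_Suc \<theta>_add[OF IH(1) zG[OF k]] IH(2) \<theta>_int[OF k]
        by (rule conjI[OF A.\<Gamma>_add[OF IH(1) zG[OF k]] refl])
    qed
    have z: "(\<Sum>i<n. zmul (a i) (l i)) = 0" using \<theta>_inj sum[of n] s by simp
    have "(\<Sum>i'<k. zmul (a i') (l i')) i = (\<Sum>i'<k. if i' = i then a i' * int (m i') else 0)" for k
      by (induction k) (auto simp: zmul_def l_def \<delta>_def)
    from this[of n] have "a i * int (m i) = 0" using z i by simp
    then show "a i = 0" using m(1)[OF i] by simp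
  qed
qed

section \<open>Isomorphism invariants\<close>

theorem theorem6p2:
  fixes sc :: "'k::field_char_0 \<Rightarrow> 'a::ab_group_add \<Rightarrow> 'a" and br :: "'a \<Rightarrow> 'a \<Rightarrow> 'a"
    and sc' :: "'k \<Rightarrow> 'b::ab_group_add \<Rightarrow> 'b" and br' :: "'b \<Rightarrow> 'b \<Rightarrow> 'b"
    and \<Delta> :: "'v::real_vector set" and n :: nat and gr :: "'v \<Rightarrow> (nat \<Rightarrow> int) \<Rightarrow> 'a set"
    and \<Delta>' :: "'w::real_vector set" and n' :: nat and gr' :: "'w \<Rightarrow> (nat \<Rightarrow> int) \<Rightarrow> 'b set"
    and \<phi> :: "'a \<Rightarrow> 'b"
  assumes "lie_torus sc br \<Delta> n gr" and "fgc sc br" and "centreless br"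
    and "lie_torus sc' br' \<Delta>' n' gr'" and "fgc sc' br'" and "centreless br'"
    and "lie_alg_iso sc br sc' br' \<phi>"
  shows "rs_iso \<Delta> \<Delta>' \<and> n = n' \<and> crk sc br = crk sc' br' \<and> rkv sc br \<Delta> gr = rkv sc' br' \<Delta>' gr'"
proof -
  have T: "fgc_lie_torus sc br \<Delta> n gr" and T': "fgc_lie_torus sc' br' \<Delta>' n' gr'"
    using assms by unfold_locales
  have LI: "lie_iso sc br sc' br' \<phi>" by unfold_locales (rule assms)
  interpret A: fgc_lie_torus sc br \<Delta> n gr by (rule T)
  interpret B: fgc_lie_torus sc' br' \<Delta>' n' gr' by (rule T')
  interpret lie_iso sc br sc' br' \<phi> by (rule LI)
  obtain \<pi> where \<pi>: "linear \<pi>" "\<pi> ` \<Delta> = \<Delta>'"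
    "\<forall>\<beta>\<in>\<Delta>'. B.rk (B.L \<beta>) = (\<Sum>\<alpha>\<in>{\<alpha>\<in>\<Delta>. \<pi> \<alpha> = \<beta>}. A.rk (A.L \<alpha>))"
    using second_grading_comparison[OF T T' LI] by blast
  obtain \<pi>' where \<pi>': "linear \<pi>'" "\<pi>' ` \<Delta>' = \<Delta>"
    using second_grading_comparison[OF T' T lie_iso_inv] by blast
  \<comment> \<open>Each comparison map is only known to be surjective on roots; having one in each
    direction forces injectivity.\<close>
  have inj: "inj_on \<pi> (span \<Delta>)" by (rule mutual_surjection_inj[OF \<pi>(1,2) \<pi>' A.fin_\<Delta>])
  have inj\<Delta>: "inj_on \<pi> \<Delta>" by (rule inj_on_subset[OF inj span_superset])
  have rs: "rs_iso \<Delta> \<Delta>'" unfolding rs_iso_def using \<pi>(1,2) inj by blast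
  have nn: "n = n'" using nullity_le[OF T T' LI] nullity_le[OF T' T lie_iso_inv] by simp
  have crk: "crk sc br = crk sc' br'"
  proof -
    obtain b where b: "cbasis A.Cc UNIV b" using A.ex_hom_basis[OF A.gmod_UNIV] by metis
    have "\<phi> ` UNIV = UNIV" using \<phi>_bij by (simp add: bij_is_surj)
    then have "cbasis B.Cc UNIV (\<phi> ` b)" using cbasis_iso[OF b] by simp
    then show ?thesis using A.C.crank_eq[OF b] B.C.crank_eq by (simp add: crk_def card_image[OF \<phi>_inj])
  qed
  \<comment> \<open>Injectivity makes the fibres singletons, so the sum of ranks over a fibre
    collapses to one term.\<close>
  have rk: "B.rk (B.L (\<pi> \<alpha>)) = A.rk (A.L \<alpha>)" if a: "\<alpha> \<in> \<Delta>" for \<alpha>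
  proof -
    have "{\<alpha>'\<in>\<Delta>. \<pi> \<alpha>' = \<pi> \<alpha>} = {\<alpha>}" using inj_onD[OF inj\<Delta>] a by blast
    then show ?thesis using bspec[OF \<pi>(3), of "\<pi> \<alpha>"] \<pi>(2) a by auto
  qed
  have \<pi>0: "\<pi> 0 = 0" by (rule linear_0[OF \<pi>(1)])
  have imD: "\<pi> ` A.D = B.D"
    using inj_on_image_set_diff[OF inj\<Delta>, of \<Delta> "{0}"] \<pi>(2) \<pi>0 A.zero_\<Delta> by auto
  interpret P: rsys_iso A.D B.D \<pi>
  proof (intro rsys_iso.intro rsys_iso_axioms.intro)
    show "rsys A.D" "rsys B.D" by (rule A.R.rsys_axioms B.R.rsys_axioms)+
    show "inj_on \<pi> (span A.D)" by (rule inj_on_subset[OF inj span_mono]) blast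
  qed (rule \<pi>(1) imD)+
  have rkB: "B.rk (B.L \<beta>) = B.rk (B.L \<beta>')" if "\<beta> \<in> B.D" "\<beta>' \<in> B.D" "B.R.fm \<beta> \<beta> = B.R.fm \<beta>' \<beta>'" for \<beta> \<beta>'
    by (rule B.R.equal_length_invariant[where r = "\<lambda>\<beta>. B.rk (B.L \<beta>)"]) (use that B.rk_s in auto)
  \<comment> \<open>The roots chosen on the two sides need not correspond under \<pi>. They belong
    to the same length class, though, and rank depends only on length.\<close>
  have pick: "A.rk (A.L (SOME \<alpha>. K \<alpha>)) = B.rk (B.L (SOME \<beta>. K' \<beta>))"
    if K: "\<exists>\<alpha>. K \<alpha>" "\<And>\<alpha>. K \<alpha> \<Longrightarrow> \<alpha> \<in> A.D" "\<And>\<alpha>. \<alpha> \<in> A.D \<Longrightarrow> K' (\<pi> \<alpha>) \<longleftrightarrow> K \<alpha>"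
      "\<And>\<beta>. K' \<beta> \<Longrightarrow> \<beta> \<in> B.D" "\<And>\<beta> \<beta>'. K' \<beta> \<Longrightarrow> K' \<beta>' \<Longrightarrow> B.R.fm \<beta> \<beta> = B.R.fm \<beta>' \<beta>'" for K K'
  proof -
    define \<alpha> where "\<alpha> = (SOME \<alpha>. K \<alpha>)"
    define \<beta> where "\<beta> = (SOME \<beta>. K' \<beta>)"
    have a: "K \<alpha>" unfolding \<alpha>_def by (rule someI_ex[OF K(1)])
    then have b': "K' (\<pi> \<alpha>)" using K(2,3) by blast
    then have b: "K' \<beta>" unfolding \<beta>_def by (rule someI)
    have "B.rk (B.L (\<pi> \<alpha>)) = B.rk (B.L \<beta>)" by (rule rkB[OF K(4)[OF b'] K(4)[OF b] K(5)[OF b' b]])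
    then show ?thesis using rk[of \<alpha>] K(2)[OF a] by (simp add: \<alpha>_def \<beta>_def)
  qed
  have sh: "A.rk (A.L (SOME \<alpha>. short_root A.D \<alpha>)) = B.rk (B.L (SOME \<alpha>. short_root B.D \<alpha>))"
    by (rule pick[OF A.R.ex_short _ P.short_iso _ B.R.short_length]) (auto simp: short_root_def)
  have lg: "A.rk (A.L (SOME \<alpha>. long_root A.D \<alpha>)) = B.rk (B.L (SOME \<alpha>. long_root B.D \<alpha>))"
    if "\<exists>\<alpha>. long_root A.D \<alpha>"
    by (rule pick[OF that _ P.long_iso _ B.R.long_length]) (auto simp: long_root_def)
  have ex: "A.rk (A.L (SOME \<alpha>. extralong_root A.D \<alpha>)) = B.rk (B.L (SOME \<alpha>. extralong_root B.D \<alpha>))"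
    if "\<exists>\<alpha>. extralong_root A.D \<alpha>"
    by (rule pick[OF that _ P.extralong_iso _ B.R.extralong_length]) (auto simp: extralong_root_def)
  have "rkv sc br \<Delta> gr = rkv sc' br' \<Delta>' gr'"
  proof (cases "reduced_rs A.D")
    case True
    then show ?thesis
      unfolding rkv_def Let_def P.reduced_iso P.simply_laced_iso P.dim_iso
      using sh lg[OF A.R.ex_long_reduced[OF True]] by (cases "simply_laced A.D") (simp_all only: if_True if_False simp_thms)
  next
    case False
    then show ?thesis
      unfolding rkv_def Let_def P.reduced_iso P.simply_laced_iso P.dim_iso
      using sh lg[OF A.R.ex_long_nonreduced[OF False]] ex[OF A.R.ex_extralong[OF False]]
      by (cases "dim (span A.D) = 1") (simp_all only: if_True if_False simp_thms)
  qed
  then show ?thesis using rs nn crk by blast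
qed

end
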